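(* Assume the Generalized Riemann Hypothesis. Let $A>0$, and for a prime $q$ put $\sigma_A := 1 - A/\log\log q$. Let $x>0$ be given and define $$\mathcal{N}(q,x) = \left\{ \chi \ (\mathrm{mod}\ q) : -\operatorname{Re}\frac{L'}{L}(\sigma_A,\chi) \geqslant \frac{\log\log q}{\log\log\log q}\left(\frac{e^{A}-1}{A}\log\log\log q - x\right)\right\},$$ the set of Dirichlet characters modulo $q$ satisfying this inequality. Then as the prime $q\to\infty$, $$\#\mathcal{N}(q,x) \geqslant q^{1-e^{-x}+o(1)}.$$
   Context: $L(s,\chi)$ is the Dirichlet $L$-function of the Dirichlet character $\chi$. $A$ is an arbitrary fixed positive real number (the standing parameter defining $\sigma_A$). *)

theory Defs
  imports "HOL-Complex_Analysis.Complex_Analysis" "HOL-Number_Theory.Number_Theory"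
begin

definition dirichlet_characters :: "nat \<Rightarrow> (nat \<Rightarrow> complex) set" where
  "dirichlet_characters q = {chi.
     (\<forall>n. chi (n + q) = chi n) \<and>
     (\<forall>m n. chi (m * n) = chi m * chi n) \<and>
     (\<forall>n. chi n \<noteq> 0 \<longleftrightarrow> coprime n q)}"

(* f extends the Dirichlet series of chi holomorphically from Re z > 1 to Re z > c,
   with the possible exception of the points of S. *)
definition continues_L_series ::
    "(nat \<Rightarrow> complex) \<Rightarrow> real \<Rightarrow> complex set \<Rightarrow> (complex \<Rightarrow> complex) \<Rightarrow> bool" where
  "continues_L_series chi c S f \<longleftrightarrow>
     f holomorphic_on ({z. Re z > c} - S) \<and>
     (\<forall>z. Re z > 1 \<longrightarrow> (\<lambda>n. chi (Suc n) * of_nat (Suc n) powr (- z)) sums f z)"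

(* The analytically continued L-function L(s, chi). The only possible pole is s = 1, so S
   is {} or {1}; at s = 1 the case S = {} is forced, and the value there is unspecified
   when chi is principal. The value does not depend on c, S and f: see Dirichlet_L_eqI. *)
definition Dirichlet_L :: "(nat \<Rightarrow> complex) \<Rightarrow> complex \<Rightarrow> complex" where
  "Dirichlet_L chi s = (THE v. \<exists>c S f. S \<subseteq> {1} \<and> c < Re s \<and> s \<notin> S \<and>
     continues_L_series chi c S f \<and> v = f s)"

lemma continues_L_series_unique:
  assumes f: "continues_L_series chi c S f" and g: "continues_L_series chi d T g"
    and S: "S \<subseteq> {1}" "s \<notin> S" and T: "T \<subseteq> {1}" "s \<notin> T"
    and s: "c < Re s" "d < Re s"
  shows "f s = g s"
proof -
  have eq: "f z = g z" if "Re z > 1" for z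
    using f g that unfolding continues_L_series_def by (blast intro: sums_unique2)
  define H where "H = {z. Re z > max c d}"
  define U where "U = H - (S \<union> T)"
  define V where "V = {z. Re z > max (max c d) 1}"
  have fin: "finite (S \<union> T)"
    using S T by (meson finite.emptyI finite.insertI finite_UnI finite_subset)
  have H: "open H" "connected H"
    unfolding H_def
    by (rule open_halfspace_Re_gt, rule convex_connected, rule convex_halfspace_Re_gt)
  have U: "open U" "connected U"
    unfolding U_def using H fin
    by (auto intro!: open_Diff finite_imp_closed connected_open_delete_finite)
  have V: "open V" unfolding V_def by (rule open_halfspace_Re_gt)
  have "complex_of_real (max (max c d) 1 + 1) \<in> V" by (auto simp: V_def max_def)
  then have V_ne: "V \<noteq> {}" by blast
  have "V \<subseteq> U" using S T by (auto simp: V_def U_def H_def)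
  moreover have "f holomorphic_on U" "g holomorphic_on U"
    using f g unfolding continues_L_series_def U_def H_def
    by (auto elim!: holomorphic_on_subset)
  moreover have "s \<in> U" using S T s by (auto simp: U_def H_def)
  ultimately show ?thesis
    using analytic_continuation_open[of V U f g s] U V V_ne eq
    by (auto simp: V_def)
qed

lemma Dirichlet_L_eqI:
  assumes "continues_L_series chi c S f" "S \<subseteq> {1}" "c < Re s" "s \<notin> S"
  shows "Dirichlet_L chi s = f s"
  unfolding Dirichlet_L_def
proof (rule the_equality)
  show "\<exists>c S f'. S \<subseteq> {1} \<and> c < Re s \<and> s \<notin> S \<and> continues_L_series chi c S f' \<and> f s = f' s"
    using assms by blast
next
  fix v assume "\<exists>c S f. S \<subseteq> {1} \<and> c < Re s \<and> s \<notin> S \<and> continues_L_series chi c S f \<and> v = f s"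
  then show "v = f s"
    using assms continues_L_series_unique by blast
qed

definition GRH :: bool where
  "GRH \<longleftrightarrow> (\<forall>q>0. \<forall>chi\<in>dirichlet_characters q. \<forall>s.
     0 < Re s \<and> Re s < 1 \<and> Dirichlet_L chi s = 0 \<longrightarrow> Re s = 1 / 2)"

definition sigma :: "real \<Rightarrow> nat \<Rightarrow> real" where
  "sigma A q = 1 - A / ln (ln (real q))"

definition large_log_deriv_characters :: "real \<Rightarrow> nat \<Rightarrow> real \<Rightarrow> (nat \<Rightarrow> complex) set" where
  "large_log_deriv_characters A q x = {chi \<in> dirichlet_characters q.
     - Re (deriv (Dirichlet_L chi) (of_real (sigma A q)) / Dirichlet_L chi (of_real (sigma A q)))
       \<ge> ln (ln (real q)) / ln (ln (ln (real q))) *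
           ((exp A - 1) / A * ln (ln (ln (real q))) - x)}"

end

theory Submission
  imports Defs "HOL-Real_Asymp.Real_Asymp"
begin

text \<open>
  Pigeonhole on the arguments of \<open>chi p\<close> for the primes \<open>p \<le> ln q\<close> gives
  \<open>q powr (1 - o(1))\<close> characters with \<open>chi p\<close> close to 1 at all these primes, and by Mertens'
  theorem such primes alone produce the main term \<open>ln (ln q) * (exp A - 1) / A\<close>.
  Under GRH, Borel--Caratheodory bounds \<open>L'/L\<close> on a disc about 2 that contains \<open>sigma A q\<close>,
  so \<open>- L'/L\<close> may be replaced by its Taylor polynomial of degree about \<open>5 ln (ln q)\<close> at 2, that is, by
  the Dirichlet series with a positive smooth weight that is negligible beyond a fixed power of \<open>ln q\<close>.
  The primes between \<open>ln q\<close> and this power are handled by a high moment over all characters: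
  the tail exceeds \<open>x ln (ln q) / (2 ln (ln (ln q)))\<close> for fewer characters than the pigeonhole
  provides. So \<open>\<epsilon> = 0\<close> suffices, because the true count is \<open>q powr (1 - o(1))\<close>.
\<close>

subsection \<open>Chebyshev and Mertens estimates\<close>

text \<open>Put \<open>t = ln q\<close>. There are O(t / ln t) forced primes, and cutting the circle
  into about (ln ln t)^2 arcs for each of them costs a factor exp (O(t ln ln ln t / ln t)), which is
  q^o(1). For the primes between t and t^20 the variance is O((ln t)^2 / t), and moments of order
  about t / ln t are available before products of these primes reach q. The exceptional set is
  therefore smaller than q by a factor exp (c t ln ln t / ln t) with some c > 0. The saving has ln
  ln t where the cost has ln ln ln t, and this gap carries the proof. The slack x ln t / ln ln t in
  the threshold pays for everything else: half of it is the height allowed to the tail, and the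
  other half exceeds the remaining errors, which are O(ln t / (ln ln t)^2). An obstacle:
  \<open>GRH\<close> speaks of the open critical strip only, whereas the disc about 2 also meets the
  line Re s = 1, so non-vanishing on that line has to be proved. Setting aside the at most two
  characters with principal square keeps every pole out of that argument.\<close>

lemma prod_primes_dvd:
  fixes P :: "nat set"
  assumes "finite P" "\<And>p. p \<in> P \<Longrightarrow> prime p" "\<And>p. p \<in> P \<Longrightarrow> p dvd N"
  shows "\<Prod>P dvd N"
  using assms
proof (induction P rule: finite_induct)
  case (insert p P)
  have "coprime p (\<Prod>P)"
    using insert by (intro prod_coprime_right) (auto intro!: primes_coprime)
  then show ?case
    using insert by (auto intro!: divides_mult)
qed auto

text \<open>Row 2m+1 has two equal middle entries, and together they are at most the row sum 2 *
  4^m.\<close>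

lemma binomial_odd_le: "(2 * m + 1) choose m \<le> 4 ^ m"
proof -
  have "((2 * m + 1) choose m) + ((2 * m + 1) choose (m + 1)) = (\<Sum>k\<in>{m, m + 1}. (2 * m + 1) choose k)"
    by (subst sum.insert) (auto simp del: binomial_Suc_Suc)
  also have "\<dots> \<le> (\<Sum>k\<le>2 * m + 1. (2 * m + 1) choose k)"
    by (rule sum_mono2) auto
  also have "\<dots> = 2 ^ (2 * m + 1)"
    by (rule choose_row_sum)
  also have "\<dots> = 2 * 4 ^ m"
    by (simp add: power_mult)
  finally show ?thesis
    using binomial_symmetric[of m "2 * m + 1"] by simp
qed

text \<open>Erdos' induction: every prime in (m+1, 2m+1] divides the middle binomial coefficient of
  row 2m+1, so these primes multiply to at most 4^m, and the induction hypothesis at m+1 covers the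
  rest. Even n > 2 are not prime and reduce to n - 1.\<close>

lemma prod_primes_le: "\<Prod>{p. prime p \<and> p \<le> n} \<le> (4::nat) ^ n"
proof (induction n rule: less_induct)
  case (less n)
  have fin: "finite {p. prime p \<and> p \<le> k}" for k :: nat
    by (rule finite_subset[of _ "{..k}"]) auto
  consider "n \<le> 1" | "n = 2" | "even n" "n > 2" | m where "n = 2 * m + 1" "m > 0"
  proof -
    have "n \<le> 1 \<or> n = 2 \<or> (even n \<and> n > 2) \<or> (\<exists>m>0. n = 2 * m + 1)" by presburger
    then show ?thesis using that by metis
  qed
  then show ?case
  proof cases
    case 1
    then have "{p. prime p \<and> p \<le> n} = {}"
      by (auto dest!: prime_ge_2_nat)
    then show ?thesis by (metis One_nat_def Suc_leI prod.empty zero_less_numeral zero_less_power)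
  next
    case 2
    have "{p. prime p \<and> p \<le> n} = {2::nat}"
      using 2 prime_ge_2_nat by (auto intro: antisym)
    then show ?thesis using 2 by simp
  next
    case 3
    have "{p. prime p \<and> p \<le> n} = {p. prime p \<and> p \<le> n - 1}"
      using 3 prime_odd_nat[of n] by (force simp: le_eq_less_or_eq)
    moreover have "\<Prod>{p. prime p \<and> p \<le> n - 1} \<le> 4 ^ (n - 1)"
      using 3 by (intro less) auto
    moreover have "(4::nat) ^ (n - 1) \<le> 4 ^ n"
      by (intro power_increasing) auto
    ultimately show ?thesis by (metis order_trans)
  next
    case 4
    define Q where "Q = {p. prime p \<and> m + 1 < p \<and> p \<le> 2 * m + 1}"
    have split: "{p. prime p \<and> p \<le> n} = {p. prime p \<and> p \<le> m + 1} \<union> Q"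
      using 4 by (auto simp: Q_def)
    have finQ: "finite Q"
      unfolding Q_def by (rule finite_subset[of _ "{..2*m+1}"]) auto
    have dvd: "p dvd (2 * m + 1) choose m" if "p \<in> Q" for p
    proof -
      have p: "prime p" "m + 1 < p" "p \<le> 2 * m + 1" using that by (auto simp: Q_def)
      have "p dvd fact (2 * m + 1)" using p prime_dvd_fact_iff[of p "2 * m + 1"] by blast
      moreover have "fact m * fact (m + 1) * ((2 * m + 1) choose m) = fact (2 * m + 1)"
        using binomial_fact_lemma[of m "2 * m + 1"] by simp
      ultimately have "p dvd fact m * fact (m + 1) * ((2 * m + 1) choose m)" by simp
      then have "p dvd fact m \<or> p dvd fact (m + 1) \<or> p dvd (2 * m + 1) choose m"
        using p(1) by (simp only: prime_dvd_mult_iff disj_assoc)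
      moreover have "\<not> p dvd fact m" "\<not> p dvd fact (m + 1)"
        using p prime_dvd_fact_iff[of p m] prime_dvd_fact_iff[of p "m + 1"] by auto
      ultimately show ?thesis by blast
    qed
    have "\<Prod>Q dvd (2 * m + 1) choose m"
      by (rule prod_primes_dvd) (use finQ dvd in \<open>auto simp: Q_def\<close>)
    then have "\<Prod>Q \<le> (2 * m + 1) choose m"
      by (rule dvd_imp_le) simp
    then have Q: "\<Prod>Q \<le> 4 ^ m" using binomial_odd_le order_trans by blast
    have "\<Prod>{p. prime p \<and> p \<le> n} = \<Prod>{p. prime p \<and> p \<le> m + 1} * \<Prod>Q"
      unfolding split by (rule prod.union_disjoint) (use finQ fin in \<open>auto simp: Q_def\<close>)
    also have "\<dots> \<le> 4 ^ (m + 1) * 4 ^ m"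
      by (rule mult_le_mono) (use Q less[of "m + 1"] 4 in auto)
    finally show ?thesis using 4 by (simp add: power_add mult_2)
  qed
qed

lemma finite_primes_le [simp]: "finite {p. prime p \<and> p \<le> (n::nat)}"
  by (rule finite_subset[of _ "{..n}"]) auto

lemma theta_le: "(\<Sum>p | prime p \<and> p \<le> n. ln (real p)) \<le> real n * ln 4"
proof -
  have "(\<Sum>p | prime p \<and> p \<le> n. ln (real p)) = ln (\<Prod>p | prime p \<and> p \<le> n. real p)"
    by (subst ln_prod) (auto dest: prime_gt_0_nat)
  also have "(\<Prod>p | prime p \<and> p \<le> n. real p) = real (\<Prod>{p. prime p \<and> p \<le> n})"
    by simp
  also have "ln \<dots> \<le> ln (real (4 ^ n))"
    by (subst ln_le_cancel_iff)
       (use prod_primes_le[of n] in \<open>auto intro!: prod_pos simp: prime_gt_0_nat of_nat_le_iff simp del: of_nat_prod of_nat_power\<close>)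
  finally show ?thesis by (simp add: ln_realpow)
qed

text \<open>Each prime above sqrt n contributes at least (ln n) / 2 to Chebyshev's theta, which
  gives 4 n / ln n of them. The primes up to sqrt n number at most sqrt n \<le> 2 n / ln n. Hence
  the constant 6.\<close>

lemma card_primes_le:
  assumes "n \<ge> 2"
  shows "real (card {p. prime p \<and> p \<le> n}) \<le> 6 * real n / ln (real n)"
proof -
  define s where "s = sqrt (real n)"
  define P where "P = {p. prime p \<and> p \<le> n}"
  define Q where "Q = {p \<in> P. real p > s}"
  have finP [simp]: "finite P" by (simp add: P_def)
  have n: "ln (real n) > 0" using assms by simp
  have s: "s \<ge> 0" "s > 0" "s * s = real n" using assms by (auto simp: s_def)
  have ln_s: "ln s = ln (real n) / 2"
    using assms by (simp add: s_def ln_sqrt)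
  have "ln s \<le> s" using s ln_le_minus_one[of s] by linarith
  then have "s * ln (real n) \<le> 2 * (s * s)" using ln_s s mult_left_mono[of "ln (real n)" "2 * s" s] s(1) by linarith
  then have s_le: "s \<le> 2 * real n / ln (real n)" using n s(3) by (simp add: field_simps)
  have "card (P - Q) \<le> card {1..nat \<lfloor>s\<rfloor>}"
  proof (rule card_mono)
    show "P - Q \<subseteq> {1..nat \<lfloor>s\<rfloor>}"
    proof
      fix p assume p: "p \<in> P - Q"
      then have "p \<ge> 1" using prime_gt_0_nat by (auto simp: P_def Suc_le_eq)
      moreover have "real p \<le> s" using p by (auto simp: Q_def)
      ultimately show "p \<in> {1..nat \<lfloor>s\<rfloor>}" by (simp add: le_nat_floor)
    qed
  qed auto
  then have c1: "real (card (P - Q)) \<le> s" using s by (simp add: le_nat_floor) linarith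
  have "real (card Q) * ln s \<le> (\<Sum>p\<in>Q. ln (real p))"
    using s by (intro sum_bounded_below) (auto simp: Q_def)
  also have "\<dots> \<le> (\<Sum>p\<in>P. ln (real p))"
    by (rule sum_mono2) (auto simp: Q_def P_def dest: prime_gt_0_nat)
  also have "\<dots> \<le> real n * ln 4" unfolding P_def by (rule theta_le)
  also have "ln 4 \<le> (2::real)"
  proof -
    have "ln (4::real) = 2 * ln 2" using ln_realpow[of 2 2] by simp
    then show ?thesis using ln_2_less_1 by simp
  qed
  finally have "real (card Q) * ln (real n) \<le> 4 * real n"
    using ln_s by (simp add: mult_left_mono)
  then have c2: "real (card Q) \<le> 4 * real n / ln (real n)" using n by (simp add: field_simps)
  have "card P = card Q + card (P - Q)"
    by (subst card_Un_disjoint[symmetric]) (auto simp: Q_def intro!: arg_cong[of _ _ card])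
  then have "real (card P) \<le> 4 * real n / ln (real n) + 2 * real n / ln (real n)"
    using c1 c2 s_le by linarith
  then show ?thesis by (simp add: P_def add_divide_distrib[symmetric])
qed

section \<open>Prime powers and Mertens' first theorem\<close>

lemma ln_le_powr: "x \<ge> 1 \<Longrightarrow> e > 0 \<Longrightarrow> ln x \<le> x powr e / (e::real)"
  using ln_le_minus_one[of "x powr e"] by (simp add: ln_powr field_simps)

lemma sum_powr_bounded:
  fixes s :: real
  assumes "s < -1"
  obtains C where "C > 0" "\<And>A. finite A \<Longrightarrow> (\<Sum>n\<in>A. real n powr s) \<le> C"
proof -
  have sm: "summable (\<lambda>n. real n powr s)" using assms summable_real_powr_iff by simp
  have "(\<Sum>n\<in>A. real n powr s) \<le> (\<Sum>n. real n powr s)" if "finite A" for A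
    by (rule sum_le_suminf[OF sm that]) auto
  moreover have "0 \<le> (\<Sum>n. real n powr s)" by (rule suminf_nonneg[OF sm]) auto
  ultimately show ?thesis by (intro that[of "(\<Sum>n. real n powr s) + 1"]) force+
qed

lemma sum_power_from_2_le:
  fixes r :: real
  assumes "0 \<le> r" "r \<le> 3/4"
  shows "(\<Sum>j=2..N. r ^ j) \<le> 4 * r ^ 2"
proof -
  have "(\<Sum>j=2..N. r ^ j) * (1 - r) \<le> r ^ 2"
  proof (cases "N \<ge> 2")
    case True
    have "(\<Sum>j=2..N. r ^ j) * (1 - r) = r ^ 2 - r ^ Suc N"
      using True sum_gp_multiplied[of 2 N r] by (simp add: mult.commute)
    then show ?thesis using assms by simp
  qed auto
  moreover have "(\<Sum>j=2..N. r ^ j) * (1/4) \<le> (\<Sum>j=2..N. r ^ j) * (1 - r)"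
    using assms by (intro mult_left_mono sum_nonneg) auto
  ultimately show ?thesis by linarith
qed

text \<open>Prime powers with exponent at least 2 converge absolutely to the right of 1/2. The
  exponent 9/10 is the lower end of the range of \<open>s\<close> used later, so one constant serves
  all of them and prime powers drop out of every estimate.\<close>

lemma mangoldt_nonprime_sum_bounded:
  obtains C :: real where "C > 0"
    "\<And>A. finite A \<Longrightarrow> (\<Sum>n | n \<in> A \<and> \<not> prime n. mangoldt n * real n powr (-9/10)) \<le> C"
proof -
  obtain C where C: "C > 0" "\<And>A. finite A \<Longrightarrow> (\<Sum>n\<in>A. real n powr (-3/2)) \<le> C"
    using sum_powr_bounded[of "-3/2"] by auto
  let ?f = "\<lambda>n. mangoldt n * real n powr (-9/10)"
  have "(\<Sum>n | n \<in> A \<and> \<not> prime n. ?f n) \<le> 40 / 3 * C" if fin: "finite A" for A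
  proof -
    obtain N where N: "A \<subseteq> {..N}" using fin by (metis finite_nat_iff_bounded_le)
    define P where "P = {p. prime p \<and> p \<le> N}"
    define h where "h = (\<lambda>(p::nat,j::nat). p ^ j)"
    have nn: "?f n \<ge> 0" for n by (simp add: mangoldt_nonneg)
    have "(\<Sum>n | n \<in> A \<and> \<not> prime n. ?f n) = (\<Sum>n | n \<in> A \<and> \<not> prime n \<and> primepow n. ?f n)"
      using that by (intro sum.mono_neutral_right) (auto simp: mangoldt_def)
    also have "\<dots> \<le> sum ?f (h ` (P \<times> {2..N}))"
    proof (rule sum_mono2)
      show "{n \<in> A. \<not> prime n \<and> primepow n} \<subseteq> h ` (P \<times> {2..N})"
      proof
        fix n assume n: "n \<in> {n \<in> A. \<not> prime n \<and> primepow n}"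
        then obtain p j where pj: "prime p" "j > 0" "n = p ^ j"
          unfolding primepow_def by auto
        have "j \<noteq> 1" using n pj by auto
        then have j: "j \<ge> 2" using pj by simp
        have "p \<le> p ^ j" "j < p ^ j"
          using pj prime_gt_1_nat[of p] self_le_power[of p j] power_gt_expt[of p j] by simp_all
        then have "p \<le> N" "j \<le> N" using pj n N by auto
        then show "n \<in> h ` (P \<times> {2..N})"
          using pj j by (intro image_eqI[of _ _ "(p, j)"]) (auto simp: h_def P_def)
      qed
    qed (simp_all only: nn P_def finite_imageI finite_cartesian_product finite_primes_le finite_atLeastAtMost)
    also have "\<dots> \<le> sum (?f \<circ> h) (P \<times> {2..N})"
      by (rule sum_image_le) (simp_all only: nn P_def finite_cartesian_product finite_primes_le finite_atLeastAtMost)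
    also have "\<dots> = (\<Sum>p\<in>P. \<Sum>j=2..N. ?f (p ^ j))"
      by (subst sum.cartesian_product) (auto simp: h_def intro!: sum.cong)
    also have "\<dots> \<le> (\<Sum>p\<in>P. 40 / 3 * real p powr (-3/2))"
    proof (rule sum_mono)
      fix p assume "p \<in> P"
      then have p: "prime p" "p \<ge> 2" using prime_ge_2_nat by (auto simp: P_def)
      define r where "r = real p powr (-9/10)"
      have "r \<le> 2 powr (-9/10)" unfolding r_def using p by (intro powr_mono2') auto
      also have "\<dots> \<le> 2 powr (-1/2)" by (intro powr_mono) auto
      also have "\<dots> \<le> (3/4::real)"
      proof -
        have "2 powr (-1/2) = inverse (sqrt (2::real))" by (simp add: powr_minus powr_half_sqrt)
        also have "\<dots> \<le> inverse (4/3)"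
          by (intro le_imp_inverse_le real_le_rsqrt) (simp_all add: power2_eq_square)
        finally show ?thesis by simp
      qed
      finally have r: "0 \<le> r" "r \<le> 3/4" by (auto simp: r_def)
      have "(\<Sum>j=2..N. ?f (p ^ j)) = (\<Sum>j=2..N. ln (real p) * r ^ j)"
        using p by (intro sum.cong refl)
          (auto simp: mangoldt_primepow r_def powr_power powr_realpow[symmetric] powr_powr mult.commute)
      also have "\<dots> \<le> ln (real p) * (4 * r ^ 2)"
        unfolding sum_distrib_left[symmetric] using p r
        by (intro mult_left_mono sum_power_from_2_le) auto
      \<comment> \<open>The logarithm is absorbed by the power 3/10, since 3/10 - 2 * 9/10 = -3/2
        still gives a convergent sum.\<close>
      also have "\<dots> \<le> (real p powr (3/10) / (3/10)) * (4 * r ^ 2)"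
        using p r by (intro mult_right_mono ln_le_powr) auto
      also have "\<dots> = 40 / 3 * (real p powr (3/10) * r ^ 2)" by simp
      also have "real p powr (3/10) * r ^ 2 = real p powr (-3/2)"
        using p by (simp add: r_def powr_power powr_add[symmetric])
      finally show "(\<Sum>j=2..N. ?f (p ^ j)) \<le> 40 / 3 * real p powr (-3/2)" .
    qed
    also have "\<dots> \<le> 40 / 3 * C"
      unfolding sum_distrib_left[symmetric] using C by (auto simp: P_def)
    finally show ?thesis .
  qed
  then show ?thesis using C by (intro that[of "40 / 3 * C"]) auto
qed

text \<open>Write each ln m as the sum of \<open>mangoldt d\<close> over d | m and exchange the
  sums: d has \<open>n div d\<close> multiples up to n.\<close>

lemma ln_fact_eq_mangoldt_sum:
  "ln (fact n :: real) = (\<Sum>d=1..n. mangoldt d * real (n div d))"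
proof -
  have "ln (fact n :: real) = (\<Sum>m=1..n. ln (real m))"
    by (simp add: fact_prod) (subst ln_prod, auto)
  also have "\<dots> = (\<Sum>m=1..n. \<Sum>d | d dvd m. mangoldt d)"
    by (intro sum.cong refl) (simp add: mangoldt_sum)
  also have "\<dots> = (\<Sum>m=1..n. \<Sum>d=1..n. if d dvd m then mangoldt d else 0)"
  proof (rule sum.cong[OF refl])
    fix m assume m: "m \<in> {1..n}"
    have "{d. d dvd m} = {d \<in> {1..n}. d dvd m}"
      using m by (auto dest: dvd_imp_le intro: Nat.gr0I simp: Suc_le_eq)
    then show "(\<Sum>d | d dvd m. mangoldt d) = (\<Sum>d=1..n. if d dvd m then mangoldt d else (0::real))"
      by (simp only: sum.inter_filter finite_atLeastAtMost)
  qed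
  also have "\<dots> = (\<Sum>d=1..n. \<Sum>m=1..n. if d dvd m then mangoldt d else 0)"
    by (rule sum.swap)
  also have "\<dots> = (\<Sum>d=1..n. mangoldt d * real (n div d))"
  proof (rule sum.cong[OF refl])
    fix d assume d: "d \<in> {1..n}"
    have "{m \<in> {1..n}. d dvd m} = (\<lambda>k. d * k) ` {1..n div d}"
    proof (intro equalityI subsetI)
      fix m assume "m \<in> {m \<in> {1..n}. d dvd m}"
      then obtain k where k: "m = d * k" "m \<ge> 1" "m \<le> n" by auto
      then have "k \<le> n div d" using d by (simp add: less_eq_div_iff_mult_less_eq mult.commute)
      then show "m \<in> (\<lambda>k. d * k) ` {1..n div d}" using k by (intro image_eqI[of _ _ k]) (auto intro!: Suc_leI gr0I)
    next
      fix m assume "m \<in> (\<lambda>k. d * k) ` {1..n div d}"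
      then obtain k where k: "m = d * k" "k \<ge> 1" "k \<le> n div d" by (auto simp only: image_iff atLeastAtMost_iff)
      then have "d * k \<le> n" using d by (simp add: less_eq_div_iff_mult_less_eq mult.commute)
      then show "m \<in> {m \<in> {1..n}. d dvd m}" using k d by (auto simp: Suc_le_eq)
    qed
    moreover have "inj_on (\<lambda>k. d * k) {1..n div d}" using d by (auto simp: inj_on_def)
    ultimately have "card {m \<in> {1..n}. d dvd m} = n div d" by (simp add: card_image)
    then show "(\<Sum>m=1..n. if d dvd m then mangoldt d else 0) = mangoldt d * real (n div d)"
      by (simp add: sum.inter_filter[symmetric])
  qed
  finally show ?thesis .
qed

lemma ln_fact_ge: "ln (fact n :: real) \<ge> real n * ln (real n) - real n"
proof (induction n)
  case (Suc n)
  have "real n * ln (real (Suc n)) - real n * ln (real n) \<le> 1"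
  proof (cases "n = 0")
    case False
    have "ln (real (Suc n)) - ln (real n) = ln (1 + 1 / real n)"
      using False by (simp add: ln_divide_pos[symmetric] add_divide_distrib add.commute)
    also have "\<dots> \<le> 1 / real n" by (rule ln_add_one_self_le_self) simp
    finally show ?thesis using False by (simp add: field_simps)
  qed auto
  moreover have "ln (fact (Suc n) :: real) = ln (real (Suc n)) + ln (fact n)"
    by (simp add: ln_mult del: of_nat_Suc)
  ultimately show ?case using Suc by (simp add: algebra_simps)
qed auto

lemma ln_fact_le: "ln (fact n :: real) \<le> real n * ln (real n)"
proof (cases "n = 0")
  case False
  have "ln (fact n :: real) \<le> ln (real n ^ n)"
    using False fact_le_power[of n, where 'a = real] by (subst ln_le_cancel_iff) auto
  then show ?thesis using False by (simp add: ln_realpow)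
qed auto

text \<open>Compare ln n! with n ln n. Rounding n div d up to n/d bounds the full
  \<open>mangoldt\<close> sum from below; rounding it down to n/d - 1 at primes only bounds the
  prime sum from above, the loss being theta(n) \<le> n ln 4. The two sums differ by the bounded
  contribution of prime powers, so each bound transfers to the other sum.\<close>

lemma mertens_prime:
  obtains C :: real where "C > 0"
    "\<And>n. n \<ge> 1 \<Longrightarrow> \<bar>(\<Sum>i=1..n. if prime i then ln (real i) / real i else 0) - ln (real n)\<bar> \<le> C"
    "\<And>n. n \<ge> 1 \<Longrightarrow> \<bar>(\<Sum>i=1..n. mangoldt i / real i) - ln (real n)\<bar> \<le> C"
proof -
  obtain C where C: "C > 0"
    "\<And>A. finite A \<Longrightarrow> (\<Sum>n | n \<in> A \<and> \<not> prime n. mangoldt n * real n powr (-9/10)) \<le> C"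
    using mangoldt_nonprime_sum_bounded by blast
  define M where "M = (\<lambda>n::nat. \<Sum>i=1..n. if prime i then ln (real i) / real i else 0)"
  define L where "L = (\<lambda>n::nat. \<Sum>i=1..n. mangoldt i / real i)"
  have ge: "L n \<ge> ln (real n) - 1" if "n \<ge> 1" for n
  proof -
    have "real n * (ln (real n) - 1) \<le> ln (fact n)"
      using ln_fact_ge[of n] by (simp add: algebra_simps)
    also have "\<dots> = (\<Sum>d=1..n. mangoldt d * real (n div d))" by (rule ln_fact_eq_mangoldt_sum)
    also have "\<dots> \<le> (\<Sum>d=1..n. mangoldt d * (real n / real d))"
      by (intro sum_mono mult_left_mono mangoldt_nonneg) (simp add: of_nat_div_le_of_nat)
    also have "\<dots> = real n * L n" by (simp add: L_def sum_distrib_left mult_ac)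
    finally show ?thesis using that by simp
  qed
  have le: "M n \<le> ln (real n) + 2" if "n \<ge> 1" for n
  proof -
    let ?b = "\<lambda>d. if prime d then ln (real d) else 0"
    have "real n * M n - (\<Sum>d=1..n. ?b d) = (\<Sum>d=1..n. ?b d * (real n / real d - 1))"
      by (simp add: M_def sum_distrib_left sum_subtractf[symmetric]) (intro sum.cong refl, auto simp: algebra_simps)
    also have "\<dots> \<le> (\<Sum>d=1..n. mangoldt d * real (n div d))"
    proof (rule sum_mono)
      fix d assume d: "d \<in> {1..n}"
      have "real n / real d - 1 \<le> real (n div d)"
        using real_of_int_div3[of "int n" "int d"] by (simp flip: of_nat_div)
      moreover have "real n / real d - 1 \<ge> 0" using d by simp
      ultimately show "?b d * (real n / real d - 1) \<le> mangoldt d * real (n div d)"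
        using d by (auto intro!: mult_mono mult_nonneg_nonneg mangoldt_nonneg simp: prime_gt_0_nat)
    qed
    also have "\<dots> \<le> real n * ln (real n)"
      using ln_fact_le[of n] ln_fact_eq_mangoldt_sum[of n] by simp
    finally have "real n * M n \<le> real n * ln (real n) + (\<Sum>d=1..n. ?b d)" by simp
    also have "(\<Sum>d=1..n. ?b d) = (\<Sum>p | prime p \<and> p \<le> n. ln (real p))"
      by (subst sum.inter_filter[symmetric]) (auto intro!: sum.cong simp: prime_gt_0_nat Suc_le_eq)
    also have "\<dots> \<le> real n * ln 4" by (rule theta_le)
    finally have "real n * M n \<le> real n * (ln (real n) + ln 4)" by (simp add: algebra_simps)
    then have "M n \<le> ln (real n) + ln 4" using that by simp
    moreover have "ln (4::real) \<le> 2"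
      using ln_realpow[of 2 2] ln_2_less_1 by simp
    ultimately show ?thesis by simp
  qed
  have diff: "M n \<le> L n" "L n \<le> M n + C" for n
  proof -
    have eq: "L n - M n = (\<Sum>i | i \<in> {1..n} \<and> \<not> prime i. mangoldt i / real i)"
      unfolding L_def M_def sum_subtractf[symmetric] 
      by (subst Collect_conj_eq, simp add: sum.inter_restrict) (intro sum.cong refl, auto)
    show "M n \<le> L n"
      using eq sum_nonneg[of "{i. i \<in> {1..n} \<and> \<not> prime i}" "\<lambda>i. mangoldt i / real i"]
      by (simp add: mangoldt_nonneg)
    have "L n - M n \<le> (\<Sum>i | i \<in> {1..n} \<and> \<not> prime i. mangoldt i * real i powr (-9/10))"
      unfolding eq
    proof (rule sum_mono)
      fix i assume i: "i \<in> {i \<in> {1..n}. \<not> prime i}"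
      have "1 / real i = real i powr (-1)" using i by (simp add: powr_minus_divide)
      also have "\<dots> \<le> real i powr (-9/10)" using i by (intro powr_mono) auto
      finally show "mangoldt i / real i \<le> mangoldt i * real i powr (-9/10)"
        using mult_left_mono[OF _ mangoldt_nonneg[of i]] by fastforce
    qed
    also have "\<dots> \<le> C" by (rule C) simp
    finally show "L n \<le> M n + C" by simp
  qed
  have "\<bar>M n - ln (real n)\<bar> \<le> C + 3" "\<bar>L n - ln (real n)\<bar> \<le> C + 3" if "n \<ge> 1" for n
    using ge[OF that] le[OF that] diff[of n] C(1) by linarith+
  then show ?thesis
    using C(1) by (intro that[of "C + 3"]) (auto simp: L_def M_def)
qed

section \<open>Partial summation against powers of n\<close>

text \<open>This is 1 - exp (-y) \<le> y. It compares a discrete increment of n^c with c n^c d(ln n)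
  and holds for both signs of \<open>c\<close>, so it serves growing and decaying weights
  alike.\<close>

lemma powr_diff_le_ln_diff:
  fixes a b c :: real
  assumes "0 < a" "0 < b"
  shows "b powr c - a powr c \<le> c * (b powr c * (ln b - ln a))"
proof -
  have "a powr c = b powr c * exp (- (c * (ln b - ln a)))"
    using assms by (simp add: powr_def exp_add[symmetric] algebra_simps)
  then have "b powr c - a powr c = b powr c * (1 - exp (- (c * (ln b - ln a))))"
    by (simp add: algebra_simps)
  also have "\<dots> \<le> b powr c * (c * (ln b - ln a))"
    using exp_ge_add_one_self[of "- (c * (ln b - ln a))"] by (intro mult_left_mono) auto
  finally show ?thesis by (simp add: mult_ac)
qed

lemma abel_weighted_sum_ge:
  fixes a :: "nat \<Rightarrow> real"
  assumes M: "\<And>n. n \<ge> 1 \<Longrightarrow> \<bar>(\<Sum>i=1..n. a i) - ln (real n)\<bar> \<le> C" and c: "c > 0" and n: "n \<ge> 1"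
  shows "(\<Sum>i=1..n. a i * real i powr c) \<ge> (real n powr c - 1) / c - 2 * C * real n powr c"
proof -
  define E where "E = (\<lambda>n::nat. (\<Sum>i=1..n. a i) - ln (real n))"
  have C: "C \<ge> 0" using M[of 1] by simp
  \<comment> \<open>The boundary term \<open>E n * real n powr c\<close> is kept in the claim so
    that the induction closes; it is estimated only at the end.\<close>
  have "(\<Sum>i=1..n. a i * real i powr c) \<ge> (real n powr c - 1) / c + E n * real n powr c - C * (real n powr c - 1)"
    using n
  proof (induction n rule: dec_induct)
    case base
    then show ?case by (simp add: E_def)
  next
    case (step n)
    define x y where "x = real n powr c" and "y = real (Suc n) powr c"
    define d where "d = ln (real (Suc n)) - ln (real n)"
    have xy: "x \<le> y" unfolding x_def y_def using c by (intro powr_mono2) auto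
    have a: "a (Suc n) = d + (E (Suc n) - E n)" by (simp add: E_def d_def)
    have "(y - x) / c \<le> y * d"
      using powr_diff_le_ln_diff[of "real n" "real (Suc n)" c] step c
      by (simp add: x_def y_def d_def field_simps del: of_nat_Suc)
    moreover have "E n * (y - x) \<le> C * (y - x)"
      using M[of n] step xy by (intro mult_right_mono) (auto simp: E_def)
    moreover have "(\<Sum>i=1..Suc n. a i * real i powr c) = (\<Sum>i=1..n. a i * real i powr c) + a (Suc n) * y"
      by (simp add: y_def)
    ultimately show ?case
      using step.IH unfolding a x_def[symmetric] y_def[symmetric]
      by (simp add: algebra_simps diff_divide_distrib add_divide_distrib)
  qed
  moreover have "E n * real n powr c \<ge> - C * real n powr c"
    using M[OF n] by (intro mult_right_mono) (auto simp: E_def)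
  ultimately show ?thesis using C by (simp add: algebra_simps)
qed

text \<open>The bound is uniform in n. For a = \<open>mangoldt i / real i\<close> it says that the
  von Mangoldt series at 1 + c is at most 1/c + C, which stands in for the simple pole of zeta at
  1.\<close>

lemma abel_weighted_sum_le:
  fixes a :: "nat \<Rightarrow> real"
  assumes M: "\<And>n. n \<ge> 1 \<Longrightarrow> \<bar>(\<Sum>i=1..n. a i) - ln (real n)\<bar> \<le> C" and c: "c > 0"
  shows "(\<Sum>i=1..n. a i * real i powr (-c)) \<le> 1 / c + C"
proof (cases "n \<ge> 1")
  case n: True
  define E where "E = (\<lambda>n::nat. (\<Sum>i=1..n. a i) - ln (real n))"
  have C: "C \<ge> 0" using M[of 1] by simp
  have "(\<Sum>i=1..n. a i * real i powr (-c)) \<le>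
      (1 - real n powr (-c)) / c + E n * real n powr (-c) + C * (1 - real n powr (-c))"
    using n
  proof (induction n rule: dec_induct)
    case base
    then show ?case by (simp add: E_def)
  next
    case (step n)
    define x y where "x = real n powr (-c)" and "y = real (Suc n) powr (-c)"
    define d where "d = ln (real (Suc n)) - ln (real n)"
    have xy: "x \<ge> y" unfolding x_def y_def using c step by (intro powr_mono2') auto
    have a: "a (Suc n) = d + (E (Suc n) - E n)" by (simp add: E_def d_def)
    have "y * d \<le> (x - y) / c"
      using powr_diff_le_ln_diff[of "real n" "real (Suc n)" "-c"] step c
      by (simp add: x_def y_def d_def field_simps del: of_nat_Suc)
    moreover have "E n * (x - y) \<le> C * (x - y)"
      using M[of n] step xy by (intro mult_right_mono) (auto simp: E_def)
    moreover have "(\<Sum>i=1..Suc n. a i * real i powr (-c)) = (\<Sum>i=1..n. a i * real i powr (-c)) + a (Suc n) * y"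
      by (simp add: y_def)
    ultimately show ?case
      using step.IH unfolding a x_def[symmetric] y_def[symmetric]
      by (simp add: algebra_simps diff_divide_distrib add_divide_distrib)
  qed
  moreover have "E n * real n powr (-c) \<le> C * real n powr (-c)"
    using M[OF n] by (intro mult_right_mono) (auto simp: E_def)
  moreover have "(1 - real n powr (-c)) / c \<le> 1 / c" using c by (intro divide_right_mono) auto
  ultimately show ?thesis using C by (simp add: algebra_simps)
next
  case False
  then show ?thesis using c M[of 1] by simp
qed

subsection \<open>Dirichlet characters to a prime modulus\<close>

lemma character_mult: "chi \<in> dirichlet_characters q \<Longrightarrow> chi (m * n) = chi m * chi n"
  by (simp add: dirichlet_characters_def)

lemma character_eq_0_iff: "chi \<in> dirichlet_characters q \<Longrightarrow> chi n = 0 \<longleftrightarrow> \<not> coprime n q"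
  by (auto simp: dirichlet_characters_def)

lemma character_1 [simp]: "chi \<in> dirichlet_characters q \<Longrightarrow> chi (Suc 0) = 1"
  using character_mult[of chi q 1 1] character_eq_0_iff[of chi q 1] by simp

lemma character_add_mult: "chi \<in> dirichlet_characters q \<Longrightarrow> chi (n + k * q) = chi n"
proof (induction k)
  case (Suc k)
  have "chi (n + k * q + q) = chi (n + k * q)"
    using Suc.prems by (simp add: dirichlet_characters_def)
  then show ?case using Suc by (simp add: algebra_simps)
qed auto

lemma character_mod: "chi \<in> dirichlet_characters q \<Longrightarrow> chi (n mod q) = chi n"
  using character_add_mult[of chi q "n mod q" "n div q"] by (simp add: mult.commute)

lemma character_cong: "chi \<in> dirichlet_characters q \<Longrightarrow> [m = n] (mod q) \<Longrightarrow> chi m = chi n"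
  using character_mod[of chi q m] character_mod[of chi q n] by (simp add: cong_def)

lemma character_power: "chi \<in> dirichlet_characters q \<Longrightarrow> chi (n ^ k) = chi n ^ k"
  by (induction k) (auto simp: character_mult)

text \<open>By Euler's theorem the value is a root of unity; the definition itself only asks that it
  be nonzero.\<close>

lemma norm_character_eq_1:
  assumes chi: "chi \<in> dirichlet_characters q" and n: "coprime n q" and q: "q > 0"
  shows "norm (chi n) = 1"
proof -
  have "chi n ^ totient q = chi (n ^ totient q)" by (simp add: character_power[OF chi])
  also have "\<dots> = chi 1" by (rule character_cong[OF chi]) (rule euler_theorem[OF n])
  finally have "norm (chi n) ^ totient q = 1" using chi by (simp flip: norm_power)
  then show ?thesis using q power_eq_1_iff[of "norm (chi n)" "totient q"] by simp
qed

lemma norm_character_le_1: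
  assumes "chi \<in> dirichlet_characters q" "q > 0"
  shows "norm (chi n) \<le> 1"
  using norm_character_eq_1[OF assms(1) _ assms(2), of n] character_eq_0_iff[OF assms(1), of n]
  by (cases "coprime n q") auto

lemma character_times:
  "\<lbrakk>chi \<in> dirichlet_characters q; psi \<in> dirichlet_characters q\<rbrakk>
    \<Longrightarrow> (\<lambda>n. chi n * psi n) \<in> dirichlet_characters q"
  by (auto simp: dirichlet_characters_def)

lemma character_cnj:
  "chi \<in> dirichlet_characters q \<Longrightarrow> (\<lambda>n. cnj (chi n)) \<in> dirichlet_characters q"
  by (auto simp: dirichlet_characters_def)

lemma character_mult_cnj:
  assumes "chi \<in> dirichlet_characters q" "q > 0" "coprime n q"
  shows "chi n * cnj (chi n) = 1"
  using norm_character_eq_1[OF assms(1,3,2)] complex_norm_square[of "chi n"] by simp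

lemma inj_on_character_times:
  assumes psi: "psi \<in> dirichlet_characters q" and q: "q > 0"
  shows "inj_on (\<lambda>chi n. chi n * psi n) (dirichlet_characters q)"
proof (rule inj_onI)
  fix f g assume fg: "f \<in> dirichlet_characters q" "g \<in> dirichlet_characters q"
    and eq: "(\<lambda>n. f n * psi n) = (\<lambda>n. g n * psi n)"
  show "f = g"
  proof
    fix n
    show "f n = g n"
      using fun_cong[OF eq, of n] character_eq_0_iff[OF fg(1), of n] character_eq_0_iff[OF fg(2), of n]
        character_eq_0_iff[OF psi, of n]
      by (cases "coprime n q") auto
  qed
qed

lemma bij_betw_character_times:
  assumes psi: "psi \<in> dirichlet_characters q" and q: "q > 0" and fin: "finite (dirichlet_characters q)"
  shows "bij_betw (\<lambda>chi n. chi n * psi n) (dirichlet_characters q) (dirichlet_characters q)"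
  unfolding bij_betw_def using inj_on_character_times[OF psi q] psi
  by (auto intro!: endo_inj_surj[OF fin] character_times)

lemma primitive_root_index:
  assumes q: "prime q" and g: "residue_primroot q g" and n: "\<not> q dvd n"
  obtains i where "i < q - 1" "[g ^ i = n] (mod q)"
proof -
  have bij: "bij_betw (\<lambda>i. g ^ i mod q) {..<q - 1} (totatives q)"
    using residue_primroot_is_generator[OF _ g] prime_gt_1_nat[OF q] totient_prime[OF q] by simp
  have "n mod q \<in> totatives q"
    using n q prime_gt_0_nat[OF q] by (auto simp: totatives_prime mod_greater_zero_iff_not_dvd)
  then obtain i where "i < q - 1" "g ^ i mod q = n mod q"
    using bij unfolding bij_betw_def by (metis (no_types, lifting) imageE lessThan_iff)
  then show ?thesis by (intro that[of i]) (auto simp: cong_def)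
qed

text \<open>The chosen exponent is a discrete logarithm of n to the base g. It is determined only
  modulo q - 1, so the value is independent of the choice as soon as
  \<open>z ^ (q - 1) = 1\<close>.\<close>

definition root_character :: "nat \<Rightarrow> nat \<Rightarrow> complex \<Rightarrow> nat \<Rightarrow> complex" where
  "root_character q g z n = (if q dvd n then 0 else z ^ (SOME i. [g ^ i = n] (mod q)))"

lemma root_character_eq:
  assumes q: "prime q" and g: "residue_primroot q g" and z: "z ^ (q - 1) = 1"
    and n: "\<not> q dvd n" and i: "[g ^ i = n] (mod q)"
  shows "root_character q g z n = z ^ i"
proof -
  define j where "j = (SOME i. [g ^ i = n] (mod q))"
  have "[g ^ j = n] (mod q)" unfolding j_def using i by (rule someI)
  then have "[g ^ i = g ^ j] (mod q)" using i cong_sym cong_trans by blast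
  moreover have "coprime q g" "ord q g = q - 1"
    using g q by (auto simp: residue_primroot_def totient_prime)
  ultimately have "[i = j] (mod (q - 1))" using order_divides_expdiff[of q g i j] by simp
  then have "z ^ i = z ^ j"
  proof -
    have "z ^ k = z ^ (k mod (q - 1))" for k
      using z power_add[of z "(q - 1) * (k div (q - 1))" "k mod (q - 1)"] by (simp add: power_mult)
    then show ?thesis using \<open>[i = j] (mod (q - 1))\<close> unfolding cong_def by metis
  qed
  then show ?thesis using n by (simp add: root_character_def j_def)
qed

lemma root_character_in:
  assumes q: "prime q" and g: "residue_primroot q g" and z: "z ^ (q - 1) = 1"
  shows "root_character q g z \<in> dirichlet_characters q"
proof -
  let ?f = "root_character q g z"
  have z0: "z \<noteq> 0" using z prime_gt_1_nat[OF q] by (auto simp: power_0_left split: if_splits)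
  have cop: "coprime n q \<longleftrightarrow> \<not> q dvd n" for n
    using q by (metis coprime_commute prime_imp_coprime_nat coprime_absorb_left not_prime_unit)
  have "?f (n + q) = ?f n" for n
  proof (cases "q dvd n")
    case False
    then obtain i where i: "[g ^ i = n] (mod q)" using primitive_root_index[OF q g] by blast
    then have "[g ^ i = n + q] (mod q)" by (simp add: cong_def)
    then show ?thesis
      using False root_character_eq[OF q g z _ i] root_character_eq[OF q g z, of "n + q" i] by simp
  qed (auto simp: root_character_def)
  moreover have "?f (m * n) = ?f m * ?f n" for m n
  proof (cases "q dvd m \<or> q dvd n")
    case False
    then have mn: "\<not> q dvd m" "\<not> q dvd n" "\<not> q dvd m * n" using q prime_dvd_mult_nat by auto
    obtain i j where ij: "[g ^ i = m] (mod q)" "[g ^ j = n] (mod q)"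
      using primitive_root_index[OF q g] mn by metis
    then have "[g ^ (i + j) = m * n] (mod q)" by (simp add: power_add cong_mult)
    then show ?thesis
      using root_character_eq[OF q g z mn(1) ij(1)] root_character_eq[OF q g z mn(2) ij(2)]
        root_character_eq[OF q g z mn(3), of "i + j"] by (simp add: power_add)
  qed (auto simp: root_character_def)
  moreover have "?f n \<noteq> 0 \<longleftrightarrow> coprime n q" for n
    using z0 by (auto simp: root_character_def cop)
  ultimately show ?thesis by (auto simp: dirichlet_characters_def)
qed

lemma primroot_not_dvd:
  assumes "prime q" "residue_primroot q g" shows "\<not> q dvd g"
  using assms by (auto simp: residue_primroot_def dest!: coprime_common_divisor_nat[of q g q])

text \<open>A character is determined by its value at the primitive root, and every (q-1)-th root of
  unity occurs there. This yields the number of characters and enough of them to separate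
  residues.\<close>

lemma bij_betw_root_character:
  assumes q: "prime q" and g: "residue_primroot q g"
  shows "bij_betw (root_character q g) {z. z ^ (q - 1) = 1} (dirichlet_characters q)"
  unfolding bij_betw_def
proof
  have ng: "\<not> q dvd g" by (rule primroot_not_dvd[OF q g])
  have at_g: "root_character q g z g = z" if "z ^ (q - 1) = 1" for z
    using root_character_eq[OF q g that ng, of 1] by simp
  show "inj_on (root_character q g) {z. z ^ (q - 1) = 1}"
    using at_g by (auto intro!: inj_onI) metis
  show "root_character q g ` {z. z ^ (q - 1) = 1} = dirichlet_characters q"
  proof (intro equalityI subsetI)
    fix chi assume chi: "chi \<in> dirichlet_characters q"
    have cop: "coprime g q" using g by (simp add: residue_primroot_def coprime_commute)
    have "chi g ^ (q - 1) = chi (g ^ (q - 1))" by (simp add: character_power[OF chi])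
    also have "\<dots> = chi 1"
      using euler_theorem[of g q] cop q by (intro character_cong[OF chi]) (simp add: totient_prime)
    finally have z: "chi g ^ (q - 1) = 1" using chi by simp
    have "chi n = root_character q g (chi g) n" for n
    proof (cases "q dvd n")
      case True
      then show ?thesis
        using character_eq_0_iff[OF chi, of n] not_prime_unit[of q] q
        by (auto simp: root_character_def dest!: coprime_common_divisor_nat[of n q q])
    next
      case False
      then obtain i where i: "[g ^ i = n] (mod q)" using primitive_root_index[OF q g] by blast
      show ?thesis
        using root_character_eq[OF q g z False i] character_cong[OF chi i] character_power[OF chi] by simp
    qed
    then show "chi \<in> root_character q g ` {z. z ^ (q - 1) = 1}" using z by blast
  qed (use root_character_in[OF q g] in auto)
qed

lemma primroot_exists:
  assumes "prime (q::nat)" obtains g where "residue_primroot q g"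
  using prime_primitive_root_exists[of q] prime_gt_1_nat[OF assms] assms by auto

lemma finite_characters: "prime q \<Longrightarrow> finite (dirichlet_characters q)"
  and card_characters: "prime q \<Longrightarrow> card (dirichlet_characters q) = q - 1"
proof -
  assume q: "prime q"
  obtain g where g: "residue_primroot q g" using primroot_exists[OF q] .
  have q1: "q - 1 > 0" using prime_gt_1_nat[OF q] by simp
  have "finite {z::complex. z ^ (q - 1) = 1}" "card {z::complex. z ^ (q - 1) = 1} = q - 1"
    using finite_roots_unity[of "q - 1"] card_roots_unity_eq[of "q - 1"] q1 by auto
  then show "finite (dirichlet_characters q)" "card (dirichlet_characters q) = q - 1"
    using bij_betw_root_character[OF q g] bij_betw_finite bij_betw_same_card by metis+
qed

lemma separating_character:
  assumes q: "prime q" and mn: "\<not> q dvd m" "\<not> q dvd n" "m mod q \<noteq> n mod q"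
  obtains chi where "chi \<in> dirichlet_characters q" "chi m \<noteq> chi n"
proof -
  obtain g where g: "residue_primroot q g" using primroot_exists[OF q] .
  obtain i where i: "i < q - 1" "[g ^ i = m] (mod q)" using primitive_root_index[OF q g mn(1)] .
  obtain j where j: "j < q - 1" "[g ^ j = n] (mod q)" using primitive_root_index[OF q g mn(2)] .
  have ij: "i \<noteq> j" using i j mn(3) by (auto simp: cong_def)
  \<comment> \<open>A primitive (q-1)-th root of unity gives a character that is injective on the
    nonzero residues.\<close>
  define z where "z = cis (2 * pi / real (q - 1))"
  have q1: "q - 1 > 0" using prime_gt_1_nat[OF q] by simp
  have zk: "z ^ k = cis (2 * pi * real k / real (q - 1))" for k
    by (simp only: z_def Complex.DeMoivre times_divide_eq_right times_divide_eq_left mult_ac)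
  have "2 * pi * real (q - 1) / real (q - 1) = 2 * pi"
    by (rule nonzero_mult_div_cancel_right) (use q1 in linarith)
  then have z: "z ^ (q - 1) = 1" unfolding zk by simp
  have "inj_on (\<lambda>k. cis (2 * pi * real k / real (q - 1))) {..<q - 1}"
    using Complex.bij_betw_roots_unity[OF q1] by (simp add: bij_betw_def)
  then have "z ^ i \<noteq> z ^ j" using i(1) j(1) ij unfolding zk inj_on_def by blast
  then show ?thesis
    using root_character_eq[OF q g z mn(1) i(2)] root_character_eq[OF q g z mn(2) j(2)]
      root_character_in[OF q g z] that by metis
qed

text \<open>Multiplication by a character \<open>psi\<close> that separates m and n permutes the
  characters but multiplies the sum by \<open>psi m * cnj (psi n)\<close>, which is not 1; so the
  sum vanishes.\<close>

lemma character_orthogonality: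
  assumes q: "prime q" and mn: "\<not> q dvd m" "\<not> q dvd n"
  shows "(\<Sum>chi\<in>dirichlet_characters q. chi m * cnj (chi n)) =
    (if m mod q = n mod q then of_nat (q - 1) else 0)"
proof (cases "m mod q = n mod q")
  case True
  have q0: "q > 0" using prime_gt_0_nat[OF q] .
  have cop: "coprime n q" using q mn(2) by (metis coprime_commute prime_imp_coprime_nat)
  have "chi m * cnj (chi n) = 1" if chi: "chi \<in> dirichlet_characters q" for chi
    using character_cong[OF chi, of m n] True character_mult_cnj[OF chi q0 cop] by (simp add: cong_def)
  then have "(\<Sum>chi\<in>dirichlet_characters q. chi m * cnj (chi n)) = (\<Sum>chi\<in>dirichlet_characters q. 1)"
    by (intro sum.cong) auto
  then show ?thesis using True card_characters[OF q] by simp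
next
  case False
  obtain psi where psi: "psi \<in> dirichlet_characters q" "psi m \<noteq> psi n"
    using separating_character[OF q mn False] .
  have q0: "q > 0" using prime_gt_0_nat[OF q] .
  have cop: "coprime n q" using q mn(2) by (metis coprime_commute prime_imp_coprime_nat)
  define S where "S = (\<Sum>chi\<in>dirichlet_characters q. chi m * cnj (chi n))"
  have "S = (\<Sum>chi\<in>dirichlet_characters q. (chi m * psi m) * cnj (chi n * psi n))"
    unfolding S_def
    using sum.reindex_bij_betw[OF bij_betw_character_times[OF psi(1) q0 finite_characters[OF q]],
        of "\<lambda>chi. chi m * cnj (chi n)"] by simp
  also have "\<dots> = psi m * cnj (psi n) * S"
    by (simp add: S_def sum_distrib_left mult_ac)
  finally have "(1 - psi m * cnj (psi n)) * S = 0" by (simp add: algebra_simps)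
  moreover have "psi m * cnj (psi n) \<noteq> 1"
  proof
    assume "psi m * cnj (psi n) = 1"
    then have "psi m * (psi n * cnj (psi n)) = psi n" by (simp add: mult_ac)
    then show False using psi(2) character_mult_cnj[OF psi(1) q0 cop] by simp
  qed
  ultimately show ?thesis using False by (simp add: S_def)
qed

section \<open>High moments of character sums over primes\<close>

text \<open>For arguments below q congruence is equality, so only the diagonal survives. This is the
  origin of the later restriction \<open>Z ^ k < q\<close> on the order of the moment.\<close>

lemma character_mean_square:
  fixes a :: "nat \<Rightarrow> real"
  assumes q: "prime q" and M: "M \<subseteq> {1..<q}"
  shows "(\<Sum>chi\<in>dirichlet_characters q. norm (\<Sum>m\<in>M. of_real (a m) * chi m) ^ 2) =
    real (q - 1) * (\<Sum>m\<in>M. a m ^ 2)"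
proof -
  have fin: "finite M" using M finite_subset by blast
  have nd: "\<not> q dvd m" if "m \<in> M" for m using M that nat_dvd_not_less[of m q] by fastforce
  have "complex_of_real (\<Sum>chi\<in>dirichlet_characters q. norm (\<Sum>m\<in>M. of_real (a m) * chi m) ^ 2)
    = (\<Sum>chi\<in>dirichlet_characters q. \<Sum>m\<in>M. \<Sum>n\<in>M. of_real (a m) * of_real (a n) * (chi m * cnj (chi n)))"
    by (simp add: complex_norm_square sum_product mult_ac del: of_real_power)
  also have "\<dots> = (\<Sum>m\<in>M. \<Sum>n\<in>M. of_real (a m) * of_real (a n) * (\<Sum>chi\<in>dirichlet_characters q. chi m * cnj (chi n)))"
    by (subst sum.swap, rule sum.cong[OF refl], subst sum.swap) (simp add: sum_distrib_left)
  also have "\<dots> = (\<Sum>m\<in>M. \<Sum>n\<in>M. if n = m then of_real (a m) * of_real (a n) * of_nat (q - 1) else 0)"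
  proof (intro sum.cong refl)
    fix m n assume mn: "m \<in> M" "n \<in> M"
    then have "m mod q = m" "n mod q = n" using M by auto
    then show "of_real (a m) * of_real (a n) * (\<Sum>chi\<in>dirichlet_characters q. chi m * cnj (chi n)) =
        (if n = m then of_real (a m) * of_real (a n) * of_nat (q - 1) else 0)"
      using character_orthogonality[OF q nd[OF mn(1)] nd[OF mn(2)]] by auto
  qed
  also have "\<dots> = of_real (real (q - 1) * (\<Sum>m\<in>M. a m ^ 2))"
    using fin by (simp add: sum_distrib_left power2_eq_square mult_ac)
  finally show ?thesis using of_real_eq_iff by blast
qed

text \<open>The coefficient of m in the k-th power of the Dirichlet polynomial with coefficients
  \<open>a p\<close> at the primes of \<open>P\<close>, that is, a sum over ordered factorisations
  of m into k such primes. Splitting off one prime at a time avoids multinomial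
  coefficients.\<close>

fun prime_convolution :: "nat set \<Rightarrow> (nat \<Rightarrow> real) \<Rightarrow> nat \<Rightarrow> nat \<Rightarrow> real" where
  "prime_convolution P a 0 m = (if m = 1 then 1 else 0)"
| "prime_convolution P a (Suc k) m = (\<Sum>p | p \<in> P \<and> p dvd m. a p * prime_convolution P a k (m div p))"

lemma prime_convolution_support:
  assumes "\<And>p. p \<in> P \<Longrightarrow> prime p \<and> p \<le> Z" "prime_convolution P a k m \<noteq> 0"
  shows "m \<in> {1..Z ^ k}" "size (prime_factorization m) = k"
proof -
  have "m \<in> {1..Z ^ k} \<and> size (prime_factorization m) = k"
    using assms(2)
  proof (induction k arbitrary: m)
    case (Suc k)
    then obtain p where p: "p \<in> P" "p dvd m" "prime_convolution P a k (m div p) \<noteq> 0"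
      by (auto elim!: sum.not_neutral_contains_not_neutral)
    have m: "m = p * (m div p)" using p by simp
    have pr: "prime p" "p \<le> Z" using assms(1) p by auto
    have IH: "m div p \<in> {1..Z ^ k}" "size (prime_factorization (m div p)) = k" using Suc.IH[OF p(3)] by auto
    have "prime_factorization m = prime_factorization p + prime_factorization (m div p)"
      using pr IH by (subst m, subst prime_factorization_mult) (auto simp: prime_gt_0_nat)
    then have "size (prime_factorization m) = Suc k" using IH pr by (simp add: prime_factorization_prime)
    moreover have "m \<le> Z * Z ^ k" using IH pr by (subst m, intro mult_le_mono) auto
    moreover have "m \<ge> 1" using IH pr m by (metis Suc_leI One_nat_def atLeastAtMost_iff mult_is_0 neq0_conv not_one_le_zero prime_gt_0_nat)
    ultimately show ?case by simp
  qed (auto split: if_splits)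
  then show "m \<in> {1..Z ^ k}" "size (prime_factorization m) = k" by auto
qed

text \<open>The substitution m = p * m'. The support condition on \<open>F\<close> discards
  cofactors m' beyond Z^k, which still occur on the left for primes p smaller than Z.\<close>

lemma sum_prime_divisors_reindex:
  fixes F :: "nat \<Rightarrow> nat \<Rightarrow> 'b::comm_monoid_add"
  assumes P: "finite P" "\<And>p. p \<in> P \<Longrightarrow> prime p \<and> p \<le> Z"
    and F: "\<And>p m. F p m \<noteq> 0 \<Longrightarrow> m \<in> {1..Z ^ k}"
  shows "(\<Sum>m=1..Z ^ Suc k. \<Sum>p | p \<in> P \<and> p dvd m. F p (m div p)) = (\<Sum>p\<in>P. \<Sum>m=1..Z ^ k. F p m)"
proof -
  have "(\<Sum>m=1..Z ^ Suc k. \<Sum>p | p \<in> P \<and> p dvd m. F p (m div p)) =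
     (\<Sum>m=1..Z ^ Suc k. \<Sum>p\<in>P. if p dvd m then F p (m div p) else 0)"
    using P by (simp add: sum.inter_filter)
  also have "\<dots> = (\<Sum>p\<in>P. \<Sum>m=1..Z ^ Suc k. if p dvd m then F p (m div p) else 0)"
    by (rule sum.swap)
  also have "\<dots> = (\<Sum>p\<in>P. \<Sum>m=1..Z ^ k. F p m)"
  proof (rule sum.cong[OF refl])
    fix p assume p: "p \<in> P"
    have pr: "p > 0" "p \<le> Z" using P(2)[OF p] prime_gt_0_nat by auto
    have "(\<Sum>m=1..Z ^ k. F p m) = (\<Sum>m\<in>(\<lambda>m. p * m) ` {1..Z ^ k}. F p (m div p))"
      using pr by (subst sum.reindex) (auto simp: inj_on_def)
    also have "\<dots> = (\<Sum>m=1..Z ^ Suc k. if p dvd m then F p (m div p) else 0)"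
    proof (rule sum.mono_neutral_cong_left)
      show "(\<lambda>m. p * m) ` {1..Z ^ k} \<subseteq> {1..Z ^ Suc k}"
        using pr by (auto intro!: mult_le_mono simp: Suc_le_eq)
      show "\<forall>m\<in>{1..Z ^ Suc k} - (\<lambda>m. p * m) ` {1..Z ^ k}. (if p dvd m then F p (m div p) else 0) = 0"
      proof
        fix m assume m: "m \<in> {1..Z ^ Suc k} - (\<lambda>m. p * m) ` {1..Z ^ k}"
        have "F p (m div p) = 0" if "p dvd m"
          
        proof -
          from \<open>p dvd m\<close> obtain j where j: "m = p * j" by blast
          then have "j \<notin> {1..Z ^ k}" using m by blast
          then show ?thesis using F[of p j] j pr by auto
        qed
        then show "(if p dvd m then F p (m div p) else 0) = 0" by simp
      qed
    qed auto
    finally show "(\<Sum>m=1..Z ^ Suc k. if p dvd m then F p (m div p) else 0) = (\<Sum>m=1..Z ^ k. F p m)" ..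
  qed
  finally show ?thesis .
qed

lemma character_sum_power:
  assumes P: "finite P" "\<And>p. p \<in> P \<Longrightarrow> prime p \<and> p \<le> Z" and chi: "chi \<in> dirichlet_characters q"
  shows "(\<Sum>p\<in>P. of_real (a p) * chi p) ^ k =
    (\<Sum>m=1..Z ^ k. of_real (prime_convolution P a k m) * chi m)"
proof (induction k)
  case 0
  then show ?case using chi by simp
next
  case (Suc k)
  have "(\<Sum>m=1..Z ^ Suc k. of_real (prime_convolution P a (Suc k) m) * chi m) =
     (\<Sum>m=1..Z ^ Suc k. \<Sum>p | p \<in> P \<and> p dvd m.
        of_real (a p) * of_real (prime_convolution P a k (m div p)) * (chi p * chi (m div p)))"
    by (intro sum.cong refl) (auto simp: sum_distrib_right character_mult[OF chi, symmetric] intro!: sum.cong)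
  also have "\<dots> = (\<Sum>p\<in>P. \<Sum>m=1..Z ^ k. of_real (a p) * of_real (prime_convolution P a k m) * (chi p * chi m))"
    by (rule sum_prime_divisors_reindex[OF P]) (use prime_convolution_support(1)[OF P(2)] in auto)
  also have "\<dots> = (\<Sum>p\<in>P. of_real (a p) * chi p) * (\<Sum>m=1..Z ^ k. of_real (prime_convolution P a k m) * chi m)"
    by (simp add: sum_product mult_ac)
  finally show ?case using Suc by simp
qed

text \<open>Cauchy-Schwarz at every step of the recursion: an m in the support has exactly k + 1
  prime factors with multiplicity, hence at most k + 1 terms in its sum. The factors 1, 2, ..., k
  accumulate to k!, the size of a Gaussian moment.\<close>

lemma prime_convolution_square_sum:
  assumes P: "finite P" "\<And>p. p \<in> P \<Longrightarrow> prime p \<and> p \<le> Z"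
  shows "(\<Sum>m=1..Z ^ k. prime_convolution P a k m ^ 2) \<le> fact k * (\<Sum>p\<in>P. a p ^ 2) ^ k"
proof (induction k)
  case (Suc k)
  let ?c = "prime_convolution P a"
  have "(\<Sum>m=1..Z ^ Suc k. ?c (Suc k) m ^ 2) \<le>
     (\<Sum>m=1..Z ^ Suc k. real (Suc k) * (\<Sum>p | p \<in> P \<and> p dvd m. (a p * ?c k (m div p)) ^ 2))"
  proof (rule sum_mono)
    fix m assume "m \<in> {1..Z ^ Suc k}"
    show "?c (Suc k) m ^ 2 \<le> real (Suc k) * (\<Sum>p | p \<in> P \<and> p dvd m. (a p * ?c k (m div p)) ^ 2)"
    proof (cases "?c (Suc k) m = 0")
      case True
      then show ?thesis by (simp add: sum_nonneg del: prime_convolution.simps of_nat_Suc)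
    next
      case False
      have sup: "m \<in> {1..Z ^ Suc k}" "size (prime_factorization m) = Suc k"
        using prime_convolution_support[OF P(2) False] by auto
      have "card {p. p \<in> P \<and> p dvd m} \<le> card (prime_factors m)"
        using sup P(2) by (intro card_mono) (auto simp: prime_factors_dvd)
      also have "\<dots> \<le> Suc k"
        using sup(2) size_multiset_overloaded_eq[of "prime_factorization m"]
          sum_mono[of "prime_factors m" "\<lambda>_. 1" "count (prime_factorization m)"]
        by (auto simp: Suc_le_eq)
      finally have c: "real (card {p. p \<in> P \<and> p dvd m}) \<le> real (Suc k)" by simp
      have "?c (Suc k) m ^ 2 \<le> real (card {p. p \<in> P \<and> p dvd m}) * (\<Sum>p | p \<in> P \<and> p dvd m. (a p * ?c k (m div p)) ^ 2)"
        using sum_squared_le_sum_of_squares[where I = "{p. p \<in> P \<and> p dvd m}" and f = "\<lambda>p. a p * ?c k (m div p)"]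
        by (simp add: mult.commute)
      also have "\<dots> \<le> real (Suc k) * (\<Sum>p | p \<in> P \<and> p dvd m. (a p * ?c k (m div p)) ^ 2)"
        using c by (intro mult_right_mono sum_nonneg) auto
      finally show ?thesis .
    qed
  qed
  also have "\<dots> = real (Suc k) * (\<Sum>p\<in>P. \<Sum>m=1..Z ^ k. (a p * ?c k m) ^ 2)"
    unfolding sum_distrib_left[symmetric]
    by (subst sum_prime_divisors_reindex[OF P, where k = k])
       (use prime_convolution_support(1)[OF P(2)] in auto)
  also have "(\<Sum>p\<in>P. \<Sum>m=1..Z ^ k. (a p * ?c k m) ^ 2) = (\<Sum>p\<in>P. a p ^ 2) * (\<Sum>m=1..Z ^ k. ?c k m ^ 2)"
    by (simp add: sum_product power_mult_distrib)
  also have "real (Suc k) * \<dots> \<le> real (Suc k) * ((\<Sum>p\<in>P. a p ^ 2) * (fact k * (\<Sum>p\<in>P. a p ^ 2) ^ k))"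
    using Suc by (intro mult_left_mono sum_nonneg) auto
  finally show ?case by (simp add: mult_ac)
qed auto

lemma character_moment:
  assumes q: "prime q" and P: "finite P" "\<And>p. p \<in> P \<Longrightarrow> prime p \<and> p \<le> Z" and Z: "Z ^ k < q"
  shows "(\<Sum>chi\<in>dirichlet_characters q. norm (\<Sum>p\<in>P. of_real (a p) * chi p) ^ (2 * k)) \<le>
    real (q - 1) * (fact k * (\<Sum>p\<in>P. a p ^ 2) ^ k)"
proof -
  have "(\<Sum>chi\<in>dirichlet_characters q. norm (\<Sum>p\<in>P. of_real (a p) * chi p) ^ (2 * k)) =
    (\<Sum>chi\<in>dirichlet_characters q. norm (\<Sum>m=1..Z ^ k. of_real (prime_convolution P a k m) * chi m) ^ 2)"
    by (intro sum.cong refl) (subst character_sum_power[OF P, symmetric], auto simp: norm_power power_mult[symmetric] mult.commute)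
  also have "\<dots> = real (q - 1) * (\<Sum>m=1..Z ^ k. prime_convolution P a k m ^ 2)"
    using Z by (intro character_mean_square[OF q]) auto
  also have "\<dots> \<le> real (q - 1) * (fact k * (\<Sum>p\<in>P. a p ^ 2) ^ k)"
    by (intro mult_left_mono prime_convolution_square_sum[OF P]) auto
  finally show ?thesis .
qed

text \<open>Markov's inequality for the moment of order 2k, with k! \<le> k^k. It is useful once k
  times the variance is much smaller than V^2.\<close>

lemma card_large_character_sums:
  assumes q: "prime q" and P: "finite P" "\<And>p. p \<in> P \<Longrightarrow> prime p \<and> p \<le> Z" and Z: "Z ^ k < q" and V: "V > 0"
  shows "real (card {chi \<in> dirichlet_characters q. norm (\<Sum>p\<in>P. of_real (a p) * chi p) > V}) \<le>
    real q * (real k * (\<Sum>p\<in>P. a p ^ 2) / V ^ 2) ^ k"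
proof -
  define B where "B = {chi \<in> dirichlet_characters q. norm (\<Sum>p\<in>P. of_real (a p) * chi p) > V}"
  have "real (card B) * V ^ (2 * k) \<le> (\<Sum>chi\<in>B. norm (\<Sum>p\<in>P. of_real (a p) * chi p) ^ (2 * k))"
    using V by (intro sum_bounded_below power_mono) (auto simp: B_def)
  also have "\<dots> \<le> (\<Sum>chi\<in>dirichlet_characters q. norm (\<Sum>p\<in>P. of_real (a p) * chi p) ^ (2 * k))"
    by (intro sum_mono2 finite_characters[OF q]) (auto simp: B_def)
  also have "\<dots> \<le> real (q - 1) * (fact k * (\<Sum>p\<in>P. a p ^ 2) ^ k)"
    by (rule character_moment[OF q P Z])
  also have "\<dots> \<le> real q * (real k ^ k * (\<Sum>p\<in>P. a p ^ 2) ^ k)"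
    using fact_le_power[of k, where 'a = real]
    by (intro mult_mono mult_right_mono) (auto simp: sum_nonneg)
  finally have "real (card B) \<le> real q * (real k ^ k * (\<Sum>p\<in>P. a p ^ 2) ^ k) / V ^ (2 * k)"
    using V by (simp add: pos_le_divide_eq)
  then show ?thesis by (simp add: B_def power_divide power_mult_distrib power_mult)
qed

section \<open>Characters close to 1 at small primes, and characters with principal square\<close>

lemma norm_exp_i_diff_le: "norm (exp (\<i> * of_real a) - exp (\<i> * of_real b)) \<le> \<bar>a - b\<bar>"
proof -
  have "exp (\<i> * of_real a) - exp (\<i> * of_real b) = exp (\<i> * of_real b) * (exp (\<i> * of_real (a - b)) - 1)"
    by (simp add: algebra_simps exp_diff)
  then have "norm (exp (\<i> * of_real a) - exp (\<i> * of_real b)) = 2 * \<bar>sin ((a - b) / 2)\<bar>"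
    using dist_exp_i_1[of "a - b"] by (simp add: norm_mult)
  also have "\<dots> \<le> 2 * \<bar>(a - b) / 2\<bar>" using abs_sin_x_le_abs_x[of "(a - b) / 2"] by linarith
  finally show ?thesis by simp
qed

lemma pigeonhole_fibre:
  assumes "finite X" "f ` X \<subseteq> Y" "finite Y" "Y \<noteq> {}"
  obtains y where "y \<in> Y" "card X \<le> card {x \<in> X. f x = y} * card Y"
proof -
  have "\<exists>y\<in>Y. card X \<le> card {x \<in> X. f x = y} * card Y"
  proof (rule ccontr)
    assume "\<not> ?thesis"
    then have lt: "card {x \<in> X. f x = y} * card Y < card X" if "y \<in> Y" for y
      using that by (meson linorder_not_le)
    have X: "X = (\<Union>y\<in>Y. {x \<in> X. f x = y})" using assms(2) by auto
    have "card X * card Y = (\<Sum>y\<in>Y. card {x \<in> X. f x = y}) * card Y"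
      using assms by (subst X, subst card_UN_disjoint) auto
    also have "\<dots> = (\<Sum>y\<in>Y. card {x \<in> X. f x = y} * card Y)" by (rule sum_distrib_right)
    also have "\<dots> < (\<Sum>y\<in>Y. card X)" by (rule sum_strict_mono) (use assms lt in auto)
    finally show False by simp
  qed
  then show ?thesis using that by blast
qed

text \<open>Pigeonhole on the arguments of the values at \<open>P\<close>, followed by division by one member of
  the most populated box.\<close>

lemma many_characters_near_1:
  assumes q: "prime q" and P: "finite P" "\<And>p. p \<in> P \<Longrightarrow> \<not> q dvd p" and N: "N \<ge> 1"
  obtains S where "S \<subseteq> dirichlet_characters q" "q - 1 \<le> card S * N ^ card P"
    "\<And>chi p. \<lbrakk>chi \<in> S; p \<in> P\<rbrakk> \<Longrightarrow> norm (chi p - 1) \<le> 2 * pi / real N"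
proof -
  let ?X = "dirichlet_characters q"
  define f where "f = (\<lambda>(chi :: nat \<Rightarrow> complex) p. nat \<lfloor>real N * Arg2pi (chi p) / (2 * pi)\<rfloor>)"
  define F where "F = (\<lambda>chi. restrict (f chi) P)"
  define Y where "Y = PiE P (\<lambda>_. {..<N})"
  have q0: "q > 0" using prime_gt_0_nat[OF q] .
  have bd: "0 \<le> real N * Arg2pi z / (2 * pi)" "real N * Arg2pi z / (2 * pi) < real N" for z
    using Arg2pi_ge_0[of z] Arg2pi_lt_2pi[of z] N by (auto simp: field_simps)
  have sub: "F ` ?X \<subseteq> Y"
  proof
    fix y assume "y \<in> F ` ?X"
    then obtain chi where y: "y = F chi" by blast
    have "f chi p < N" for p
      using bd[of "chi p"] unfolding f_def by linarith
    then show "y \<in> Y" by (auto simp: y F_def Y_def)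
  qed
  have Y: "finite Y" "Y \<noteq> {}" "card Y = N ^ card P"
    using P N by (auto simp: Y_def finite_PiE card_PiE PiE_eq_empty_iff lessThan_empty_iff)
  obtain y where y: "y \<in> Y" "card ?X \<le> card {chi \<in> ?X. F chi = y} * card Y"
    using pigeonhole_fibre[OF finite_characters[OF q] sub Y(1,2)] .
  define T where "T = {chi \<in> ?X. F chi = y}"
  have cop: "coprime p q" if "p \<in> P" for p
    using P(2)[OF that] q by (metis coprime_commute prime_imp_coprime_nat)
  have close: "norm (chi p - psi p) \<le> 2 * pi / real N" if "chi \<in> T" "psi \<in> T" "p \<in> P" for chi psi p
  proof -
    have "f chi p = F chi p" "f psi p = F psi p" using that by (auto simp: F_def)
    then have eq: "f chi p = f psi p" using that by (simp add: T_def)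
    then have "\<lfloor>real N * Arg2pi (chi p) / (2 * pi)\<rfloor> = \<lfloor>real N * Arg2pi (psi p) / (2 * pi)\<rfloor>"
      using bd[of "chi p"] bd[of "psi p"] by (simp add: f_def nat_eq_iff)
    then have "\<bar>real N * Arg2pi (chi p) / (2 * pi) - real N * Arg2pi (psi p) / (2 * pi)\<bar> < 1"
      by linarith
    then have "\<bar>real N / (2 * pi) * (Arg2pi (chi p) - Arg2pi (psi p))\<bar> < 1"
      by (simp add: algebra_simps diff_divide_distrib)
    then have "real N / (2 * pi) * \<bar>Arg2pi (chi p) - Arg2pi (psi p)\<bar> < 1"
      using N by (simp add: abs_mult)
    then have "\<bar>Arg2pi (chi p) - Arg2pi (psi p)\<bar> \<le> 2 * pi / real N"
      using N by (simp add: field_simps)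
    moreover have "chi p = exp (\<i> * of_real (Arg2pi (chi p)))" "psi p = exp (\<i> * of_real (Arg2pi (psi p)))"
      using Arg2pi_eq[of "chi p"] Arg2pi_eq[of "psi p"] norm_character_eq_1[OF _ cop q0] that
      by (auto simp: T_def)
    ultimately show ?thesis using norm_exp_i_diff_le[of "Arg2pi (chi p)" "Arg2pi (psi p)"] by simp
  qed
  have "card ?X > 0" using card_characters[OF q] prime_gt_1_nat[OF q] by simp
  then have "T \<noteq> {}" using y by (auto simp: T_def[symmetric])
  then obtain psi where psi: "psi \<in> T" by blast
  then have psiX: "psi \<in> ?X" by (simp add: T_def)
  define S where "S = (\<lambda>chi n. chi n * cnj (psi n)) ` T"
  show ?thesis
  proof (rule that[of S])
    show "S \<subseteq> ?X" using character_times character_cnj[OF psiX] by (auto simp: S_def T_def)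
    have "inj_on (\<lambda>chi n. chi n * cnj (psi n)) T"
      using inj_on_character_times[OF character_cnj[OF psiX] q0] by (rule inj_on_subset) (auto simp: T_def)
    then have "card S = card T" by (simp add: S_def card_image)
    then show "q - 1 \<le> card S * N ^ card P"
      using y Y card_characters[OF q] by (simp add: T_def)
    fix chi p assume "chi \<in> S" "p \<in> P"
    then obtain chi' where chi': "chi' \<in> T" "chi p = chi' p * cnj (psi p)" by (auto simp: S_def)
    have "chi p - 1 = (chi' p - psi p) * cnj (psi p)"
      using character_mult_cnj[OF psiX q0 cop] \<open>p \<in> P\<close> chi' by (simp add: algebra_simps)
    then have "norm (chi p - 1) = norm (chi' p - psi p)"
      using norm_character_eq_1[OF psiX cop q0] \<open>p \<in> P\<close> by (simp add: norm_mult)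
    then show "norm (chi p - 1) \<le> 2 * pi / real N" using close[OF chi'(1) psi \<open>p \<in> P\<close>] by simp
  qed
qed

text \<open>Such a character takes the value 1 or -1 at a primitive root: it is the principal or the
  quadratic one. These are the characters set aside in the final count.\<close>

lemma card_characters_square_principal:
  assumes q: "prime q"
  shows "card {chi \<in> dirichlet_characters q. \<forall>n. \<not> q dvd n \<longrightarrow> chi n ^ 2 = 1} \<le> 2"
proof -
  obtain g where g: "residue_primroot q g" using primroot_exists[OF q] .
  define B where "B = {chi \<in> dirichlet_characters q. \<forall>n. \<not> q dvd n \<longrightarrow> chi n ^ 2 = 1}"
  have bij: "bij_betw (root_character q g) {z. z ^ (q - 1) = 1} (dirichlet_characters q)"
    by (rule bij_betw_root_character[OF q g])
  have "B \<subseteq> root_character q g ` {1, -1}"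
  proof
    fix chi assume "chi \<in> B"
    then have chi: "chi \<in> dirichlet_characters q" "chi g ^ 2 = 1"
      using primroot_not_dvd[OF q g] by (auto simp: B_def)
    obtain z where z: "z ^ (q - 1) = 1" "chi = root_character q g z"
      using bij chi(1) by (auto simp: bij_betw_def)
    have "chi g = z"
      using root_character_eq[OF q g z(1) primroot_not_dvd[OF q g], of 1] z(2) by simp
    then have "z = 1 \<or> z = -1" using chi(2) by (simp add: power2_eq_1_iff)
    then show "chi \<in> root_character q g ` {1, -1}" using z(2) by auto
  qed
  then have "card B \<le> card (root_character q g ` {1, -1})" by (intro card_mono) auto
  also have "\<dots> \<le> card {1, -1 :: complex}" by (rule card_image_le) simp
  also have "\<dots> \<le> 2" by (simp add: card_insert_if)
  finally show ?thesis by (simp add: B_def)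
qed

subsection \<open>Dirichlet series\<close>

text \<open>The sum starts at index 0, which is harmless because
  \<open>0 powr (- s) = 0\<close>.\<close>

definition dirichlet_series :: "(nat \<Rightarrow> complex) \<Rightarrow> complex \<Rightarrow> complex" where
  "dirichlet_series a s = (\<Sum>n. a n * of_nat n powr (- s))"

lemma norm_nat_powr: "norm (of_nat n powr (- s) :: complex) = real n powr (- Re s)"
  using norm_powr_real_powr[of "of_nat n" "- s"] by simp

lemma summable_ln_powr:
  fixes c :: real
  assumes "c > 1"
  shows "summable (\<lambda>n. (1 + ln (real n)) * real n powr (- c))"
proof (rule summable_comparison_test_ev)
  define d where "d = (c - 1) / 2"
  have d: "d > 0" using assms by (simp add: d_def)
  show "summable (\<lambda>n. (1 + 1 / d) * real n powr (d - c))"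
    using assms by (intro summable_mult) (simp add: summable_real_powr_iff d_def field_simps)
  show "\<forall>\<^sub>F n in sequentially. norm ((1 + ln (real n)) * real n powr (- c)) \<le> (1 + 1 / d) * real n powr (d - c)"
    using eventually_ge_at_top[of 1]
  proof eventually_elim
    case (elim n)
    have "1 \<le> real n powr d" using elim d by (simp add: ge_one_powr_ge_zero)
    moreover have "ln (real n) \<le> real n powr d / d" using elim d by (intro ln_le_powr) auto
    ultimately have "1 + ln (real n) \<le> (1 + 1 / d) * real n powr d"
      by (simp add: algebra_simps)
    then have "(1 + ln (real n)) * real n powr (- c) \<le> (1 + 1 / d) * real n powr d * real n powr (- c)"
      by (intro mult_right_mono) auto
    also have "\<dots> = (1 + 1 / d) * real n powr (d - c)" by (simp add: powr_add[symmetric])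
    finally show ?case using elim by simp
  qed
qed

context
  fixes a :: "nat \<Rightarrow> complex"
  assumes a: "\<And>n. n \<ge> 1 \<Longrightarrow> norm (a n) \<le> 1 + ln (real n)"
begin

text \<open>The growth 1 + ln n allowed to the coefficients covers both \<open>chi n\<close> and
  \<open>mangoldt n * chi n\<close>, so L and its logarithmic derivative share one theory.\<close>

lemma dirichlet_series_term_le:
  assumes "Re s \<ge> c"
  shows "norm (a n * of_nat n powr (- s)) \<le> (1 + ln (real n)) * real n powr (- c)"
proof (cases "n \<ge> 1")
  case True
  have "real n powr (- Re s) \<le> real n powr (- c)" using True assms by (intro powr_mono) auto
  then show ?thesis
    using a[OF True] True unfolding norm_mult norm_nat_powr by (intro mult_mono) auto
qed (simp add: not_less_eq_eq)

lemma dirichlet_series_summable_norm: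
  assumes "Re s > 1" shows "summable (\<lambda>n. norm (a n * of_nat n powr (- s)))"
  by (rule summable_comparison_test'[OF summable_ln_powr[OF assms], of 0])
     (use dirichlet_series_term_le[of "Re s" s] in auto)

lemma dirichlet_series_sums:
  assumes "Re s > 1" shows "(\<lambda>n. a n * of_nat n powr (- s)) sums dirichlet_series a s"
  unfolding dirichlet_series_def
  by (rule summable_sums[OF summable_norm_cancel[OF dirichlet_series_summable_norm[OF assms]]])

lemma dirichlet_series_uniform_limit:
  assumes "c > 1"
  shows "uniform_limit {s. Re s > c} (\<lambda>N s. \<Sum>n<N. a n * of_nat n powr (- s)) (dirichlet_series a) sequentially"
  unfolding dirichlet_series_def[abs_def]
  by (rule Weierstrass_m_test[OF _ summable_ln_powr[OF assms]]) (auto intro!: dirichlet_series_term_le)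

lemma dirichlet_series_holomorphic: "dirichlet_series a holomorphic_on {s. Re s > 1}"
proof (rule holomorphic_uniform_sequence[OF open_halfspace_Re_gt, where f = "\<lambda>N s. \<Sum>n<N. a n * of_nat n powr (- s)"])
  show "(\<lambda>s. \<Sum>n<N. a n * of_nat n powr (- s)) holomorphic_on {s. Re s > 1}" for N
    by (intro holomorphic_intros)
  fix s :: complex assume s: "s \<in> {s. Re s > 1}"
  define c where "c = (1 + Re s) / 2"
  have c: "c > 1" "Re s > c" using s by (auto simp: c_def)
  have "s \<in> {s. Re s > c}" using c by simp
  then obtain d where d: "d > 0" "cball s d \<subseteq> {s. Re s > c}"
    using open_halfspace_Re_gt[of c] open_contains_cball by blast
  then have "cball s d \<subseteq> {s. Re s > 1}" using c by force
  then show "\<exists>d>0. cball s d \<subseteq> {s. 1 < Re s} \<and>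
      uniform_limit (cball s d) (\<lambda>N s. \<Sum>n<N. a n * of_nat n powr - s) (dirichlet_series a) sequentially"
    using d uniform_limit_on_subset[OF dirichlet_series_uniform_limit[OF c(1)] d(2)] by blast
qed

lemma higher_deriv_dirichlet_partial_sum:
  "(deriv ^^ k) (\<lambda>s. \<Sum>n<N. a n * of_nat n powr (- s)) =
    (\<lambda>s. \<Sum>n<N. a n * (- of_real (ln (real n))) ^ k * of_nat n powr (- s))"
proof (induction k)
  case (Suc k)
  have d: "((\<lambda>s. of_nat n powr (- s)) has_field_derivative - of_real (ln (real n)) * of_nat n powr (- s)) (at s)"
    for n :: nat and s :: complex
  proof (cases "n = 0")
    case False
    have "((\<lambda>z. of_nat n powr z) has_field_derivative Ln (of_nat n) * of_nat n powr (- s)) (at (- s))"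
      using False by (intro has_field_derivative_powr_right) auto
    moreover have "(uminus has_field_derivative -1) (at s)" by (auto intro!: derivative_eq_intros)
    ultimately show ?thesis
      using DERIV_chain2[of "\<lambda>z. of_nat n powr z" _ uminus s "-1" UNIV] False Ln_of_real[of "real n"] by simp
  qed auto
  have "((\<lambda>s. \<Sum>n<N. a n * (- of_real (ln (real n))) ^ k * of_nat n powr (- s)) has_field_derivative
      (\<Sum>n<N. a n * (- of_real (ln (real n))) ^ k * (- of_real (ln (real n)) * of_nat n powr (- s)))) (at s)" for s
    by (intro DERIV_sum DERIV_cmult d)
  then have "deriv (\<lambda>s. \<Sum>n<N. a n * (- of_real (ln (real n))) ^ k * of_nat n powr (- s)) s =
      (\<Sum>n<N. a n * (- of_real (ln (real n))) ^ Suc k * of_nat n powr (- s))" for s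
    by (auto dest!: DERIV_imp_deriv simp: mult_ac)
  then show ?case using Suc by auto
qed auto

lemma higher_deriv_dirichlet_series:
  assumes s: "Re s > 1"
  shows "(\<lambda>n. a n * (- of_real (ln (real n))) ^ k * of_nat n powr (- s)) sums (deriv ^^ k) (dirichlet_series a) s"
proof -
  define c where "c = (1 + Re s) / 2"
  have c: "c > 1" "Re s > c" using s by (auto simp: c_def)
  have "(\<lambda>N. (deriv ^^ k) (\<lambda>s. \<Sum>n<N. a n * of_nat n powr (- s)) s) \<longlonglongrightarrow> (deriv ^^ k) (dirichlet_series a) s"
    by (rule higher_deriv_complex_uniform_limit[OF dirichlet_series_uniform_limit[OF c(1)] _ _ open_halfspace_Re_gt])
       (use c in \<open>auto intro!: always_eventually holomorphic_intros\<close>)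
  then show ?thesis unfolding higher_deriv_dirichlet_partial_sum sums_def .
qed

end

lemma mangoldt_coeff_le:
  assumes "\<And>n. norm (chi n) \<le> 1" "n \<ge> 1"
  shows "norm (mangoldt n * chi n :: complex) \<le> 1 + ln (real n)"
proof -
  have "norm (mangoldt n * chi n :: complex) \<le> mangoldt n * 1"
    using assms by (simp add: norm_mult mult_left_le mangoldt_nonneg)
  also have "\<dots> \<le> ln (real n)" using mangoldt_le[of n] assms by simp
  finally show ?thesis by simp
qed

text \<open>This is \<open>\<Sum>\<^sub>d\<^sub>|\<^sub>n mangoldt d = ln n\<close> in terms of generating functions.\<close>

lemma deriv_dirichlet_series_eq:
  assumes mult: "\<And>m n. chi (m * n) = chi m * chi n" and le: "\<And>n. norm (chi n) \<le> 1" and s: "Re s > 1"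
  shows "deriv (dirichlet_series chi) s = - dirichlet_series (\<lambda>n. mangoldt n * chi n) s * dirichlet_series chi s"
proof -
  let ?A = "\<lambda>n. mangoldt n * chi n * of_nat n powr (- s)" and ?B = "\<lambda>n. chi n * of_nat n powr (- s)"
  have chi: "norm (chi n) \<le> 1 + ln (real n)" if "n \<ge> 1" for n using le[of n] that by (simp add: add_increasing2)
  have A: "(?A has_sum dirichlet_series (\<lambda>n. mangoldt n * chi n) s) UNIV"
    using dirichlet_series_summable_norm[OF mangoldt_coeff_le[OF le] s]
      dirichlet_series_sums[OF mangoldt_coeff_le[OF le] s] by (intro norm_summable_imp_has_sum) auto
  have B: "(?B has_sum dirichlet_series chi s) UNIV"
    using dirichlet_series_summable_norm[OF chi s] dirichlet_series_sums[OF chi s]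
    by (intro norm_summable_imp_has_sum) auto
  have absA: "(\<lambda>n. norm (?A n)) summable_on UNIV"
    using dirichlet_series_summable_norm[OF mangoldt_coeff_le[OF le] s] by (intro norm_summable_imp_summable_on) auto
  have absB: "(\<lambda>n. norm (?B n)) summable_on UNIV"
    using dirichlet_series_summable_norm[OF chi s] by (intro norm_summable_imp_summable_on) auto
  have prod: "((\<lambda>(d, m). ?A d * ?B m) has_sum
      dirichlet_series (\<lambda>n. mangoldt n * chi n) s * dirichlet_series chi s) (UNIV \<times> UNIV)"
  proof (rule has_sum_SigmaI)
    have "(\<lambda>x. norm (case x of (d, m) \<Rightarrow> ?A d * ?B m)) summable_on UNIV \<times> UNIV"
      unfolding Infinite_Sum.abs_summable_on_Sigma_iff
      using summable_on_cmult_right[OF absB] summable_on_cmult_left[OF absA]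
      by (auto simp: norm_mult[of "?A _" "?B _"] infsum_cmult_right[OF absB] infsum_nonneg simp del: norm_mult norm_mangoldt)
    then show "(\<lambda>x. case x of (d, m) \<Rightarrow> ?A d * ?B m) summable_on UNIV \<times> UNIV"
      by (rule abs_summable_summable)
    show "((\<lambda>m. case (d, m) of (d, m) \<Rightarrow> ?A d * ?B m) has_sum ?A d * dirichlet_series chi s) UNIV" for d
      using has_sum_cmult_right[OF B, of "?A d"] by simp
    show "((\<lambda>d. ?A d * dirichlet_series chi s) has_sum
        dirichlet_series (\<lambda>n. mangoldt n * chi n) s * dirichlet_series chi s) UNIV"
      using has_sum_cmult_left[OF A, of "dirichlet_series chi s"] .
  qed
  define f where "f = (\<lambda>(n, d). ?A d * ?B (n div d))"
  \<comment> \<open>Terms with an index 0 vanish; on positive indices (d, m) corresponds bijectively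
    to (d m, d), a number together with one of its divisors.\<close>
  have "((\<lambda>(d, m). ?A d * ?B m) has_sum
      dirichlet_series (\<lambda>n. mangoldt n * chi n) s * dirichlet_series chi s) ({1..} \<times> {1..})"
    by (rule has_sum_cong_neutral[THEN iffD1, OF _ _ _ prod]) (auto simp: not_less_eq_eq)
  also have "?this \<longleftrightarrow> (f has_sum
      dirichlet_series (\<lambda>n. mangoldt n * chi n) s * dirichlet_series chi s) (Sigma {1..} (\<lambda>n. {d. d dvd n}))"
    by (rule has_sum_reindex_bij_witness[of _ "\<lambda>(n, d). (d, n div d)" "\<lambda>(d, m). (d * m, d)"])
       (auto simp: f_def Suc_le_eq dvd_div_eq_0_iff intro!: Nat.gr0I)
  finally have "((\<lambda>n. \<Sum>d | d dvd n. f (n, d)) has_sum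
      dirichlet_series (\<lambda>n. mangoldt n * chi n) s * dirichlet_series chi s) {1..}"
    by (rule has_sum_SigmaD) (auto intro!: has_sum_finite)
  also have "?this \<longleftrightarrow> ((\<lambda>n. chi n * of_real (ln (real n)) * of_nat n powr (- s)) has_sum
      dirichlet_series (\<lambda>n. mangoldt n * chi n) s * dirichlet_series chi s) UNIV"
  proof (rule has_sum_cong_neutral)
    fix n :: nat assume "n \<in> {1..} \<inter> UNIV"
    then have n: "n > 0" by simp
    have "(\<Sum>d | d dvd n. f (n, d)) = (\<Sum>d | d dvd n. mangoldt d * (chi n * of_nat n powr (- s)))"
    proof (rule sum.cong[OF refl])
      fix d assume "d \<in> {d. d dvd n}"
      then obtain m where m: "n = d * m" by auto
      have "d > 0" using m n by simp
      then have "f (n, d) = mangoldt d * (chi d * chi m) * (of_nat d powr (- s) * of_nat m powr (- s))"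
        using m by (simp add: f_def mult_ac)
      then show "f (n, d) = mangoldt d * (chi n * of_nat n powr (- s))"
        by (simp add: m mult powr_times_real)
    qed
    also have "\<dots> = of_real (ln (real n)) * (chi n * of_nat n powr (- s))"
      using n mangoldt_sum[of n, where ?'a = complex] by (simp add: sum_distrib_right[symmetric])
    finally show "(\<Sum>d | d dvd n. f (n, d)) = chi n * of_real (ln (real n)) * of_nat n powr (- s)"
      by (simp add: mult_ac)
  qed (auto simp: not_less_eq_eq)
  finally have "(\<lambda>n. chi n * of_real (ln (real n)) * of_nat n powr (- s)) sums
      (dirichlet_series (\<lambda>n. mangoldt n * chi n) s * dirichlet_series chi s)"
    by (rule has_sum_imp_sums)
  from sums_minus[OF this] have "(\<lambda>n. chi n * (- of_real (ln (real n))) * of_nat n powr (- s)) sums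
      (- dirichlet_series (\<lambda>n. mangoldt n * chi n) s * dirichlet_series chi s)"
    by simp
  moreover have "(\<lambda>n. chi n * (- of_real (ln (real n))) * of_nat n powr (- s)) sums deriv (dirichlet_series chi) s"
    using higher_deriv_dirichlet_series[OF chi s, of 1] by simp
  ultimately show ?thesis
    by (rule sums_unique2[symmetric])
qed

text \<open>With D the von Mangoldt series and F a primitive of D on the half-plane, L' = -D L makes
  L exp F constant. Non-vanishing thus spreads from the single point 2.\<close>

lemma dirichlet_series_nonzero:
  assumes mult: "\<And>m n. chi (m * n) = chi m * chi n" and le: "\<And>n. norm (chi n) \<le> 1"
    and nz: "dirichlet_series chi 2 \<noteq> 0" and s: "Re s > 1"
  shows "dirichlet_series chi s \<noteq> 0"
proof -
  let ?H = "{s. Re s > 1}"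
  let ?D = "dirichlet_series (\<lambda>n. mangoldt n * chi n)"
  have chi: "norm (chi n) \<le> 1 + ln (real n)" if "n \<ge> 1" for n using le[of n] that by (simp add: add_increasing2)
  have H: "open ?H" "convex ?H" by (rule open_halfspace_Re_gt convex_halfspace_Re_gt)+
  have D: "?D holomorphic_on ?H" by (rule dirichlet_series_holomorphic[OF mangoldt_coeff_le[OF le]])
  have L: "dirichlet_series chi holomorphic_on ?H" by (rule dirichlet_series_holomorphic[OF chi])
  obtain F where F: "\<And>z. z \<in> ?H \<Longrightarrow> (F has_field_derivative ?D z) (at z)"
    using holomorphic_convex_primitive'[OF H(2,1) D] at_within_open[OF _ H(1)] by metis
  have "((\<lambda>z. dirichlet_series chi z * exp (F z)) has_field_derivative 0) (at z)" if z: "z \<in> ?H" for z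
  proof -
    have "(dirichlet_series chi has_field_derivative deriv (dirichlet_series chi) z) (at z)"
      using holomorphic_derivI[OF L H(1) z] .
    then have "((\<lambda>z. dirichlet_series chi z * exp (F z)) has_field_derivative
        deriv (dirichlet_series chi) z * exp (F z) + exp (F z) * ?D z * dirichlet_series chi z) (at z)"
      by (auto intro!: derivative_eq_intros F[OF z])
    then show ?thesis
      using deriv_dirichlet_series_eq[OF mult le, of z] z by (simp add: algebra_simps)
  qed
  then have "\<exists>c. \<forall>z\<in>?H. dirichlet_series chi z * exp (F z) = c"
    using has_field_derivative_zero_constant[OF H(2), of "\<lambda>z. dirichlet_series chi z * exp (F z)"]
    by (auto intro: has_field_derivative_at_within)
  then have "dirichlet_series chi s * exp (F s) = dirichlet_series chi 2 * exp (F 2)"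
    using s by auto
  then show ?thesis using nz by auto
qed

text \<open>The terms from n = 2 on add up to at most pi^2/6 - 1 < 3/4. The bound anchors both the
  non-vanishing and the Borel-Caratheodory estimate at the centre of the disc, uniformly in the
  character.\<close>

lemma norm_dirichlet_series_2_ge:
  assumes le: "\<And>n. norm (chi n) \<le> 1" and 1: "chi 1 = 1"
  shows "norm (dirichlet_series chi 2) \<ge> 1 / 4"
proof -
  have chi: "norm (chi n) \<le> 1 + ln (real n)" if "n \<ge> 1" for n using le[of n] that by (simp add: add_increasing2)
  let ?f = "\<lambda>n. chi n * of_nat n powr (- 2)"
  have sums: "?f sums dirichlet_series chi 2" using dirichlet_series_sums[OF chi, of 2] by simp
  have inv: "(\<lambda>n. 1 / real ((n + 1) ^ 2)) sums (pi ^ 2 / 6)"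
    using inverse_squares_sums by simp
  have "(\<lambda>n. ?f (n + 2)) sums (dirichlet_series chi 2 - (\<Sum>n<2. ?f n))"
    by (rule sums_split_initial_segment[OF sums])
  moreover have "(\<Sum>n<2. ?f n) = 1" using 1 by (simp add: eval_nat_numeral)
  ultimately have s2: "(\<lambda>n. ?f (n + 2)) sums (dirichlet_series chi 2 - 1)" by simp
  have i2: "(\<lambda>n. 1 / real ((n + 1 + 1) ^ 2)) sums (pi ^ 2 / 6 - (\<Sum>n<1. 1 / real ((n + 1) ^ 2)))"
    by (rule sums_split_initial_segment[OF inv])
  have "norm (?f (n + 2)) \<le> 1 / real ((n + 1 + 1) ^ 2)" for n
  proof -
    have "norm (?f (n + 2)) \<le> 1 * real (n + 2) powr (-2)"
      unfolding norm_mult norm_nat_powr using le[of "n + 2"] by (intro mult_mono) auto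
    then show ?thesis by (simp add: powr_minus_divide powr_numeral add.commute)
  qed
  then have "norm (dirichlet_series chi 2 - 1) \<le> pi ^ 2 / 6 - 1"
    using norm_sums_le[OF s2 i2] by simp
  also have "\<dots> \<le> 3 / 4"
  proof -
    have "pi ^ 2 \<le> 3.2 ^ 2" using pi_less_4 pi_approx by (intro power_mono) auto
    then show ?thesis by (simp add: power2_eq_square)
  qed
  finally show ?thesis
    using norm_triangle_ineq2[of 1 "1 - dirichlet_series chi 2"] by (simp add: norm_minus_commute)
qed

subsection \<open>The L-function of a non-principal character\<close>

definition nonprincipal :: "nat \<Rightarrow> (nat \<Rightarrow> complex) \<Rightarrow> bool" where
  "nonprincipal q chi \<longleftrightarrow> (\<exists>n. \<not> q dvd n \<and> chi n \<noteq> 1)"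

lemma prime_coprime_iff: "prime (q::nat) \<Longrightarrow> coprime n q \<longleftrightarrow> \<not> q dvd n"
  by (metis coprime_commute coprime_absorb_left not_prime_unit prime_imp_coprime_nat)

lemma nonprincipal_sum_eq_0:
  assumes q: "prime q" and chi: "chi \<in> dirichlet_characters q" and np: "nonprincipal q chi"
  shows "(\<Sum>m<q. chi m) = 0"
proof -
  obtain n where n: "\<not> q dvd n" "chi n \<noteq> 1" using np by (auto simp: nonprincipal_def)
  have q0: "q > 0" using prime_gt_0_nat[OF q] .
  have "inj_on (\<lambda>m. n * m mod q) {..<q}"
  proof (rule inj_onI)
    fix a b assume ab: "a \<in> {..<q}" "b \<in> {..<q}" "n * a mod q = n * b mod q"
    then have "[n * a = n * b] (mod q)" by (simp add: cong_def)
    then have "[a = b] (mod q)" using n(1) prime_coprime_iff[OF q] by (simp add: cong_mult_lcancel_nat)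
    then show "a = b" using ab by (simp add: cong_def)
  qed
  moreover have "(\<lambda>m. n * m mod q) ` {..<q} \<subseteq> {..<q}" using q0 by auto
  ultimately have bij: "bij_betw (\<lambda>m. n * m mod q) {..<q} {..<q}"
    by (simp add: bij_betw_def endo_inj_surj)
  have "(\<Sum>m<q. chi m) = (\<Sum>m<q. chi (n * m mod q))"
    using sum.reindex_bij_betw[OF bij, of chi] by simp
  also have "\<dots> = chi n * (\<Sum>m<q. chi m)"
    by (simp add: character_mod[OF chi] character_mult[OF chi] sum_distrib_left)
  finally have "(1 - chi n) * (\<Sum>m<q. chi m) = 0" by (simp add: algebra_simps)
  then show ?thesis using n by simp
qed

text \<open>Full periods cancel, and less than one period remains. Only the logarithm of this bound
  enters the estimate of L'/L.\<close>

lemma norm_character_sum_le: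
  assumes q: "prime q" and chi: "chi \<in> dirichlet_characters q" and np: "nonprincipal q chi"
  shows "norm (\<Sum>m<N. chi m) \<le> real q"
proof (induction N rule: less_induct)
  case (less N)
  show ?case
  proof (cases "N < q")
    case True
    have "norm (\<Sum>m<N. chi m) \<le> (\<Sum>m<N. 1)"
      by (rule order_trans[OF norm_sum]) (intro sum_mono norm_character_le_1[OF chi] prime_gt_0_nat q)
    then show ?thesis using True by simp
  next
    case False
    define M where "M = N - q"
    have N: "N = M + q" using False by (simp add: M_def)
    have "(\<Sum>m<N. chi m) = (\<Sum>m<q. chi m) + (\<Sum>m<M. chi (m + q))"
      unfolding N lessThan_atLeast0 using sum.atLeastLessThan_concat[of 0 q "M + q" chi]
        sum.shift_bounds_nat_ivl[of chi 0 q M] by simp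
    also have "\<dots> = (\<Sum>m<M. chi m)"
      using nonprincipal_sum_eq_0[OF assms] character_add_mult[OF chi, of _ 1] by simp
    finally show ?thesis using less[of M] prime_gt_0_nat[OF q] N by simp
  qed
qed

text \<open>The weight of partial summation, equal to s times the integral of x^(-s-1) over
  [n+1, n+2]; this explains the extra decay.\<close>

definition nat_powr_diff :: "nat \<Rightarrow> complex \<Rightarrow> complex" where
  "nat_powr_diff n s = of_nat (Suc n) powr (- s) - of_nat (Suc (Suc n)) powr (- s)"

lemma norm_nat_powr_diff_le:
  assumes "Re s > -1"
  shows "norm (nat_powr_diff n s) \<le> norm s * real (Suc n) powr (- Re s - 1)"
proof -
  let ?S = "closed_segment (of_nat (Suc n) :: complex) (of_nat (Suc (Suc n)))"
  have S: "z \<in> \<real>" "Re z \<ge> real (Suc n)" if zS: "z \<in> ?S" for z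
  proof -
    obtain u where u: "0 \<le> u" "z = (1 - u) *\<^sub>R of_nat (Suc n) + u *\<^sub>R of_nat (Suc (Suc n))"
      using zS unfolding in_segment by blast
    then have "z = of_real (real (Suc n) + u)" by (simp add: scaleR_conv_of_real algebra_simps)
    then show "z \<in> \<real>" "Re z \<ge> real (Suc n)" using u(1) by auto
  qed
  have "norm ((of_nat (Suc n) :: complex) powr (- s) - of_nat (Suc (Suc n)) powr (- s)) \<le>
      (norm s * real (Suc n) powr (- Re s - 1)) * norm ((of_nat (Suc n) :: complex) - of_nat (Suc (Suc n)))"
  proof (rule field_differentiable_bound[where S = ?S])
    fix z assume z: "z \<in> ?S"
    have "z \<notin> \<real>\<^sub>\<le>\<^sub>0" using S[OF z] by (auto elim!: nonpos_Reals_cases)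
    then show "((\<lambda>z. z powr (- s)) has_field_derivative (- s * z powr (- s - 1))) (at z within ?S)"
      by (intro has_field_derivative_at_within[OF has_field_derivative_powr])
    have "norm (z powr (- s - 1)) = Re z powr (- Re s - 1)"
      using S[OF z] by (subst norm_powr_real_powr) auto
    also have "\<dots> \<le> real (Suc n) powr (- Re s - 1)"
      using S[OF z] assms by (intro powr_mono2') auto
    finally show "norm (- s * z powr (- s - 1)) \<le> norm s * real (Suc n) powr (- Re s - 1)"
      by (simp add: norm_mult mult_left_mono)
  qed auto
  then show ?thesis by (simp add: nat_powr_diff_def)
qed

text \<open>The L-series after partial summation, which converges absolutely for Re s > 0 when the
  character sums are bounded. The inner sum runs up to \<open>chi (n + 1)\<close>, matching the step
  from n + 1 to n + 2 in the weight.\<close>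

definition L_cont :: "(nat \<Rightarrow> complex) \<Rightarrow> complex \<Rightarrow> complex" where
  "L_cont chi s = (\<Sum>n. (\<Sum>m<Suc (Suc n). chi m) * nat_powr_diff n s)"

lemma summable_Suc_powr: "c < -1 \<Longrightarrow> summable (\<lambda>n. real (Suc n) powr c)"
  using summable_Suc_iff[of "\<lambda>n. real n powr c"] summable_real_powr_iff[of c] by simp

context
  fixes q :: nat and chi :: "nat \<Rightarrow> complex"
  assumes q: "prime q" and chi: "chi \<in> dirichlet_characters q" and np: "nonprincipal q chi"
begin

lemma L_cont_term_le:
  assumes "Re s \<ge> c" "c > 0" "norm s \<le> R"
  shows "norm ((\<Sum>m<Suc (Suc n). chi m) * nat_powr_diff n s) \<le> real q * R * real (Suc n) powr (- c - 1)"
proof -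
  have "norm ((\<Sum>m<Suc (Suc n). chi m) * nat_powr_diff n s) \<le> real q * (norm s * real (Suc n) powr (- Re s - 1))"
    unfolding norm_mult using norm_nat_powr_diff_le[of s n] assms
    by (intro mult_mono norm_character_sum_le[OF q chi np]) auto
  also have "\<dots> \<le> real q * (R * real (Suc n) powr (- c - 1))"
    using assms by (intro mult_left_mono mult_mono powr_mono) (auto intro: order_trans[OF norm_ge_zero])
  finally show ?thesis by (simp add: mult_ac)
qed

lemma L_cont_holomorphic: "L_cont chi holomorphic_on {s. Re s > 0}"
proof (rule holomorphic_uniform_sequence[OF open_halfspace_Re_gt,
      where f = "\<lambda>N s. \<Sum>n<N. (\<Sum>m<Suc (Suc n). chi m) * nat_powr_diff n s"])
  show "(\<lambda>s. \<Sum>n<N. (\<Sum>m<Suc (Suc n). chi m) * nat_powr_diff n s) holomorphic_on {s. Re s > 0}" for N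
    unfolding nat_powr_diff_def by (intro holomorphic_intros)
  fix s :: complex assume s: "s \<in> {s. Re s > 0}"
  define c where "c = Re s / 2"
  have c: "c > 0" using s by (simp add: c_def)
  have bd: "Re z \<ge> c" "norm z \<le> norm s + c" if "z \<in> cball s c" for z
  proof -
    have "norm (s - z) \<le> c" using that by (simp add: dist_norm)
    then show "Re z \<ge> c" "norm z \<le> norm s + c"
      using abs_Re_le_cmod[of "s - z"] norm_triangle_ineq[of s "z - s"]
      by (auto simp: c_def norm_minus_commute)
  qed
  have "uniform_limit (cball s c) (\<lambda>N s. \<Sum>n<N. (\<Sum>m<Suc (Suc n). chi m) * nat_powr_diff n s) (L_cont chi) sequentially"
    unfolding L_cont_def[abs_def]
  proof (rule Weierstrass_m_test)
    show "summable (\<lambda>n. real q * (norm s + c) * real (Suc n) powr (- c - 1))"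
      using c by (intro summable_mult summable_Suc_powr) auto
    show "norm ((\<Sum>m<Suc (Suc n). chi m) * nat_powr_diff n z) \<le> real q * (norm s + c) * real (Suc n) powr (- c - 1)"
      if "z \<in> cball s c" for n z using bd[OF that] c by (intro L_cont_term_le) auto
  qed
  moreover have "cball s c \<subseteq> {s. Re s > 0}" using bd c by force
  ultimately show "\<exists>d>0. cball s d \<subseteq> {s. Re s > 0} \<and>
     uniform_limit (cball s d) (\<lambda>N s. \<Sum>n<N. (\<Sum>m<Suc (Suc n). chi m) * nat_powr_diff n s) (L_cont chi) sequentially"
    using c by blast
qed

lemma chi_coeff_le: "n \<ge> 1 \<Longrightarrow> norm (chi n) \<le> 1 + ln (real n)"
  using norm_character_le_1[OF chi prime_gt_0_nat[OF q], of n] by (simp add: add_increasing2)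

lemma L_cont_sums:
  assumes s: "Re s > 0"
  shows "(\<lambda>n. (\<Sum>m<Suc (Suc n). chi m) * nat_powr_diff n s) sums L_cont chi s"
  unfolding L_cont_def
proof (rule summable_sums, rule summable_norm_cancel, rule summable_comparison_test')
  show "summable (\<lambda>n. real q * norm s * real (Suc n) powr (- Re s - 1))"
    using s by (intro summable_mult summable_Suc_powr) auto
  show "norm (norm ((\<Sum>m<Suc (Suc n). chi m) * nat_powr_diff n s)) \<le> real q * norm s * real (Suc n) powr (- Re s - 1)"
    if "n \<ge> 0" for n using L_cont_term_le[of "Re s" s "norm s" n] s by simp
qed

lemma partial_summation:
  "(\<Sum>n<N. chi (Suc n) * of_nat (Suc n) powr (- s)) =
   (\<Sum>n<N. (\<Sum>m<Suc (Suc n). chi m) * nat_powr_diff n s) + (\<Sum>m<Suc N. chi m) * of_nat (Suc N) powr (- s)"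
proof (induction N)
  case 0
  have "chi 0 = 0" using character_eq_0_iff[OF chi, of 0] prime_gt_1_nat[OF q] by auto
  then show ?case by simp
next
  case (Suc N)
  then show ?case by (simp add: nat_powr_diff_def algebra_simps del: of_nat_Suc)
qed

lemma L_cont_L_series_sums:
  assumes s: "Re s > 0"
  shows "(\<lambda>n. chi (Suc n) * of_nat (Suc n) powr (- s)) sums L_cont chi s"
proof -
  have bound: "(\<lambda>N. real q * real (Suc N) powr (- Re s)) \<longlonglongrightarrow> real q * 0"
    using s by (intro tendsto_mult tendsto_const tendsto_neg_powr
        filterlim_compose[OF filterlim_real_sequentially filterlim_Suc]) auto
  have lim: "(\<lambda>N. (\<Sum>m<Suc N. chi m) * of_nat (Suc N) powr (- s)) \<longlonglongrightarrow> 0"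
  proof -
    have "norm ((\<Sum>m<Suc N. chi m) * of_nat (Suc N) powr (- s)) \<le> real q * real (Suc N) powr (- Re s)" for N
      unfolding norm_mult norm_nat_powr
      by (rule mult_right_mono[OF norm_character_sum_le[OF q chi np]]) simp
    moreover note bound[unfolded mult_zero_right]
    ultimately show ?thesis by (rule Lim_null_comparison[OF always_eventually[OF allI]])
  qed
  show ?thesis
    unfolding sums_def partial_summation
    using tendsto_add[OF L_cont_sums[OF s, unfolded sums_def] lim] by (simp only: add_0_right)
qed

lemma L_cont_eq_dirichlet_series:
  assumes "Re s > 1" shows "L_cont chi s = dirichlet_series chi s"
proof -
  have "(\<lambda>n. chi (Suc n) * of_nat (Suc n) powr (- s)) sums (dirichlet_series chi s - chi 0 * of_nat 0 powr (- s))"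
    using dirichlet_series_sums[OF chi_coeff_le assms] by (subst sums_Suc_iff) simp
  then show ?thesis using L_cont_L_series_sums[of s] assms sums_unique2 by force
qed

lemma L_cont_continues: "continues_L_series chi 0 {} (L_cont chi)"
  using L_cont_holomorphic L_cont_L_series_sums by (auto simp: continues_L_series_def)

lemma Dirichlet_L_eq: "Re s > 0 \<Longrightarrow> Dirichlet_L chi s = L_cont chi s"
  by (rule Dirichlet_L_eqI[OF L_cont_continues]) auto

text \<open>Absolute convergence at Re s = 1/2 makes the bound linear in q and |s| with a numerical
  constant, so ln |L| is at most ln q + O(1) on a fixed disc.\<close>

lemma norm_L_cont_le:
  assumes "Re s \<ge> 1 / 2"
  shows "norm (L_cont chi s) \<le> real q * norm s * (\<Sum>n. real (Suc n) powr (- 3 / 2))"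
proof -
  have sm: "summable (\<lambda>n. real (Suc n) powr (- 3 / 2))" by (rule summable_Suc_powr) simp
  have "norm (L_cont chi s) \<le> (\<Sum>n. real q * norm s * real (Suc n) powr (- 3 / 2))"
    unfolding L_cont_def
  proof (rule norm_suminf_le)
    show "summable (\<lambda>n. real q * norm s * real (Suc n) powr (- 3 / 2))" using sm by (rule summable_mult)
    show "norm ((\<Sum>m<Suc (Suc n). chi m) * nat_powr_diff n s) \<le> real q * norm s * real (Suc n) powr (- 3 / 2)" for n
      using L_cont_term_le[of "1/2" s "norm s" n] assms by simp
  qed
  then show ?thesis using suminf_mult[OF sm] by simp
qed

lemma L_cont_2_ge: "norm (L_cont chi 2) \<ge> 1 / 4"
  using norm_dirichlet_series_2_ge[of chi] norm_character_le_1[OF chi prime_gt_0_nat[OF q]] chi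
  by (simp add: L_cont_eq_dirichlet_series)

lemma L_cont_nonzero_gt_1:
  assumes "Re s > 1" shows "L_cont chi s \<noteq> 0"
proof -
  have "L_cont chi 2 \<noteq> 0" using L_cont_2_ge by force
  then have "dirichlet_series chi 2 \<noteq> 0" by (simp add: L_cont_eq_dirichlet_series)
  then show ?thesis
    using dirichlet_series_nonzero[OF character_mult[OF chi]
        norm_character_le_1[OF chi prime_gt_0_nat[OF q]] _ assms] L_cont_eq_dirichlet_series[OF assms] by simp
qed

lemma logderiv_L_cont:
  assumes s: "Re s > 1"
  shows "deriv (L_cont chi) s / L_cont chi s = - dirichlet_series (\<lambda>n. mangoldt n * chi n) s"
proof -
  have "deriv (L_cont chi) s = deriv (dirichlet_series chi) s"
    by (rule deriv_cong_ev)
       (use s L_cont_eq_dirichlet_series in \<open>auto intro!: eventually_mono[OF eventually_nhds_in_open[OF open_halfspace_Re_gt[of 1]]]\<close>)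
  also have "\<dots> = - dirichlet_series (\<lambda>n. mangoldt n * chi n) s * dirichlet_series chi s"
    using s by (intro deriv_dirichlet_series_eq character_mult[OF chi] norm_character_le_1[OF chi prime_gt_0_nat[OF q]])
  finally show ?thesis using L_cont_nonzero_gt_1[OF s] L_cont_eq_dirichlet_series[OF s] by simp
qed

text \<open>The restriction to Re s < 1 reflects the open strip in \<open>GRH\<close>; the line Re s
  = 1 is treated separately.\<close>

lemma GRH_L_cont_nonzero:
  assumes "GRH" "Re s > 1 / 2" "Re s < 1"
  shows "L_cont chi s \<noteq> 0"
proof
  assume "L_cont chi s = 0"
  then have "Dirichlet_L chi s = 0" using Dirichlet_L_eq[of s] assms by simp
  moreover have "0 < Re s" using assms by simp
  ultimately have "Re s = 1 / 2"
    using assms(1) assms(3) chi prime_gt_0_nat[OF q] unfolding GRH_def by blast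
  then show False using assms(2) by simp
qed

end

section \<open>Non-vanishing on the line Re s = 1\<close>

text \<open>Factor f as (w - z)^m g with g nonzero near z: the logarithmic derivative is m / (w - z)
  plus a bounded function. The point \<open>w\<close> with \<open>f w \<noteq> 0\<close> excludes
  the zero function, and m = 0 covers f z \<noteq> 0, so the caller need not know whether z is a
  zero.\<close>

lemma holomorphic_logderiv_near:
  assumes f: "f holomorphic_on S" "open S" "connected S" and z: "z \<in> S" and w: "w \<in> S" "f w \<noteq> 0"
  obtains m C d where "d > 0" "f z = 0 \<longrightarrow> m \<ge> (1::nat)"
    "\<And>t. \<lbrakk>0 < t; t < d\<rbrakk> \<Longrightarrow> Re (deriv f (z + of_real t) / f (z + of_real t)) \<ge> real m / t - C"
proof -
  obtain g r m where gr: "r > 0" "ball z r \<subseteq> S" "g holomorphic_on ball z r" "f z = 0 \<longrightarrow> m \<ge> (1::nat)"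
    "\<And>w. w \<in> ball z r \<Longrightarrow> f w = (w - z) ^ m * g w" "\<And>w. w \<in> ball z r \<Longrightarrow> g w \<noteq> 0"
  proof (cases "f z = 0")
    case True
    have nc: "\<not> f constant_on S"
    proof
      assume "f constant_on S"
      then obtain y where "\<forall>x\<in>S. f x = y" unfolding constant_on_def by blast
      then have "f z = f w" using z w(1) by simp
      then show False using True w(2) by simp
    qed
    show ?thesis
    proof (rule holomorphic_factor_zero_nonconstant[OF f z True nc])
      fix g r and n :: nat
      assume "0 < n" "0 < r" "ball z r \<subseteq> S" "g holomorphic_on ball z r"
        "\<And>w. w \<in> ball z r \<Longrightarrow> f w = (w - z) ^ n * g w" "\<And>w. w \<in> ball z r \<Longrightarrow> g w \<noteq> 0"
      then show ?thesis by (intro that[of r g n]) auto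
    qed
  next
    case False
    have "continuous_on S f" using f holomorphic_on_imp_continuous_on by blast
    then obtain r where r: "r > 0" "ball z r \<subseteq> S" "\<And>w. w \<in> ball z r \<Longrightarrow> f w \<noteq> 0"
    proof -
      have "open (S \<inter> f -` (- {0}))"
        using \<open>continuous_on S f\<close> f(2) by (intro continuous_open_preimage) auto
      moreover have "z \<in> S \<inter> f -` (- {0})" using False z by auto
      ultimately obtain r where "r > 0" "ball z r \<subseteq> S \<inter> f -` (- {0})" using open_contains_ball by blast
      then show ?thesis by (intro that[of r]) auto
    qed
    show ?thesis by (rule that[of r f 0]) (use r holomorphic_on_subset[OF f(1) r(2)] False in auto)
  qed
  define h where "h = (\<lambda>w. deriv g w / g w)"
  have "h holomorphic_on ball z r" unfolding h_def
    using gr by (intro holomorphic_intros holomorphic_deriv) auto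
  then have "continuous_on (cball z (r / 2)) h"
    using gr(1) by (intro continuous_on_subset[OF holomorphic_on_imp_continuous_on]) auto
  then have "bounded (h ` cball z (r / 2))" by (intro compact_imp_bounded compact_continuous_image) auto
  then obtain C where C: "\<And>w. w \<in> cball z (r / 2) \<Longrightarrow> norm (h w) \<le> C"
    unfolding bounded_iff by blast
  have "Re (deriv f (z + of_real t) / f (z + of_real t)) \<ge> real m / t - C" if t: "0 < t" "t < r / 2" for t
  proof -
    define w where "w = z + of_real t"
    have w: "w \<in> ball z r" "w \<in> cball z (r / 2)" "w - z \<noteq> 0" using t by (auto simp: w_def dist_norm)
    have g': "(g has_field_derivative deriv g w) (at w)"
      using gr(3) w(1) by (intro holomorphic_derivI[where S = "ball z r"]) auto
    have "((\<lambda>w. (w - z) ^ m * g w) has_field_derivative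
        of_nat m * (w - z) ^ (m - 1) * g w + (w - z) ^ m * deriv g w) (at w)"
      by (rule derivative_eq_intros g' refl | simp)+
    then have "(f has_field_derivative of_nat m * (w - z) ^ (m - 1) * g w + (w - z) ^ m * deriv g w) (at w)"
      by (rule has_field_derivative_transform_within_open[where S = "ball z r"]) (use w gr(5) in auto)
    then have "deriv f w = of_nat m * (w - z) ^ (m - 1) * g w + (w - z) ^ m * deriv g w"
      by (rule DERIV_imp_deriv)
    moreover have "of_nat m * (w - z) ^ (m - 1) = of_nat m / (w - z) * (w - z) ^ m"
      using w(3) by (cases m) auto
    ultimately have "deriv f w = of_nat m / (w - z) * (w - z) ^ m * g w + (w - z) ^ m * deriv g w"
      by (simp only:)
    then have "deriv f w = (w - z) ^ m * (of_nat m / (w - z) * g w + deriv g w)"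
      by (simp only: distrib_left mult_ac)
    then have "deriv f w / f w = (of_nat m / (w - z) * g w + deriv g w) / g w"
      using gr(5)[OF w(1)] w(3) by simp
    also have "\<dots> = of_nat m / (w - z) + h w"
      using gr(6)[OF w(1)] unfolding h_def add_divide_distrib by simp
    also have "of_nat m / (w - z) = complex_of_real (real m / t)" by (simp add: w_def)
    finally have "Re (deriv f w / f w) = real m / t + Re (h w)" by simp
    then show ?thesis using C[OF w(2)] abs_Re_le_cmod[of "h w"] by (simp add: w_def)
  qed
  then show ?thesis using gr(1,4) that[of "r / 2" m C] by auto
qed

text \<open>The classical argument with \<open>3 + 4 cos \<theta> + cos (2 \<theta>) \<ge> 0\<close>. When \<open>chi\<^sup>2\<close> is non-principal no
  pole is involved, so the real quadratic case does not arise.\<close>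

lemma L_cont_nonzero_Re_1:
  assumes q: "prime q" and chi: "chi \<in> dirichlet_characters q" and np: "nonprincipal q chi"
    and np2: "nonprincipal q (\<lambda>n. chi n * chi n)" and s: "Re s = 1"
  shows "L_cont chi s \<noteq> 0"
proof
  assume zero: "L_cont chi s = 0"
  let ?psi = "\<lambda>n. chi n * chi n"
  have psi: "?psi \<in> dirichlet_characters q" by (rule character_times[OF chi chi])
  let ?H = "{s. Re s > 0}"
  have H: "open ?H" "connected ?H"
    by (rule open_halfspace_Re_gt, rule convex_connected, rule convex_halfspace_Re_gt)
  define s2 where "s2 = Complex 1 (2 * Im s)"
  obtain m1 C1 d1 where d1: "d1 > 0" "L_cont chi s = 0 \<longrightarrow> m1 \<ge> (1::nat)"
    "\<And>t. \<lbrakk>0 < t; t < d1\<rbrakk> \<Longrightarrow> Re (deriv (L_cont chi) (s + of_real t) / L_cont chi (s + of_real t)) \<ge> real m1 / t - C1"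
    by (rule holomorphic_logderiv_near[OF L_cont_holomorphic[OF q chi np] H, of s 2])
       (use L_cont_nonzero_gt_1[OF q chi np, of 2] s in auto)
  note 1 = d1(1) d1(2)[rule_format, OF zero] d1(3)
  obtain m2 C2 d2 where 2: "d2 > 0"
    "\<And>t. \<lbrakk>0 < t; t < d2\<rbrakk> \<Longrightarrow> Re (deriv (L_cont ?psi) (s2 + of_real t) / L_cont ?psi (s2 + of_real t)) \<ge> real m2 / t - C2"
    by (rule holomorphic_logderiv_near[OF L_cont_holomorphic[OF q psi np2] H, of s2 2])
       (use L_cont_nonzero_gt_1[OF q psi np2, of 2] in \<open>auto simp: s2_def\<close>)
  obtain C3 :: real where C3: "C3 > 0"
    "\<And>n. n \<ge> 1 \<Longrightarrow> \<bar>(\<Sum>i=1..n. mangoldt i / real i) - ln (real n)\<bar> \<le> C3"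
    using mertens_prime by metis
  have main: "3 * (1 / t + C3) - 4 * (real m1 / t - C1) - (real m2 / t - C2) \<ge> 0"
    if t: "0 < t" "t < d1" "t < d2" for t
  proof -
    define w1 w2 where "w1 = s + of_real t" and "w2 = s2 + of_real t"
    have w: "Re w1 > 1" "Re w2 > 1" "Re w1 = 1 + t" "Re w2 = 1 + t" "Im w2 = 2 * Im w1"
      using s t by (auto simp: w1_def w2_def s2_def)
    let ?a = "\<lambda>n. mangoldt n * chi n * of_nat n powr (- w1)" and ?b = "\<lambda>n. mangoldt n * ?psi n * of_nat n powr (- w2)"
    \<comment> \<open>The complete von Mangoldt series plays the part of the principal character;
      all that is required of it is an upper bound for its partial sums.\<close>
    let ?c = "\<lambda>n. mangoldt n * real n powr (- 1 - t)"
    have a: "?a sums - (deriv (L_cont chi) w1 / L_cont chi w1)"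
      using dirichlet_series_sums[OF mangoldt_coeff_le[of chi] w(1)] logderiv_L_cont[OF q chi np w(1)]
        norm_character_le_1[OF chi prime_gt_0_nat[OF q]] by simp
    have b: "?b sums - (deriv (L_cont ?psi) w2 / L_cont ?psi w2)"
      using dirichlet_series_sums[OF mangoldt_coeff_le[of ?psi] w(2)] logderiv_L_cont[OF q psi np2 w(2)]
        norm_character_le_1[OF psi prime_gt_0_nat[OF q]] by simp
    have pos: "0 \<le> 3 * ?c n + 4 * Re (?a n) + Re (?b n)" for n
    proof (cases "n = 0")
      case False
      define v where "v = (of_nat n :: complex) powr (- (\<i> * of_real (Im w1)))"
      define u where "u = chi n * v"
      define r where "r = mangoldt n * real n powr (- 1 - t)"
      have e: "- w1 = of_real (- 1 - t) + - (\<i> * of_real (Im w1))"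
        "- w2 = of_real (- 1 - t) + (- (\<i> * of_real (Im w1)) + - (\<i> * of_real (Im w1)))"
        using w by (auto simp: complex_eq_iff)
      have R: "(of_nat n :: complex) powr of_real (- 1 - t) = of_real (real n powr (- 1 - t))"
        using powr_of_real[of "real n" "- 1 - t"] by simp
      have ab: "?a n = of_real r * u" "?b n = of_real r * (u * u)"
        unfolding e powr_add R u_def v_def r_def by (simp_all add: mult_ac)
      have "norm v = 1" using norm_powr_real_powr[of "of_nat n" "- (\<i> * of_real (Im w1))"] False by (simp add: v_def)
      then have "norm u \<le> 1"
        using norm_character_le_1[OF chi prime_gt_0_nat[OF q]] by (simp add: u_def norm_mult)
      then have "norm u ^ 2 \<le> 1" using power_mono[of "norm u" 1 2] by simp
      then have "Re u ^ 2 + Im u ^ 2 \<le> 1" by (simp add: cmod_power2)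
      \<comment> \<open>With |u| \<le> 1 one has 3 + 4 Re u + Re (u^2) \<ge> 2 (1 + Re u)^2. This
        form also covers n divisible by q, where u = 0.\<close>
      moreover have "0 \<le> 2 * (1 + Re u) ^ 2" by simp
      ultimately have "0 \<le> 3 + 4 * Re u + Re (u * u)" by (simp add: power2_eq_square algebra_simps)
      then have "0 \<le> r * (3 + 4 * Re u + Re (u * u))"
        by (intro mult_nonneg_nonneg) (simp add: r_def mangoldt_nonneg)
      then show ?thesis unfolding ab by (simp add: r_def[symmetric] algebra_simps)
    qed auto
    have le: "(\<Sum>n<N. ?c n) \<le> 1 / t + C3" for N
    proof -
      have "(\<Sum>n<N. ?c n) \<le> (\<Sum>n\<in>insert 0 {1..N}. ?c n)"
        by (rule sum_mono2) (auto simp: mangoldt_nonneg)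
      also have "\<dots> = (\<Sum>n=1..N. ?c n)" by simp
      also have "\<dots> = (\<Sum>n=1..N. mangoldt n / real n * real n powr (- t))"
      proof (rule sum.cong[OF refl])
        fix n assume "n \<in> {1..N}"
        then have "real n powr (-1) = 1 / real n" by (simp add: powr_minus_divide)
        moreover have "real n powr (- 1 - t) = real n powr (-1) * real n powr (- t)"
          by (subst powr_add[symmetric]) simp
        ultimately show "?c n = mangoldt n / real n * real n powr (- t)" by simp
      qed
      also have "\<dots> \<le> 1 / t + C3" by (rule abel_weighted_sum_le[OF C3(2) t(1)])
      finally show ?thesis .
    qed
    have "(\<lambda>N. 4 * Re (\<Sum>n<N. ?a n) + Re (\<Sum>n<N. ?b n)) \<longlonglongrightarrow>
       4 * Re (- (deriv (L_cont chi) w1 / L_cont chi w1)) + Re (- (deriv (L_cont ?psi) w2 / L_cont ?psi w2))"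
      using a b unfolding sums_def by (intro tendsto_intros)
    moreover have "4 * Re (\<Sum>n<N. ?a n) + Re (\<Sum>n<N. ?b n) \<ge> - 3 * (1 / t + C3)" for N
    proof -
      have "0 \<le> (\<Sum>n<N. 3 * ?c n + 4 * Re (?a n) + Re (?b n))" by (rule sum_nonneg) (rule pos)
      also have "\<dots> = 3 * (\<Sum>n<N. ?c n) + (4 * Re (\<Sum>n<N. ?a n) + Re (\<Sum>n<N. ?b n))"
        by (simp add: sum.distrib sum_distrib_left)
      finally show ?thesis using le[of N] by simp
    qed
    ultimately have "4 * Re (- (deriv (L_cont chi) w1 / L_cont chi w1)) +
        Re (- (deriv (L_cont ?psi) w2 / L_cont ?psi w2)) \<ge> - 3 * (1 / t + C3)"
      by (intro LIMSEQ_le_const) auto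
    then show ?thesis using 1(3)[OF t(1,2)] 2(2)[OF t(1,3)] by (simp add: w1_def w2_def)
  qed
  define K where "K = 3 * C3 + 4 * \<bar>C1\<bar> + \<bar>C2\<bar> + 1"
  \<comment> \<open>The poles contribute at most 3/t - 4/t = -1/t, since m1 \<ge> 1 and m2 \<ge> 0.
    This t makes it at most -2K, which the constants, bounded by K, cannot make up for.\<close>
  define t where "t = min (min (d1 / 2) (d2 / 2)) (1 / (2 * K))"
  have K: "K > 0" using C3 by (simp add: K_def)
  have t: "0 < t" "t < d1" "t < d2" "t \<le> 1 / (2 * K)"
    using 1(1) 2(1) K by (auto simp: t_def min_def)
  have "1 / t \<ge> 2 * K" using t(1,4) K by (simp add: field_simps)
  moreover have "real m1 / t \<ge> 1 / t" using 1(2) t by (intro divide_right_mono) auto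
  moreover have "real m2 / t \<ge> 0" using t by simp
  moreover have "3 * C3 + 4 * C1 + C2 \<le> K" unfolding K_def by linarith
  moreover have "False" if "2 * K \<le> a" "a \<le> b" "0 \<le> c" "3 * C3 + 4 * C1 + C2 \<le> K" "K > 0"
    "3 * (a + C3) - 4 * (b - C1) - (c - C2) \<ge> 0" for a b c :: real
    using that by (simp add: algebra_simps)
  ultimately show False using main[OF t(1-3)] K by blast
qed

subsection \<open>The logarithmic derivative under GRH\<close>

text \<open>The map w / (2M - w) sends the half-plane Re w < M into the unit disc and fixes 0, so
  the Schwarz lemma applies to its composition with the rescaled g.\<close>

lemma borel_caratheodory:
  assumes hol: "g holomorphic_on ball c R" and c: "g c = 0"
    and Re: "\<And>z. z \<in> ball c R \<Longrightarrow> Re (g z) < M" and z: "z \<in> ball c R"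
  shows "norm (g z) \<le> 2 * M * norm (z - c) / (R - norm (z - c))"
proof -
  have R: "R > 0" using z by (auto intro: le_less_trans[OF zero_le_dist])
  have M: "M > 0" using Re[of c] c R by simp
  define F where "F = (\<lambda>w. g (c + of_real R * w) / (2 * of_real M - g (c + of_real R * w)))"
  have in_ball: "c + of_real R * w \<in> ball c R" if "norm w < 1" for w
    using that R by (simp add: dist_norm norm_mult)
  have nz: "2 * of_real M - g w \<noteq> 0" and lt: "norm (g w) < norm (2 * of_real M - g w)" if "w \<in> ball c R" for w
  proof -
    have "0 < Re (2 * of_real M - g w)" using Re[OF that] M by simp
    then show "2 * of_real M - g w \<noteq> 0" by (metis less_irrefl zero_complex.sel(1))
    have "norm (2 * of_real M - g w) ^ 2 - norm (g w) ^ 2 = 4 * M * (M - Re (g w))"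
      unfolding cmod_power2 by (simp add: power2_eq_square algebra_simps)
    also have "\<dots> > 0" using Re[OF that] M by simp
    finally have "norm (g w) ^ 2 < norm (2 * of_real M - g w) ^ 2" by linarith
    then show "norm (g w) < norm (2 * of_real M - g w)"
      by (rule power_less_imp_less_base) simp
  qed
  have "F holomorphic_on ball 0 1"
  proof -
    have "(\<lambda>w. g (c + of_real R * w)) holomorphic_on ball 0 1"
    proof (rule holomorphic_on_compose_gen[unfolded o_def, OF _ hol])
      show "(\<lambda>w. c + of_real R * w) holomorphic_on ball 0 1" by (intro holomorphic_intros)
      show "(\<lambda>w. c + of_real R * w) ` ball 0 1 \<subseteq> ball c R"
        unfolding image_subset_iff Ball_def mem_ball_0 using in_ball by blast
    qed
    then show ?thesis unfolding F_def using nz in_ball by (intro holomorphic_intros) auto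
  qed
  moreover have "F 0 = 0" by (simp add: F_def c)
  moreover have "norm (F w) < 1" if "norm w < 1" for w
  proof -
    have "norm (2 * of_real M - g (c + of_real R * w)) > 0" using nz[OF in_ball[OF that]] by simp
    then show ?thesis using lt[OF in_ball[OF that]] by (simp add: F_def norm_divide)
  qed
  moreover define w where "w = (z - c) / of_real R"
  moreover have w: "norm w = norm (z - c) / R" using R by (simp add: w_def norm_divide)
  moreover have zc: "norm (z - c) < R" using z by (simp add: dist_norm norm_minus_commute)
  ultimately have "norm (F w) \<le> norm w"
    using R by (intro Schwarz_Lemma(1)) auto
  moreover have "c + of_real R * w = z" using R by (simp add: w_def)
  ultimately have "norm (g z) / norm (2 * of_real M - g z) \<le> norm (z - c) / R"
    using w by (simp add: F_def norm_divide)
  moreover have "norm (2 * of_real M - g z) > 0" using nz[OF z] by simp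
  ultimately have "norm (g z) * R \<le> norm (z - c) * norm (2 * of_real M - g z)"
    using R by (simp add: divide_simps mult_ac)
  also have "\<dots> \<le> norm (z - c) * (2 * M + norm (g z))"
    using norm_triangle_ineq4[of "2 * of_real M" "g z"] M by (intro mult_left_mono) (auto simp: norm_mult)
  finally show ?thesis using zc by (simp add: pos_le_divide_eq algebra_simps)
qed

text \<open>Cauchy's inequality on the circle of radius R bounds the k-th term by B r^k; the
  remainder is a geometric tail.\<close>

lemma taylor_remainder_le:
  assumes hol: "f holomorphic_on ball z R'" and R: "0 < R" "R < R'"
    and B: "\<And>w. norm (z - w) = R \<Longrightarrow> norm (f w) \<le> B"
    and w: "norm (w - z) \<le> r * R" and r: "0 \<le> r" "r < 1"
  shows "norm (f w - (\<Sum>k<K. (deriv ^^ k) f z / fact k * (w - z) ^ k)) \<le> B * r ^ K / (1 - r)"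
proof -
  let ?t = "\<lambda>k. (deriv ^^ k) f z / fact k * (w - z) ^ k"
  have "norm (w - z) < R'" using w r R mult_strict_right_mono[of r 1 R] by linarith
  then have "?t sums f w"
    by (intro holomorphic_power_series[OF hol]) (simp add: dist_norm norm_minus_commute)
  then have 1: "(\<lambda>k. ?t (k + K)) sums (f w - (\<Sum>k<K. ?t k))"
    by (rule sums_split_initial_segment)
  have "(\<lambda>k. r ^ k) sums (1 / (1 - r))" using r by (intro geometric_sums) simp
  then have 2: "(\<lambda>k. B * r ^ K * r ^ k) sums (B * r ^ K * (1 / (1 - r)))" by (rule sums_mult)
  have t_le: "norm (?t k) \<le> B * r ^ k" for k
  proof -
    have "norm ((deriv ^^ k) f z) \<le> fact k * B / R ^ k"
    proof (rule Cauchy_inequality)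
      show "f holomorphic_on ball z R" using R by (intro holomorphic_on_subset[OF hol]) auto
      show "continuous_on (cball z R) f"
        using R by (intro continuous_on_subset[OF holomorphic_on_imp_continuous_on[OF hol]]) auto
    qed (use R B in auto)
    then have "norm ((deriv ^^ k) f z) / fact k \<le> fact k * B / R ^ k / fact k"
      by (rule divide_right_mono) simp
    also have "\<dots> = B / R ^ k" by simp
    finally have t: "norm ((deriv ^^ k) f z / fact k) \<le> B / R ^ k" by (simp add: norm_divide)
    have "norm (?t k) \<le> B / R ^ k * (r * R) ^ k"
      unfolding norm_mult norm_power using w t order_trans[OF norm_ge_zero t]
      by (intro mult_mono power_mono) auto
    then show ?thesis using R by (simp add: power_mult_distrib)
  qed
  have "norm (?t (k + K)) \<le> B * r ^ K * r ^ k" for k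
  proof -
    have "B * r ^ (k + K) = B * r ^ K * r ^ k" by (simp add: power_add mult_ac)
    then show ?thesis using t_le[of "k + K"] by (simp only:)
  qed
  then have "norm (f w - (\<Sum>k<K. ?t k)) \<le> B * r ^ K * (1 / (1 - r))"
    by (rule norm_sums_le[OF 1 2])
  then show ?thesis by simp
qed

text \<open>A non-principal square forces \<open>chi\<close> itself to be non-principal, so both
  L-functions in the 3-4-1 argument are holomorphic for Re s > 0.\<close>

definition admissible :: "nat \<Rightarrow> (nat \<Rightarrow> complex) \<Rightarrow> bool" where
  "admissible q chi \<longleftrightarrow> chi \<in> dirichlet_characters q \<and> nonprincipal q (\<lambda>n. chi n * chi n)"

lemma admissible_nonprincipal: "admissible q chi \<Longrightarrow> nonprincipal q chi"
  by (force simp: admissible_def nonprincipal_def)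

lemma L_cont_nonzero_GRH:
  assumes "GRH" "prime q" "admissible q chi" "Re s > 1 / 2"
  shows "L_cont chi s \<noteq> 0"
  using GRH_L_cont_nonzero[of q chi s] L_cont_nonzero_Re_1[of q chi s] L_cont_nonzero_gt_1[of q chi s]
    admissible_nonprincipal[OF assms(3)] assms unfolding admissible_def
  by (cases "Re s" "1 :: real" rule: linorder_cases) auto

text \<open>Three discs about 2: on radius 3/2, inside Re s > 1/2, a logarithm of L exists and its
  real part is bounded above; Borel-Caratheodory bounds its modulus on radius 29/20; Cauchy's
  inequality with radius 1/20 bounds its derivative on radius 7/5.\<close>

lemma logderiv_bound_GRH:
  obtains C where "C > 0" "\<And>q chi z. \<lbrakk>GRH; prime q; admissible q chi; norm (z - 2) \<le> 7 / 5\<rbrakk> \<Longrightarrow>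
    norm (deriv (L_cont chi) z / L_cont chi z) \<le> C * (ln (real q) + C)"
proof -
  define Z where "Z = (\<Sum>n. real (Suc n) powr (- 3 / 2))"
  have "Z \<ge> 0" unfolding Z_def by (intro suminf_nonneg summable_Suc_powr) auto
  \<comment> \<open>14 = 4 * 7/2 combines 1 / |L(2)| \<le> 4 with |s| \<le> 7/2. The summand 1 makes
    the bound strict, as Borel-Caratheodory demands.\<close>
  define C0 where "C0 = ln (14 * (Z + 1))"
  have C0: "C0 > 0" unfolding C0_def using \<open>Z \<ge> 0\<close> by simp
  have main: "norm (deriv (L_cont chi) z / L_cont chi z) \<le> 1160 * (ln (real q) + C0)"
    if GRH: "GRH" and q: "prime q" and adm: "admissible q chi" and z: "norm (z - 2) \<le> 7 / 5" for q chi z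
  proof -
    let ?L = "L_cont chi" and ?B = "ball (2::complex) (3/2)"
    define M where "M = ln (real q) + C0"
    have chi: "chi \<in> dirichlet_characters q" and np: "nonprincipal q chi"
      using adm admissible_nonprincipal[OF adm] unfolding admissible_def by blast+
    have q0: "real q > 0" using prime_gt_0_nat[OF q] by simp
    have ReB: "Re s > 1 / 2" "norm s \<le> 7 / 2" if "s \<in> ?B" for s
      using that abs_Re_le_cmod[of "2 - s"] norm_triangle_ineq[of 2 "s - 2"]
      by (auto simp: dist_norm norm_minus_commute)
    have "?B \<subseteq> {s. Re s > 0}" using ReB(1) by force
    then have holL: "?L holomorphic_on ?B"
      using L_cont_holomorphic[OF q chi np] holomorphic_on_subset by blast
    have nz: "?L s \<noteq> 0" if "s \<in> ?B" for s
      using L_cont_nonzero_GRH[OF GRH q adm ReB(1)[OF that]] .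
    have "simply_connected ?B" by (intro convex_imp_simply_connected) auto
    obtain g where g: "g holomorphic_on ?B" "\<And>s. s \<in> ?B \<Longrightarrow> ?L s = exp (g s)"
      using simply_connected_eq_holomorphic_log[of ?B] \<open>simply_connected ?B\<close> holL nz by auto
    define h where "h = (\<lambda>s. g s - g 2)"
    have h: "h holomorphic_on ?B" "h 2 = 0" unfolding h_def using g(1) by (auto intro!: holomorphic_intros)
    have Lh: "?L s = ?L 2 * exp (h s)" if "s \<in> ?B" for s
      using g(2)[OF that] g(2)[of 2] by (simp add: h_def exp_diff)
    have Reh: "Re (h s) < M" if s: "s \<in> ?B" for s
    proof -
      have "norm (?L 2) * exp (Re (h s)) = norm (?L s)" using Lh[OF s] by (simp add: norm_mult)
      also have "\<dots> \<le> real q * norm s * Z"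
        unfolding Z_def using ReB(1)[OF s] by (intro norm_L_cont_le[OF q chi np]) simp
      also have "\<dots> \<le> real q * (7 / 2) * Z"
        using ReB(2)[OF s] \<open>Z \<ge> 0\<close> by (intro mult_mono) auto
      finally have "norm (?L 2) * exp (Re (h s)) \<le> real q * (7 / 2) * Z" .
      moreover have "1 / 4 * exp (Re (h s)) \<le> norm (?L 2) * exp (Re (h s))"
        by (rule mult_right_mono[OF L_cont_2_ge[OF q chi np]]) simp
      ultimately have "1 / 4 * exp (Re (h s)) \<le> real q * (7 / 2) * Z" by linarith
      then have "exp (Re (h s)) \<le> real q * (14 * Z)" by simp
      also have "\<dots> < real q * (14 * (Z + 1))" using q0 by simp
      also have "\<dots> = exp M"
        using q0 \<open>Z \<ge> 0\<close> by (simp add: M_def C0_def exp_add)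
      finally show ?thesis by simp
    qed
    \<comment> \<open>58 = 2 * (29/20) / (3/2 - 29/20); the later 1160 is 58 / (1/20).\<close>
    have hbound: "norm (h s) \<le> 58 * M" if s: "norm (s - 2) \<le> 29 / 20" for s
    proof -
      have sB: "s \<in> ?B" using s by (simp add: dist_norm norm_minus_commute)
      have "M > 0" using Reh[of 2] h(2) by simp
      have "norm (h s) \<le> 2 * M * norm (s - 2) / (3 / 2 - norm (s - 2))"
        by (rule borel_caratheodory[OF h Reh sB])
      also have "\<dots> \<le> 2 * M * (29 / 20) / (3 / 2 - 29 / 20)"
        using s \<open>M > 0\<close> by (intro frac_le mult_left_mono) auto
      finally show ?thesis by simp
    qed
    have sub: "cball z (1 / 20) \<subseteq> ?B" "\<And>w. w \<in> cball z (1 / 20) \<Longrightarrow> norm (w - 2) \<le> 29 / 20"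
    proof -
      show *: "norm (w - 2) \<le> 29 / 20" if "w \<in> cball z (1 / 20)" for w
        using that z norm_triangle_ineq[of "w - z" "z - 2"] by (simp add: dist_norm norm_minus_commute)
      show "cball z (1 / 20) \<subseteq> ?B"
      proof
        fix w assume "w \<in> cball z (1 / 20)"
        from *[OF this] show "w \<in> ?B" by (simp add: dist_norm norm_minus_commute)
      qed
    qed
    have "norm ((deriv ^^ 1) h z) \<le> fact 1 * (58 * M) / (1 / 20) ^ 1"
    proof (rule Cauchy_inequality)
      show "h holomorphic_on ball z (1 / 20)"
        using sub(1) ball_subset_cball by (blast intro: holomorphic_on_subset[OF h(1)])
      show "continuous_on (cball z (1 / 20)) h"
        using sub(1) by (blast intro: continuous_on_subset[OF holomorphic_on_imp_continuous_on[OF h(1)]])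
    qed (use hbound sub(2) in \<open>auto simp: dist_norm\<close>)
    then have "norm (deriv h z) \<le> 1160 * M" by simp
    moreover have "deriv ?L z / ?L z = deriv h z"
    proof -
      have zB: "z \<in> ?B" using sub(1) by force
      have "(h has_field_derivative deriv h z) (at z)"
        using h(1) zB by (intro holomorphic_derivI[where S = ?B]) auto
      then have "((\<lambda>s. ?L 2 * exp (h s)) has_field_derivative ?L 2 * (exp (h z) * deriv h z)) (at z)"
        by (auto intro!: derivative_eq_intros)
      then have "(?L has_field_derivative ?L 2 * (exp (h z) * deriv h z)) (at z)"
        by (rule has_field_derivative_transform_within_open[where S = ?B]) (use zB Lh[symmetric] in auto)
      then have "deriv ?L z = ?L z * deriv h z" using Lh[OF zB] by (simp add: DERIV_imp_deriv mult_ac)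
      then show ?thesis using nz[OF zB] by simp
    qed
    ultimately show ?thesis by (simp add: M_def)
  qed
  show ?thesis
  proof (rule that[of "C0 + 1160"])
    show "norm (deriv (L_cont chi) z / L_cont chi z) \<le> (C0 + 1160) * (ln (real q) + (C0 + 1160))"
      if *: "GRH" "prime q" "admissible q chi" "norm (z - 2) \<le> 7 / 5" for q chi z
    proof -
      have "ln (real q) \<ge> 0" using prime_gt_1_nat[OF *(2)] by simp
      then have "1160 * (ln (real q) + C0) \<le> (C0 + 1160) * (ln (real q) + (C0 + 1160))"
        using C0 by (intro mult_mono) auto
      then show ?thesis using main[OF *] by linarith
    qed
  qed (use C0 in simp)
qed

definition trunc_exp :: "nat \<Rightarrow> real \<Rightarrow> real" where
  "trunc_exp K u = (\<Sum>k<K. u ^ k / fact k)"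

text \<open>n^(-s) = n^(-2) exp ((2 - s) ln n) with the exponential series cut after K
  terms.\<close>

definition trunc_weight :: "nat \<Rightarrow> real \<Rightarrow> nat \<Rightarrow> real" where
  "trunc_weight K s n = real n powr (- 2) * trunc_exp K ((2 - s) * ln (real n))"

text \<open>Truncating the Taylor series of \<open>- L'/L\<close> at 2 turns the Dirichlet series into one with the
  rapidly decaying weight \<open>trunc_weight\<close>, which approximates \<open>n powr (- s)\<close> for small \<open>n\<close>. This
  replaces the explicit formula.\<close>

lemma logderiv_approx_GRH:
  obtains C where "C > 0" "\<And>q chi s K. \<lbrakk>GRH; prime q; admissible q chi; \<bar>s - 2\<bar> \<le> 11 / 10\<rbrakk> \<Longrightarrow>
    \<exists>S. (\<lambda>n. mangoldt n * chi n * of_real (trunc_weight K s n)) sums S \<and>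
      norm (- (deriv (L_cont chi) (of_real s) / L_cont chi (of_real s)) - S) \<le> C * (ln (real q) + C) * (4 / 5) ^ K"
proof -
  obtain C where C: "C > 0" "\<And>q chi z. \<lbrakk>GRH; prime q; admissible q chi; norm (z - 2) \<le> 7 / 5\<rbrakk> \<Longrightarrow>
    norm (deriv (L_cont chi) z / L_cont chi z) \<le> C * (ln (real q) + C)"
    by (rule logderiv_bound_GRH) (rule that)
  have main: "\<exists>S. (\<lambda>n. mangoldt n * chi n * of_real (trunc_weight K s n)) sums S \<and>
      norm (- (deriv (L_cont chi) (of_real s) / L_cont chi (of_real s)) - S) \<le> C * (ln (real q) + C) * (4 / 5) ^ K / (1 - 4 / 5)"
    if GRH: "GRH" and q: "prime q" and adm: "admissible q chi" and s: "\<bar>s - 2\<bar> \<le> 11 / 10" for q chi s K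
  proof -
    let ?L = "L_cont chi" and ?B = "ball (2::complex) (3/2)" and ?D = "dirichlet_series (\<lambda>n. mangoldt n * chi n)"
    define f where "f = (\<lambda>z. - (deriv ?L z / ?L z))"
    have chi: "chi \<in> dirichlet_characters q" and np: "nonprincipal q chi"
      using adm admissible_nonprincipal[OF adm] unfolding admissible_def by blast+
    have le: "norm (chi n) \<le> 1" for n by (rule norm_character_le_1[OF chi prime_gt_0_nat[OF q]])
    have ReB: "Re s > 1 / 2" if "s \<in> ?B" for s
      using that abs_Re_le_cmod[of "2 - s"] by (auto simp: dist_norm)
    have "?B \<subseteq> {s. Re s > 0}" using ReB by force
    then have holL: "?L holomorphic_on ?B"
      using L_cont_holomorphic[OF q chi np] holomorphic_on_subset by blast
    have nz: "?L s \<noteq> 0" if "s \<in> ?B" for s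
      using L_cont_nonzero_GRH[OF GRH q adm ReB[OF that]] .
    have f: "f holomorphic_on ?B"
      unfolding f_def using holL nz by (intro holomorphic_intros holomorphic_deriv) auto
    have rem: "norm (f (of_real s) - (\<Sum>k<K. (deriv ^^ k) f 2 / fact k * (of_real s - 2) ^ k)) \<le>
        C * (ln (real q) + C) * (4 / 5) ^ K / (1 - 4 / 5)"
    \<comment> \<open>The ratio 4/5 is admissible because 11/10 \<le> 4/5 * 7/5; the point
      \<open>s\<close> may thus go down to 9/10.\<close>
    proof (rule taylor_remainder_le[OF f, where R = "7 / 5"])
      show "norm (f w) \<le> C * (ln (real q) + C)" if "norm (2 - w) = 7 / 5" for w
        using C(2)[OF GRH q adm, of w] that by (simp add: f_def norm_minus_commute)
      have "norm (complex_of_real s - 2) = \<bar>s - 2\<bar>"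
        by (metis norm_of_real of_real_diff of_real_numeral)
      then show "norm (complex_of_real s - 2) \<le> 4 / 5 * (7 / 5)" using s by simp
    qed auto
    have "(deriv ^^ k) f 2 = (deriv ^^ k) ?D 2" for k
    proof (rule higher_deriv_transform_within_open[where S = "ball 2 1"])
      have Re1: "Re z > 1" if "z \<in> ball 2 1" for z :: complex
        using that abs_Re_le_cmod[of "2 - z"] by (auto simp: dist_norm)
      show "f holomorphic_on ball 2 1" by (rule holomorphic_on_subset[OF f]) auto
      show "?D holomorphic_on ball 2 1"
        by (rule holomorphic_on_subset[OF dirichlet_series_holomorphic[OF mangoldt_coeff_le[OF le]]])
           (use Re1 in auto)
      show "f z = ?D z" if "z \<in> ball 2 1" for z
        using logderiv_L_cont[OF q chi np Re1[OF that]] by (simp add: f_def)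
    qed auto
    then have "(\<lambda>n. mangoldt n * chi n * (- of_real (ln (real n))) ^ k * of_nat n powr (- 2)) sums (deriv ^^ k) f 2" for k
      using higher_deriv_dirichlet_series[OF mangoldt_coeff_le[OF le], where s = 2 and k = k] by simp
    then have "(\<lambda>n. \<Sum>k<K. mangoldt n * chi n * (- of_real (ln (real n))) ^ k * of_nat n powr (- 2) * ((of_real s - 2) ^ k / fact k))
        sums (\<Sum>k<K. (deriv ^^ k) f 2 * ((of_real s - 2) ^ k / fact k))"
      by (intro sums_sum sums_mult2)
    also have "(\<lambda>n. \<Sum>k<K. mangoldt n * chi n * (- of_real (ln (real n))) ^ k * of_nat n powr (- 2) * ((of_real s - 2) ^ k / fact k))
       = (\<lambda>n. mangoldt n * chi n * of_real (trunc_weight K s n))"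
    proof
      fix n
      have p: "(of_nat n :: complex) powr (- 2) = of_real (real n powr (- 2))"
        using powr_of_real[of "real n" "- 2"] by simp
      have k: "(- of_real (ln (real n))) ^ k * (complex_of_real s - 2) ^ k = of_real (((2 - s) * ln (real n)) ^ k)" for k
        by (simp add: power_mult_distrib[symmetric] algebra_simps)
      have "(\<Sum>k<K. mangoldt n * chi n * (- of_real (ln (real n))) ^ k * of_nat n powr (- 2) * ((of_real s - 2) ^ k / fact k))
        = mangoldt n * chi n * of_nat n powr (- 2) * (\<Sum>k<K. (- of_real (ln (real n))) ^ k * (of_real s - 2) ^ k / fact k)"
        by (simp add: sum_distrib_left mult_ac)
      also have "\<dots> = mangoldt n * chi n * of_real (trunc_weight K s n)"
        unfolding k p trunc_weight_def trunc_exp_def by (simp add: mult_ac)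
      finally show "(\<Sum>k<K. mangoldt n * chi n * (- of_real (ln (real n))) ^ k * of_nat n powr (- 2) * ((of_real s - 2) ^ k / fact k))
        = mangoldt n * chi n * of_real (trunc_weight K s n)" .
    qed
    finally have "(\<lambda>n. mangoldt n * chi n * of_real (trunc_weight K s n)) sums
        (\<Sum>k<K. (deriv ^^ k) f 2 / fact k * (of_real s - 2) ^ k)" by (simp add: mult_ac)
    then show ?thesis using rem unfolding f_def by blast
  qed
  show ?thesis
  \<comment> \<open>The factor 5 is 1 / (1 - 4/5) from the geometric tail.\<close>
  proof (rule that[of "5 * C"])
    fix q :: nat and chi :: "nat \<Rightarrow> complex" and s :: real and K :: nat
    assume *: "GRH" "prime q" "admissible q chi" "\<bar>s - 2\<bar> \<le> 11 / 10"
    have "ln (real q) \<ge> 0" using prime_gt_1_nat[OF *(2)] by simp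
    then have "C * (ln (real q) + C) * (4 / 5) ^ K / (1 - 4 / 5) \<le> 5 * C * (ln (real q) + 5 * C) * (4 / 5) ^ K"
      using C(1) by (simp add: field_simps)
    then show "\<exists>S. (\<lambda>n. mangoldt n * chi n * of_real (trunc_weight K s n)) sums S \<and>
      norm (- (deriv (L_cont chi) (of_real s) / L_cont chi (of_real s)) - S) \<le> 5 * C * (ln (real q) + 5 * C) * (4 / 5) ^ K"
      using main[OF *, of K] by (meson order_trans)
  qed (use C in simp)
qed

subsection \<open>The truncated Dirichlet series\<close>

lemma trunc_exp_nonneg: "u \<ge> 0 \<Longrightarrow> trunc_exp K u \<ge> 0"
  unfolding trunc_exp_def by (intro sum_nonneg) auto

lemma exp_real_sums: "(\<lambda>k. u ^ k / fact k) sums exp (u :: real)"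
  using exp_converges[of u] by (simp add: divide_inverse mult.commute)

lemma trunc_exp_le_exp: "u \<ge> 0 \<Longrightarrow> trunc_exp K u \<le> exp u"
  unfolding trunc_exp_def
  using sum_le_suminf[of "\<lambda>k. u ^ k / fact k" "{..<K}"] exp_real_sums[of u] by (auto simp: sums_iff)

text \<open>Rankin's trick: only powers k < K occur, so weighting them by l^(K-k) \<ge> 1 costs l^K
  and replaces exp u by the smaller exp (u/l). This makes the truncated weight decay for large
  n.\<close>

lemma trunc_exp_le_scaled:
  assumes "u \<ge> 0" "l \<ge> 1"
  shows "trunc_exp K u \<le> l ^ K * exp (u / l)"
proof -
  have "trunc_exp K u \<le> (\<Sum>k<K. l ^ K * ((u / l) ^ k / fact k))"
    unfolding trunc_exp_def
  proof (rule sum_mono)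
    fix k assume "k \<in> {..<K}"
    then have "l ^ k \<le> l ^ K" using assms by (intro power_increasing) auto
    then have "l ^ k * ((u / l) ^ k / fact k) \<le> l ^ K * ((u / l) ^ k / fact k)"
      using assms by (intro mult_right_mono) auto
    then show "u ^ k / fact k \<le> l ^ K * ((u / l) ^ k / fact k)"
      using assms by (simp add: power_divide)
  qed
  also have "\<dots> = l ^ K * trunc_exp K (u / l)" by (simp add: trunc_exp_def sum_distrib_left)
  also have "\<dots> \<le> l ^ K * exp (u / l)"
    using assms by (intro mult_left_mono trunc_exp_le_exp) auto
  finally show ?thesis .
qed

text \<open>The same trick for the tail, where all k are at least K: replacing u by l u gains l^K.
  It shows that truncation is harmless for small n.\<close>

lemma exp_minus_trunc_exp_le:
  assumes "u \<ge> 0" "l \<ge> 1"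
  shows "l ^ K * (exp u - trunc_exp K u) \<le> exp (l * u)"
proof -
  have tail: "(\<lambda>k. v ^ (k + K) / fact (k + K)) sums (exp v - trunc_exp K v)" for v :: real
    unfolding trunc_exp_def by (rule sums_split_initial_segment[OF exp_real_sums])
  have "l ^ K * (exp u - trunc_exp K u) \<le> exp (l * u) - trunc_exp K (l * u)"
  proof (rule sums_le[OF _ sums_mult[OF tail[of u]] tail[of "l * u"]])
    fix k
    have "l ^ K \<le> l ^ (k + K)" using assms by (intro power_increasing) auto
    then have "l ^ K * (u ^ (k + K) / fact (k + K)) \<le> l ^ (k + K) * (u ^ (k + K) / fact (k + K))"
      using assms by (intro mult_right_mono) auto
    then show "l ^ K * (u ^ (k + K) / fact (k + K)) \<le> (l * u) ^ (k + K) / fact (k + K)"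
      by (simp only: power_mult_distrib times_divide_eq_right)
  qed
  then show ?thesis using trunc_exp_nonneg[of "l * u" K] assms by simp
qed

context
  fixes s :: real and n :: nat
  assumes s: "9 / 10 \<le> s" "s \<le> 1" and n: "n \<ge> 1"
begin

lemma trunc_weight_nonneg: "trunc_weight K s n \<ge> 0"
  unfolding trunc_weight_def using s n by (intro mult_nonneg_nonneg trunc_exp_nonneg) auto

lemma trunc_weight_le: "trunc_weight K s n \<le> real n powr (- s)"
proof -
  have "trunc_weight K s n \<le> real n powr (- 2) * exp ((2 - s) * ln (real n))"
    unfolding trunc_weight_def using s n by (intro mult_left_mono trunc_exp_le_exp) auto
  also have "exp ((2 - s) * ln (real n)) = real n powr (2 - s)" using n by (simp add: powr_def)
  also have "real n powr (- 2) * real n powr (2 - s) = real n powr (- s)"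
    by (simp add: powr_add[symmetric])
  finally show ?thesis .
qed

text \<open>Scaling by l = 4 gives (2 - s)/4 \<le> 3/10, and -2 + 3/10 = -17/10 is summable. The
  factor 4^K is compensated by n^(2/5) once n > Z.\<close>

lemma trunc_weight_le_large: "trunc_weight K s n \<le> 4 ^ K * real n powr (- 17 / 10)"
proof -
  have "trunc_weight K s n \<le> real n powr (- 2) * (4 ^ K * exp ((2 - s) * ln (real n) / 4))"
    unfolding trunc_weight_def using s n by (intro mult_left_mono trunc_exp_le_scaled) auto
  also have "exp ((2 - s) * ln (real n) / 4) = real n powr ((2 - s) / 4)" using n by (simp add: powr_def)
  also have "\<dots> \<le> real n powr (3 / 10)" using s n by (intro powr_mono) auto
  finally have "trunc_weight K s n \<le> real n powr (- 2) * (4 ^ K * real n powr (3 / 10))"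
    by (simp add: mult_left_mono)
  also have "\<dots> = 4 ^ K * (real n powr (- 2) * real n powr (3 / 10))" by (simp only: mult_ac)
  also have "real n powr (- 2) * real n powr (3 / 10) = real n powr (- 17 / 10)"
    by (subst powr_add[symmetric]) simp
  finally show ?thesis .
qed

text \<open>Scaling by l = 2; the exponent 11/5 bounds 2 (2 - s). The truncation error n^(-2) stays
  summable after multiplication by ln n.\<close>

lemma trunc_weight_ge:
  assumes "real n powr (11 / 5) \<le> 2 ^ K"
  shows "trunc_weight K s n \<ge> real n powr (- s) - real n powr (- 2)"
proof -
  let ?u = "(2 - s) * ln (real n)"
  have "2 ^ K * (exp ?u - trunc_exp K ?u) \<le> exp (2 * ?u)"
    using s n by (intro exp_minus_trunc_exp_le) auto
  also have "\<dots> = real n powr (2 * (2 - s))" using n by (simp add: powr_def)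
  also have "\<dots> \<le> real n powr (11 / 5)" using s n by (intro powr_mono) auto
  also have "\<dots> \<le> 2 ^ K * 1" using assms by simp
  finally have "exp ?u - trunc_exp K ?u \<le> 1" by simp
  then have "real n powr (- 2) * (exp ?u - trunc_exp K ?u) \<le> real n powr (- 2) * 1"
    by (intro mult_left_mono) auto
  moreover have "real n powr (- 2) * exp ?u = real n powr (- s)"
    using n by (simp add: powr_def exp_add[symmetric] algebra_simps)
  ultimately show ?thesis unfolding trunc_weight_def by (simp add: algebra_simps)
qed

end

lemma ln_powr_le: "n \<ge> 1 \<Longrightarrow> ln (real n) * real n powr c \<le> 10 * real n powr (c + 1 / 10)"
  using mult_right_mono[OF ln_le_powr[of "real n" "1 / 10"], of "real n powr c"]
  by (simp add: powr_add mult_ac)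

text \<open>Prime powers, primes beyond \<open>Z\<close> and the truncation error below
  \<open>Y\<close> contribute O(1) uniformly in all parameters. The primes up to \<open>Y\<close>
  point almost in the direction 1, and the middle primes remain as a character sum whose size is not
  estimated here.\<close>

lemma truncated_series_lower_bound:
  obtains C where "C > 0"
    "\<And>chi s Y Z K e S. \<lbrakk>\<forall>n. norm (chi n :: complex) \<le> 1; 9 / 10 \<le> s; s \<le> 1; Y \<le> Z;
       real Y powr (11 / 5) \<le> 2 ^ K; 4 ^ K \<le> real Z powr (2 / 5); 0 \<le> e; e \<le> 1;
       \<forall>p\<le>Y. prime p \<longrightarrow> norm (chi p - 1) \<le> e;
       (\<lambda>n. mangoldt n * chi n * of_real (trunc_weight K s n)) sums S\<rbrakk> \<Longrightarrow>
     Re S \<ge> (1 - e) * (\<Sum>p | prime p \<and> p \<le> Y. ln (real p) * real p powr (- s))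
        - norm (\<Sum>p | prime p \<and> Y < p \<and> p \<le> Z. of_real (ln (real p) * trunc_weight K s p) * chi p) - C"
proof -
  obtain C1 :: real where C1: "C1 > 0"
    "\<And>A. finite A \<Longrightarrow> (\<Sum>n | n \<in> A \<and> \<not> prime n. mangoldt n * real n powr (-9/10)) \<le> C1"
    using mangoldt_nonprime_sum_bounded by blast
  obtain C2 where C2: "C2 > 0" "\<And>A. finite A \<Longrightarrow> (\<Sum>n\<in>A. real n powr (-6/5)) \<le> C2"
    using sum_powr_bounded[of "-6/5"] by auto
  have main: "Re S \<ge> (1 - e) * (\<Sum>p | prime p \<and> p \<le> Y. ln (real p) * real p powr (- s))
        - norm (\<Sum>p | prime p \<and> Y < p \<and> p \<le> Z. of_real (ln (real p) * trunc_weight K s p) * chi p) - (C1 + 10 * C2)"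
    if chi: "\<And>n. norm (chi n :: complex) \<le> 1" and s: "9 / 10 \<le> s" "s \<le> 1" and YZ: "Y \<le> Z"
      and KY: "real Y powr (11 / 5) \<le> 2 ^ K" and KZ: "4 ^ K \<le> real Z powr (2 / 5)"
      and e: "0 \<le> e" "e \<le> 1" "\<And>p. \<lbrakk>prime p; p \<le> Y\<rbrakk> \<Longrightarrow> norm (chi p - 1) \<le> e"
      and S: "(\<lambda>n. mangoldt n * chi n * of_real (trunc_weight K s n)) sums S"
    for chi :: "nat \<Rightarrow> complex" and s e :: real and Y Z K S
  proof -
    let ?W = "trunc_weight K s"
    let ?t = "\<lambda>n. mangoldt n * chi n * of_real (?W n)"
    define b1 where "b1 = (\<lambda>n. if prime n \<and> n \<le> Y then (1 - e) * (ln (real n) * real n powr (- s)) else 0)"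
    define b2 where "b2 = (\<lambda>n. if prime n \<and> Y < n \<and> n \<le> Z then of_real (ln (real n) * ?W n) * chi n else 0)"
    define b3 where "b3 = (\<lambda>n. if \<not> prime n then mangoldt n * real n powr (-9/10) else 0)"
    \<comment> \<open>The summable majorant 10 n^(-6/5) pays both for truncation at the small primes
      and for all primes beyond \<open>Z\<close>.\<close>
    have pointwise: "Re (?t n) \<ge> b1 n + Re (b2 n) - b3 n - 10 * real n powr (- 6 / 5)" for n
    proof (cases "n = 0")
      case True
      then show ?thesis by (simp add: b1_def b2_def b3_def)
    next
      case False
      then have n: "n \<ge> 1" by simp
      have W: "0 \<le> ?W n" "?W n \<le> real n powr (- s)"
        using trunc_weight_nonneg[OF s n] trunc_weight_le[OF s n] by auto
      have Ret: "Re (?t n) = mangoldt n * ?W n * Re (chi n)"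
        by (simp add: mangoldt_def)
      have "\<bar>Re (chi n)\<bar> \<le> 1" using chi[of n] abs_Re_le_cmod[of "chi n"] by linarith
      then have low: "Re (?t n) \<ge> - (mangoldt n * ?W n)"
        using mult_left_mono[of "-1" "Re (chi n)" "mangoldt n * ?W n"] W(1) mangoldt_nonneg[of n]
        unfolding Ret by simp
      consider "\<not> prime n" | "prime n" "n \<le> Y" | "prime n" "Y < n" "n \<le> Z" | "prime n" "n > Z" by linarith
      then show ?thesis
      proof cases
        case 1
        have "?W n \<le> real n powr (-9/10)"
          using W(2) powr_mono[of "- s" "-9/10" "real n"] s n by simp
        then have "mangoldt n * ?W n \<le> b3 n"
          using 1 mult_left_mono[OF _ mangoldt_nonneg[of n]] by (simp add: b3_def)
        moreover have "b1 n = 0" "b2 n = 0" using 1 by (simp_all add: b1_def b2_def)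
        moreover have "real n powr (- 6 / 5) \<ge> 0" by simp
        ultimately show ?thesis using low by (simp del: powr_ge_zero)
      next
        case 2
        have ln: "ln (real n) \<ge> 0" using n by simp
        have "real n powr (11 / 5) \<le> real Y powr (11 / 5)" using 2 by (intro powr_mono2) auto
        then have Wge: "?W n \<ge> real n powr (- s) - real n powr (- 2)"
          using KY by (intro trunc_weight_ge[OF s n]) linarith
        have "Re (chi n) \<ge> 1 - e"
          using e(3)[OF 2] abs_Re_le_cmod[of "chi n - 1"] by simp
        then have "Re (?t n) \<ge> mangoldt n * ?W n * (1 - e)"
          unfolding Ret using W(1) by (intro mult_left_mono mult_nonneg_nonneg mangoldt_nonneg)
        moreover have "mangoldt n * ?W n * (1 - e) = (1 - e) * (ln (real n) * ?W n)"
          using 2 by (simp add: mult_ac)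
        moreover have "(1 - e) * (ln (real n) * ?W n) \<ge> (1 - e) * (ln (real n) * (real n powr (- s) - real n powr (- 2)))"
          using Wge e ln by (intro mult_left_mono) auto
        moreover have "(1 - e) * (ln (real n) * real n powr (- 2)) \<le> 1 * (10 * real n powr (- 6 / 5))"
        proof (rule mult_mono)
          have "ln (real n) * real n powr (- 2) \<le> 10 * real n powr (- 2 + 1 / 10)" by (rule ln_powr_le[OF n])
          also have "\<dots> \<le> 10 * real n powr (- 6 / 5)" using n by (intro mult_left_mono powr_mono) auto
          finally show "ln (real n) * real n powr (- 2) \<le> 10 * real n powr (- 6 / 5)" .
        qed (use e ln in auto)
        moreover have "b1 n = (1 - e) * (ln (real n) * real n powr (- s))" "b2 n = 0" "b3 n = 0"
          using 2 by (simp_all add: b1_def b2_def b3_def)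
        ultimately show ?thesis by (simp add: right_diff_distrib)
      next
        case 3
        then have "b1 n = 0" "b3 n = 0" "b2 n = ?t n"
          by (simp_all add: b1_def b2_def b3_def mult_ac)
        then show ?thesis by simp
      next
        case 4
        have "4 ^ K \<le> real n powr (2 / 5)"
          using KZ 4 powr_mono2[of "2/5" "real Z" "real n"] by simp
        then have "4 ^ K * real n powr (- 17 / 10) \<le> real n powr (2 / 5) * real n powr (- 17 / 10)"
          by (intro mult_right_mono) auto
        also have "\<dots> = real n powr (- 13 / 10)" by (subst powr_add[symmetric]) simp
        finally have "?W n \<le> real n powr (- 13 / 10)" using trunc_weight_le_large[OF s n, of K] by linarith
        then have "ln (real n) * ?W n \<le> ln (real n) * real n powr (- 13 / 10)"
          using n by (intro mult_left_mono) auto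
        also have "\<dots> \<le> 10 * real n powr (- 13 / 10 + 1 / 10)" by (rule ln_powr_le[OF n])
        finally have "mangoldt n * ?W n \<le> 10 * real n powr (- 6 / 5)" using 4 by simp
        moreover have "b1 n = 0" "b2 n = 0" "b3 n = 0"
          using 4 YZ by (simp_all add: b1_def b2_def b3_def)
        ultimately show ?thesis using low by simp
      qed
    qed
    define P1 P2 where "P1 = {p. prime p \<and> p \<le> Y}" and "P2 = {p. prime p \<and> Y < p \<and> p \<le> Z}"
    have lower: "Re (\<Sum>n<N. ?t n) \<ge> (1 - e) * (\<Sum>p\<in>P1. ln (real p) * real p powr (- s))
        - norm (\<Sum>p\<in>P2. of_real (ln (real p) * ?W p) * chi p) - (C1 + 10 * C2)" if N: "N > Z" for N
    proof -
      have "(\<Sum>n<N. b1 n) = (\<Sum>n | n \<in> {..<N} \<and> (prime n \<and> n \<le> Y). (1 - e) * (ln (real n) * real n powr (- s)))"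
        unfolding b1_def by (rule sum.inter_filter[symmetric]) simp
      also have "{n. n \<in> {..<N} \<and> (prime n \<and> n \<le> Y)} = P1" using N YZ by (auto simp: P1_def)
      finally have s1: "(\<Sum>n<N. b1 n) = (1 - e) * (\<Sum>p\<in>P1. ln (real p) * real p powr (- s))"
        by (simp add: sum_distrib_left)
      have "(\<Sum>n<N. b2 n) = (\<Sum>n | n \<in> {..<N} \<and> (prime n \<and> Y < n \<and> n \<le> Z). of_real (ln (real n) * ?W n) * chi n)"
        unfolding b2_def by (rule sum.inter_filter[symmetric]) simp
      also have "{n. n \<in> {..<N} \<and> (prime n \<and> Y < n \<and> n \<le> Z)} = P2" using N by (auto simp: P2_def)
      finally have s2: "(\<Sum>n<N. b2 n) = (\<Sum>p\<in>P2. of_real (ln (real p) * ?W p) * chi p)" .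
      have "(\<Sum>n<N. b3 n) = (\<Sum>n | n \<in> {..<N} \<and> \<not> prime n. mangoldt n * real n powr (-9/10))"
        unfolding b3_def by (rule sum.inter_filter[symmetric]) simp
      then have s3: "(\<Sum>n<N. b3 n) \<le> C1" using C1(2)[of "{..<N}"] by simp
      have "(\<Sum>n<N. b1 n + Re (b2 n) - b3 n - 10 * real n powr (- 6 / 5)) \<le> (\<Sum>n<N. Re (?t n))"
        by (rule sum_mono) (rule pointwise)
      also have "(\<Sum>n<N. b1 n + Re (b2 n) - b3 n - 10 * real n powr (- 6 / 5)) =
          (\<Sum>n<N. b1 n) + Re (\<Sum>n<N. b2 n) - (\<Sum>n<N. b3 n) - 10 * (\<Sum>n<N. real n powr (- 6 / 5))"
        by (simp add: sum.distrib sum_subtractf sum_distrib_left)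
      finally show ?thesis
        using s1 s2 s3 C2(2)[of "{..<N}"] abs_Re_le_cmod[of "\<Sum>n<N. b2 n"] by simp
    qed
    have "(\<lambda>N. Re (\<Sum>n<N. ?t n)) \<longlonglongrightarrow> Re S" using S unfolding sums_def by (intro tendsto_intros)
    then have "(1 - e) * (\<Sum>p\<in>P1. ln (real p) * real p powr (- s))
        - norm (\<Sum>p\<in>P2. of_real (ln (real p) * ?W p) * chi p) - (C1 + 10 * C2) \<le> Re S"
      by (rule LIMSEQ_le_const) (use lower in \<open>auto intro!: exI[of _ "Suc Z"]\<close>)
    then show ?thesis unfolding P1_def P2_def .
  qed
  show ?thesis
    by (rule that[of "C1 + 10 * C2"]) (use C1(1) C2(1) main in auto)
qed

lemma sum_inverse_squares_le:
  assumes "Y \<ge> 1"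
  shows "(\<Sum>n\<in>{Y<..Z}. 1 / real n ^ 2) \<le> 1 / real Y"
proof (cases "Y \<le> Z")
  case True
  have "(\<Sum>n\<in>{Y<..Z}. 1 / real n ^ 2) \<le> 1 / real Y - 1 / real Z"
    using True
  proof (induction Z rule: dec_induct)
    case (step Z)
    have Z: "real Z \<ge> 1" using step assms by simp
    have "{Y<..Suc Z} = insert (Suc Z) {Y<..Z}" using step by auto
    moreover have "1 / real (Suc Z) ^ 2 \<le> 1 / real Z - 1 / real (Suc Z)"
      using Z by (simp add: divide_simps power2_eq_square) 
    ultimately show ?case using step.IH by simp
  qed auto
  then show ?thesis using divide_nonneg_nonneg[of 1 "real Z"] by linarith
qed auto

text \<open>The weight is at most p^(-s), so its square is p^(-2) p^(2(1-s)). When \<open>Z\<close>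
  is a fixed power of ln q the second factor stays bounded, and the squares beyond \<open>Y\<close>
  sum to at most 1/Y.\<close>

lemma tail_variance_le:
  assumes s: "9 / 10 \<le> s" "s \<le> 1" and Y: "Y \<ge> 1"
  shows "(\<Sum>p | prime p \<and> Y < p \<and> p \<le> Z. (ln (real p) * trunc_weight K s p) ^ 2) \<le>
    ln (real Z) ^ 2 * real Z powr (2 * (1 - s)) / real Y"
proof -
  let ?c = "ln (real Z) ^ 2 * real Z powr (2 * (1 - s))"
  have "(\<Sum>p | prime p \<and> Y < p \<and> p \<le> Z. (ln (real p) * trunc_weight K s p) ^ 2) \<le>
    (\<Sum>p\<in>{Y<..Z}. (ln (real p) * trunc_weight K s p) ^ 2)"
    by (rule sum_mono2) auto
  also have "\<dots> \<le> (\<Sum>p\<in>{Y<..Z}. ?c * (1 / real p ^ 2))"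
  proof (rule sum_mono)
    fix p assume p: "p \<in> {Y<..Z}"
    then have p1: "p \<ge> 1" using Y by auto
    have "(ln (real p) * trunc_weight K s p) ^ 2 \<le> (ln (real Z) * real p powr (- s)) ^ 2"
      using p p1 trunc_weight_nonneg[OF s p1] trunc_weight_le[OF s p1] by (intro power_mono mult_mono) auto
    also have "\<dots> = ln (real Z) ^ 2 * (real p powr (2 * (1 - s)) * (1 / real p ^ 2))"
    proof -
      have "(real p powr (- s)) ^ 2 = real p powr (2 * (1 - s) + - 2)"
        using p1 by (simp add: powr_power algebra_simps)
      also have "\<dots> = real p powr (2 * (1 - s)) * (1 / real p ^ 2)"
        using p1 by (simp only: powr_add powr_minus_divide powr_numeral of_nat_0_le_iff)
      finally show ?thesis by (simp add: power_mult_distrib)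
    qed
    also have "\<dots> \<le> ln (real Z) ^ 2 * (real Z powr (2 * (1 - s)) * (1 / real p ^ 2))"
      using p p1 s by (intro mult_left_mono mult_right_mono powr_mono2) auto
    finally show "(ln (real p) * trunc_weight K s p) ^ 2 \<le> ?c * (1 / real p ^ 2)" by (simp add: mult_ac)
  qed
  also have "\<dots> \<le> ?c * (1 / real Y)"
    unfolding sum_distrib_left[symmetric] using Y by (intro mult_left_mono sum_inverse_squares_le) auto
  finally show ?thesis by simp
qed

subsection \<open>Counting characters\<close>

lemma deriv_Dirichlet_L_eq:
  assumes "prime q" "chi \<in> dirichlet_characters q" "nonprincipal q chi" "Re s > 0"
  shows "deriv (Dirichlet_L chi) s = deriv (L_cont chi) s"
proof (rule deriv_cong_ev)
  show "\<forall>\<^sub>F z in nhds s. Dirichlet_L chi z = L_cont chi z"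
    using eventually_nhds_in_open[OF open_halfspace_Re_gt[of 0], of s] assms(4)
    by (auto elim!: eventually_mono simp: Dirichlet_L_eq[OF assms(1-3)])
qed simp

text \<open>Mertens' theorem with weight n^c, c = 1 - s. At n = t and c = A / ln t one has n^c = exp
  A, and the main term becomes ln t * (exp A - 1) / A: the constant of the theorem.\<close>

lemma prime_power_sum_ge:
  obtains C where "C > 0" "\<And>c n. \<lbrakk>c > 0; n \<ge> 1\<rbrakk> \<Longrightarrow>
    (\<Sum>p | prime p \<and> p \<le> n. ln (real p) * real p powr (- (1 - c))) \<ge> (real n powr c - 1) / c - C * real n powr c"
proof -
  obtain C :: real where C: "C > 0"
    "\<And>n. n \<ge> 1 \<Longrightarrow> \<bar>(\<Sum>i=1..n. if prime i then ln (real i) / real i else 0) - ln (real n)\<bar> \<le> C"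
    using mertens_prime by metis
  show ?thesis
  proof (rule that[of "2 * C"])
    fix c :: real and n :: nat assume c: "c > 0" and n: "n \<ge> 1"
    let ?a = "\<lambda>i. if prime i then ln (real i) / real i else 0"
    have "(\<Sum>i=1..n. ?a i * real i powr c) = (\<Sum>i=1..n. if prime i then ln (real i) * real i powr (- (1 - c)) else 0)"
    proof (rule sum.cong[OF refl])
      fix i assume i: "i \<in> {1..n}"
      have "real i powr (- (1 - c)) = real i powr (- 1) * real i powr c" by (subst powr_add[symmetric]) simp
      also have "real i powr (- 1) = 1 / real i" using i by (simp add: powr_minus_divide)
      finally show "?a i * real i powr c = (if prime i then ln (real i) * real i powr (- (1 - c)) else 0)" by simp
    qed
    also have "\<dots> = (\<Sum>i | i \<in> {1..n} \<and> prime i. ln (real i) * real i powr (- (1 - c)))"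
      by (rule sum.inter_filter[symmetric]) simp
    also have "{i. i \<in> {1..n} \<and> prime i} = {p. prime p \<and> p \<le> n}"
      using prime_gt_0_nat by (auto simp: Suc_le_eq)
    finally show "(\<Sum>p | prime p \<and> p \<le> n. ln (real p) * real p powr (- (1 - c))) \<ge> (real n powr c - 1) / c - 2 * C * real n powr c"
      using abel_weighted_sum_ge[OF C(2) c n] by simp
  qed (use C in simp)
qed

text \<open>All parameters are still free. Forced characters, minus those with a large middle sum,
  minus the two with principal square, lie in the set to be counted. The 7 is an upper bound for 2
  pi, and \<open>N \<ge> 7\<close> keeps \<open>1 - 7 / real N\<close> nonnegative.\<close>

lemma card_large_log_deriv_ge:
  obtains C where "C > 0"
    "\<And>A q x s Y Z K k N V. \<lbrakk>GRH; prime q; s = sigma A q; 9 / 10 \<le> s; s < 1; 1 \<le> Y; Y \<le> Z; Y < q;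
      real Y powr (11 / 5) \<le> 2 ^ K; 4 ^ K \<le> real Z powr (2 / 5); Z ^ k < q; N \<ge> 7; V > 0;
      (1 - 7 / real N) * ((real Y powr (1 - s) - 1) / (1 - s) - C * real Y powr (1 - s)) - V - C
        - C * (ln (real q) + C) * (4 / 5) ^ K \<ge>
      ln (ln (real q)) / ln (ln (ln (real q))) * ((exp A - 1) / A * ln (ln (ln (real q))) - x)\<rbrakk> \<Longrightarrow>
     real (card (large_log_deriv_characters A q x)) \<ge>
       real (q - 1) / real N ^ card {p. prime p \<and> p \<le> Y} -
       real q * (real k * (ln (real Z) ^ 2 * real Z powr (2 * (1 - s)) / real Y) / V ^ 2) ^ k - 2"
proof -
  obtain C1 where C1: "C1 > 0" "\<And>q chi s K. \<lbrakk>GRH; prime q; admissible q chi; \<bar>s - 2\<bar> \<le> 11 / 10\<rbrakk> \<Longrightarrow>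
    \<exists>S. (\<lambda>n. mangoldt n * chi n * of_real (trunc_weight K s n)) sums S \<and>
      norm (- (deriv (L_cont chi) (of_real s) / L_cont chi (of_real s)) - S) \<le> C1 * (ln (real q) + C1) * (4 / 5) ^ K"
    by (rule logderiv_approx_GRH) (rule that)
  obtain C2 where C2: "C2 > 0"
    "\<And>chi s Y Z K e S. \<lbrakk>\<forall>n. norm (chi n :: complex) \<le> 1; 9 / 10 \<le> s; s \<le> 1; Y \<le> Z;
       real Y powr (11 / 5) \<le> 2 ^ K; 4 ^ K \<le> real Z powr (2 / 5); 0 \<le> e; e \<le> 1;
       \<forall>p\<le>Y. prime p \<longrightarrow> norm (chi p - 1) \<le> e;
       (\<lambda>n. mangoldt n * chi n * of_real (trunc_weight K s n)) sums S\<rbrakk> \<Longrightarrow>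
     Re S \<ge> (1 - e) * (\<Sum>p | prime p \<and> p \<le> Y. ln (real p) * real p powr (- s))
        - norm (\<Sum>p | prime p \<and> Y < p \<and> p \<le> Z. of_real (ln (real p) * trunc_weight K s p) * chi p) - C2"
    by (rule truncated_series_lower_bound) (rule that)
  obtain C3 where C3: "C3 > 0" "\<And>c n. \<lbrakk>c > 0; n \<ge> 1\<rbrakk> \<Longrightarrow>
    (\<Sum>p | prime p \<and> p \<le> n. ln (real p) * real p powr (- (1 - c))) \<ge> (real n powr c - 1) / c - C3 * real n powr c"
    by (rule prime_power_sum_ge) (rule that)
  define C where "C = C1 + C2 + C3"
  have C: "C > 0" "C1 \<le> C" "C2 \<le> C" "C3 \<le> C" using C1(1) C2(1) C3(1) by (auto simp: C_def)
  show ?thesis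
  proof (rule that[OF C(1)])
    fix A x s V :: real and q Y Z K k N :: nat
    assume GRH: "GRH" and q: "prime q" and s: "s = sigma A q" "9 / 10 \<le> s" "s < 1"
      and YZ: "1 \<le> Y" "Y \<le> Z" "Y < q" and KY: "real Y powr (11 / 5) \<le> 2 ^ K" and KZ: "4 ^ K \<le> real Z powr (2 / 5)"
      and k: "Z ^ k < q" and N: "N \<ge> 7" and V: "V > 0"
      and target: "(1 - 7 / real N) * ((real Y powr (1 - s) - 1) / (1 - s) - C * real Y powr (1 - s)) - V - C
        - C * (ln (real q) + C) * (4 / 5) ^ K \<ge>
        ln (ln (real q)) / ln (ln (ln (real q))) * ((exp A - 1) / A * ln (ln (ln (real q))) - x)"
    let ?X = "dirichlet_characters q"
    define P1 P2 where "P1 = {p. prime p \<and> p \<le> Y}" and "P2 = {p. prime p \<and> Y < p \<and> p \<le> Z}"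
    define a where "a = (\<lambda>p. ln (real p) * trunc_weight K s p)"
    have fin: "finite P1" "finite P2" "finite ?X"
      using finite_characters[OF q] by (auto simp: P1_def P2_def intro: finite_subset[of _ "{..Z}"])
    have N1: "1 \<le> N" using N by simp
    have nd: "\<not> q dvd p" if "p \<in> P1" for p
      using that YZ prime_gt_0_nat by (auto simp: P1_def dest!: dvd_imp_le)
    obtain S where S: "S \<subseteq> ?X" "q - 1 \<le> card S * N ^ card P1"
      "\<And>chi p. \<lbrakk>chi \<in> S; p \<in> P1\<rbrakk> \<Longrightarrow> norm (chi p - 1) \<le> 2 * pi / real N"
      by (rule many_characters_near_1[OF q fin(1) _ N1]) (rule nd, assumption, rule that)
    define E where "E = {chi \<in> ?X. norm (\<Sum>p\<in>P2. of_real (a p) * chi p) > V}"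
    define Q where "Q = {chi \<in> ?X. \<forall>n. \<not> q dvd n \<longrightarrow> chi n ^ 2 = 1}"
    have cardE: "real (card E) \<le> real q * (real k * (ln (real Z) ^ 2 * real Z powr (2 * (1 - s)) / real Y) / V ^ 2) ^ k"
    proof -
      have "real (card E) \<le> real q * (real k * (\<Sum>p\<in>P2. a p ^ 2) / V ^ 2) ^ k"
        unfolding E_def by (rule card_large_character_sums[OF q fin(2) _ k V]) (auto simp: P2_def)
      also have "\<dots> \<le> real q * (real k * (ln (real Z) ^ 2 * real Z powr (2 * (1 - s)) / real Y) / V ^ 2) ^ k"
        using tail_variance_le[of s Y K Z] s YZ unfolding P2_def a_def
        by (intro mult_left_mono power_mono divide_right_mono) (auto intro!: divide_nonneg_nonneg mult_nonneg_nonneg sum_nonneg)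
      finally show ?thesis .
    qed
    have cardQ: "card Q \<le> 2" unfolding Q_def by (rule card_characters_square_principal[OF q])
    have sub: "S - E - Q \<subseteq> large_log_deriv_characters A q x"
    proof
      fix chi assume "chi \<in> S - E - Q"
      then have chiS: "chi \<in> S" and chi: "chi \<in> ?X" and T: "norm (\<Sum>p\<in>P2. of_real (a p) * chi p) \<le> V"
        and "chi \<notin> Q" using S(1) by (auto simp: E_def)
      then have adm: "admissible q chi"
        by (auto simp: admissible_def nonprincipal_def Q_def power2_eq_square)
      have np: "nonprincipal q chi" by (rule admissible_nonprincipal[OF adm])
      obtain F where F: "(\<lambda>n. mangoldt n * chi n * of_real (trunc_weight K s n)) sums F"
        "norm (- (deriv (L_cont chi) (of_real s) / L_cont chi (of_real s)) - F) \<le> C1 * (ln (real q) + C1) * (4 / 5) ^ K"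
        using C1(2)[OF GRH q adm, of s K] s by auto
      have e: "2 * pi / real N \<le> 7 / real N"
        using pi_approx by (intro divide_right_mono) auto
      have "Re F \<ge> (1 - 7 / real N) * (\<Sum>p\<in>P1. ln (real p) * real p powr (- s))
        - norm (\<Sum>p\<in>P2. of_real (a p) * chi p) - C2"
        unfolding P1_def P2_def a_def
      proof (rule C2(2)[OF _ _ _ YZ(2) KY KZ])
        show "\<forall>n. norm (chi n) \<le> 1" using norm_character_le_1[OF chi prime_gt_0_nat[OF q]] by blast
        show "\<forall>p\<le>Y. prime p \<longrightarrow> norm (chi p - 1) \<le> 7 / real N"
        proof (intro allI impI)
          fix p assume "p \<le> Y" "prime p"
          then have "norm (chi p - 1) \<le> 2 * pi / real N" using S(3)[OF chiS, of p] by (simp add: P1_def)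
          then show "norm (chi p - 1) \<le> 7 / real N" using e by linarith
        qed
      qed (use s N F in auto)
      moreover have "(1 - 7 / real N) * (\<Sum>p\<in>P1. ln (real p) * real p powr (- s)) \<ge>
          (1 - 7 / real N) * ((real Y powr (1 - s) - 1) / (1 - s) - C * real Y powr (1 - s))"
      proof (rule mult_left_mono)
        have "C3 * real Y powr (1 - s) \<le> C * real Y powr (1 - s)" using C by (intro mult_right_mono) auto
        moreover have "(real Y powr (1 - s) - 1) / (1 - s) - C3 * real Y powr (1 - s) \<le> (\<Sum>p\<in>P1. ln (real p) * real p powr (- s))"
          using C3(2)[of "1 - s" Y] s(3) YZ(1) by (simp add: P1_def)
        ultimately show "(real Y powr (1 - s) - 1) / (1 - s) - C * real Y powr (1 - s) \<le> (\<Sum>p\<in>P1. ln (real p) * real p powr (- s))"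
          by linarith
      qed (use N in simp)
      moreover have "C1 * (ln (real q) + C1) * (4 / 5) ^ K \<le> C * (ln (real q) + C) * (4 / 5) ^ K"
        using C C1(1) prime_gt_1_nat[OF q] by (intro mult_right_mono mult_mono add_left_mono) auto
      moreover have "Re (- (deriv (L_cont chi) (of_real s) / L_cont chi (of_real s))) \<ge> Re F - C1 * (ln (real q) + C1) * (4 / 5) ^ K"
        using F(2) abs_Re_le_cmod[of "- (deriv (L_cont chi) (of_real s) / L_cont chi (of_real s)) - F"]
        unfolding minus_complex.sel by linarith
      ultimately have "Re (- (deriv (L_cont chi) (of_real s) / L_cont chi (of_real s))) \<ge>
          ln (ln (real q)) / ln (ln (ln (real q))) * ((exp A - 1) / A * ln (ln (ln (real q))) - x)"
        using target T C(3) by linarith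
      then show "chi \<in> large_log_deriv_characters A q x"
        using chi deriv_Dirichlet_L_eq[OF q chi np, of "of_real s"] Dirichlet_L_eq[OF q chi np, of "of_real s"] s
        by (simp add: large_log_deriv_characters_def)
    qed
    have "finite (large_log_deriv_characters A q x)"
      using fin(3) by (rule finite_subset[rotated]) (auto simp: large_log_deriv_characters_def)
    then have "card (S - E - Q) \<le> card (large_log_deriv_characters A q x)" using sub by (intro card_mono)
    moreover have finEQ: "finite E" "finite Q" using fin(3) by (auto simp: E_def Q_def)
    moreover have "card S - card E \<le> card (S - E)" using finEQ(1) by (rule diff_card_le_card_Diff)
    moreover have "card (S - E) - card Q \<le> card (S - E - Q)" using finEQ(2) by (rule diff_card_le_card_Diff)
    ultimately have "real (card S) - real (card E) - real (card Q) \<le> real (card (large_log_deriv_characters A q x))"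
      by linarith
    moreover have "real (q - 1) / real N ^ card P1 \<le> real (card S)"
    proof -
      have "real (q - 1) \<le> real (card S * N ^ card P1)" using S(2) of_nat_le_iff by blast
      then show ?thesis using N by (simp add: pos_divide_le_eq)
    qed
    ultimately show "real (card (large_log_deriv_characters A q x)) \<ge>
       real (q - 1) / real N ^ card {p. prime p \<and> p \<le> Y} -
       real q * (real k * (ln (real Z) ^ 2 * real Z powr (2 * (1 - s)) / real Y) / V ^ 2) ^ k - 2"
      using cardE cardQ unfolding P1_def by linarith
  qed
qed

subsection \<open>Choice of parameters\<close>

text \<open>With \<open>t = ln q\<close>: primes up to \<open>t\<close> are forced, the primes between \<open>t\<close> and \<open>t ^ 20\<close> are
  controlled by the moment of order \<open>2 k\<close>. The forced set has size \<open>q powr (1 - O(ln ln ln t / ln t))\<close> and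
  the exceptional set has size \<open>q powr (1 - \<Omega>(ln ln t / ln t))\<close>, so the former dominates.\<close>

lemma parameters_exist:
  fixes A x C :: real
  assumes A: "A > 0" and x: "x > 0" and C: "C > 0"
  shows "\<forall>\<^sub>F t in at_top. \<exists>Y Z K k N :: nat. \<exists>V.
    1 \<le> Y \<and> Y \<le> Z \<and> real Y \<le> t \<and> real Y powr (11 / 5) \<le> 2 ^ K \<and> 4 ^ K \<le> real Z powr (2 / 5) \<and>
    real (Z ^ k) < exp t \<and> N \<ge> 7 \<and> V > 0 \<and>
    (1 - 7 / real N) * ((real Y powr (A / ln t) - 1) / (A / ln t) - C * real Y powr (A / ln t)) - V - C
        - C * (t + C) * (4 / 5) ^ K \<ge> ln t / ln (ln t) * ((exp A - 1) / A * ln (ln t) - x) \<and>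
    real N ^ card {p. prime p \<and> p \<le> Y} \<le> exp (36 * t * ln (ln (ln t)) / ln t) \<and>
    (real k * (ln (real Z) ^ 2 * real Z powr (2 * (A / ln t)) / real Y) / V ^ 2) ^ k \<le>
      exp (- (t * ln (ln t) / (168 * ln t)))"
proof -
  define D where "D = exp A + C * exp A"
  have ev1: "\<forall>\<^sub>F t in at_top. t \<ge> (4::real)" by real_asymp
  have ev2: "\<forall>\<^sub>F t in at_top. ln t \<ge> (3::real)" by real_asymp
  have ev3: "\<forall>\<^sub>F t in at_top. ln (ln t) \<ge> (3::real)" by real_asymp
  have ev4: "\<forall>\<^sub>F t in at_top. t \<ge> C" by (rule eventually_ge_at_top)
  have ev5: "\<forall>\<^sub>F t in at_top. ln t \<ge> A" by real_asymp
  have ev6: "\<forall>\<^sub>F t in at_top. t powr 20 + 1 \<le> t powr (21::real)" by real_asymp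
  have ev7: "\<forall>\<^sub>F t in at_top. ln (t / 2) \<ge> ln t / (2::real)" by real_asymp
  have ev8: "\<forall>\<^sub>F t in at_top. t / (42 * ln t) - 1 \<ge> t / (84 * ln (t::real))" by real_asymp
  \<comment> \<open>The half of the slack that \<open>V\<close> leaves over exceeds every other
    loss, the largest of order ln t / (ln ln t)^2 coming from the width of the arcs.\<close>
  have ev9: "\<forall>\<^sub>F t in at_top. x * ln t / (2 * ln (ln t)) \<ge>
      D + 7 * ((exp A - 1) / A) * ln t / ln (ln t) ^ 2 + C + 2 * C" using x by real_asymp
  have ev10: "\<forall>\<^sub>F t in at_top. (84 * exp (42 * A) / x ^ 2) * (ln (ln t) ^ 2 / ln t) \<le> exp (- ln (ln t) / 2)"
    using x by real_asymp
  show ?thesis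
    using ev1 ev2 ev3 ev4 ev5 ev6 ev7 ev8 ev9 ev10
  proof eventually_elim
    case (elim t)
    define a where "a = ln t"
    define b where "b = ln a"
    note elim = elim[folded a_def, folded b_def]
    have t: "t > 0" "t \<ge> 4" "exp a = t" using elim by (auto simp: a_def)
    have a: "a \<ge> 3" "a > 0" "exp b = a" using elim by (auto simp: b_def)
    have b: "b \<ge> 3" using elim by simp
    define Y where "Y = nat \<lfloor>t\<rfloor>"
    \<comment> \<open>Exponent 20 is dictated by K: 4^K is at most exp (8 a), which is
      (t^20)^(2/5).\<close>
    define Z where "Z = nat \<lceil>t powr 20\<rceil>"
    \<comment> \<open>Since (4/5)^K \<le> exp (-K/5) \<le> 1/t, this K absorbs the factor ln q = t
      in the Taylor remainder.\<close>
    define K where "K = nat \<lceil>5 * a\<rceil>"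
    \<comment> \<open>From ln Z \<le> 21 a this gives Z^k \<le> exp (t/2) < q, as the moment
      estimate demands.\<close>
    define k where "k = nat \<lfloor>t / (42 * a)\<rfloor>"
    \<comment> \<open>With N of size b^2 the loss 7/N of the main term is O(a / b^2), below the
      slack x a / b, while ln N stays as small as O(ln b).\<close>
    define N where "N = nat \<lceil>b ^ 2\<rceil>"
    define V where "V = x * a / (2 * b)"
    define c where "c = A / a"
    have Y: "real Y \<le> t" "real Y \<ge> t - 1" "real Y \<ge> t / 2" "real Y \<ge> 2"
      using t unfolding Y_def by linarith+
    have Z: "real Z \<ge> t powr 20" "real Z \<le> t powr 20 + 1"
      unfolding Z_def using powr_ge_zero[of t 20] by linarith+
    have K: "real K \<ge> 5 * a" "real K \<le> 5 * a + 1" using a unfolding K_def by linarith+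
    have k: "real k \<le> t / (42 * a)" "real k \<ge> t / (84 * a)"
    proof -
      have "t / (42 * a) \<ge> 0" using t a by simp
      then show "real k \<le> t / (42 * a)" unfolding k_def by linarith
      have "real k \<ge> t / (42 * a) - 1" using \<open>t / (42 * a) \<ge> 0\<close> unfolding k_def by linarith
      then show "real k \<ge> t / (84 * a)" using elim(8) by linarith
    qed
    have b2: "b ^ 2 \<ge> 9" using power_mono[of 3 b 2] b by simp
    have N: "real N \<ge> b ^ 2" "real N \<le> b ^ 2 + 1" "N \<ge> 7" using b2 unfolding N_def by linarith+
    have tp: "t powr r = exp (r * a)" for r using t by (simp add: powr_def a_def)
    have t1: "t powr 1 = t" using t by simp
    have V: "V > 0" using x a b by (simp add: V_def)
    have c: "c > 0" using A a by (simp add: c_def)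
    have Zt: "real Z \<le> t powr 21" using Z(2) elim(6) by linarith
    have "t powr 20 > 0" using t(1) by simp
    then have Zpos: "real Z > 0" using Z(1) by linarith
    have lnZ: "ln (real Z) \<le> 21 * a"
      using ln_mono[OF Zt Zpos] by (simp only: tp ln_exp)
    have lnZ0: "ln (real Z) \<ge> 0"
    proof -
      have "t powr 20 \<ge> 1" using t by (intro ge_one_powr_ge_zero) auto
      then show ?thesis using Z(1) by simp
    qed
    have YZ: "Y \<le> Z"
    proof -
      have "t powr 1 \<le> t powr 20" using t by (intro powr_mono) auto
      then have "real Y \<le> real Z" using Y(1) Z(1) t1 by linarith
      then show ?thesis by simp
    qed
    have cond1: "real Y powr (11 / 5) \<le> 2 ^ K"
    proof -
      have "real Y powr (11 / 5) \<le> t powr (11 / 5)" using Y by (intro powr_mono2) auto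
      also have "\<dots> = exp (11 / 5 * a)" by (rule tp)
      also have "\<dots> \<le> exp (real K * ln 2)"
      proof -
        have "(11 / 5) * a \<le> (5 * a) * (2 / 3)" using a by simp
        also have "\<dots> \<le> real K * ln 2" using K a ln2_ge_two_thirds by (intro mult_mono) auto
        finally show ?thesis by simp
      qed
      also have "\<dots> = 2 ^ K" by (simp add: exp_of_nat_mult)
      finally show ?thesis .
    qed
    have cond2: "4 ^ K \<le> real Z powr (2 / 5)"
    proof -
      have "(4::real) ^ K = exp (real K * ln 4)" by (simp add: exp_of_nat_mult)
      also have "real K * ln 4 \<le> (5 * a + 1) * (25 / 18)"
      proof (rule mult_mono)
        have "ln (4::real) = 2 * ln 2" using ln_realpow[of 2 2] by simp
        then show "ln 4 \<le> (25 / 18 :: real)" using ln2_le_25_over_36 by simp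
      qed (use K a in auto)
      also have "(5 * a + 1) * (25 / 18) \<le> 8 * a" using a by simp
      also have "exp (8 * a) = (t powr 20) powr (2 / 5)" unfolding powr_powr unfolding tp by simp
      also have "\<dots> \<le> real Z powr (2 / 5)" using Z by (intro powr_mono2) auto
      finally show ?thesis by simp
    qed
    have cond3: "real (Z ^ k) < exp t"
    proof -
      have "real (Z ^ k) = exp (real k * ln (real Z))" using Zpos by (simp add: exp_of_nat_mult)
      also have "real k * ln (real Z) \<le> t / (42 * a) * (21 * a)"
        using k(1) lnZ lnZ0 t a by (intro mult_mono) auto
      also have "t / (42 * a) * (21 * a) < t" using t a by simp
      finally show ?thesis by simp
    qed
    have cond4: "(1 - 7 / real N) * ((real Y powr c - 1) / c - C * real Y powr c) - V - C
        - C * (t + C) * (4 / 5) ^ K \<ge> a / b * ((exp A - 1) / A * b - x)"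
    proof -
      define M where "M = (exp A - 1) / A * a"
      have M: "M \<ge> 0" using A a by (simp add: M_def)
      have tc: "t powr c = exp A" using a by (simp add: tp c_def)
      have up: "real Y powr c \<le> exp A" using Y c powr_mono2[of c "real Y" t] by (simp add: tc)
      \<comment> \<open>Rounding t down to \<open>Y\<close> costs at most a factor 1 - c; after
        division by c this is only the additive constant exp A.\<close>
      have low: "real Y powr c \<ge> exp A * (1 - c)"
      proof -
        have "1 - c \<le> exp (- c)" using exp_ge_add_one_self[of "- c"] by simp
        also have "\<dots> \<le> (1 / 2) powr c"
          using ln_2_less_1 c by (simp add: powr_def ln_div mult_left_le)
        finally have "exp A * (1 - c) \<le> t powr c * (1 / 2) powr c" unfolding tc by simp
        also have "\<dots> = (t / 2) powr c" using t by (simp add: powr_mult[symmetric])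
        also have "\<dots> \<le> real Y powr c" using Y t c by (intro powr_mono2) auto
        finally show ?thesis .
      qed
      have "(real Y powr c - 1) / c \<ge> (exp A * (1 - c) - 1) / c" using low c by (intro divide_right_mono) auto
      moreover have "(exp A * (1 - c) - 1) / c = M - exp A"
        using A a by (simp add: M_def c_def field_simps)
      ultimately have X: "(real Y powr c - 1) / c - C * real Y powr c \<ge> M - D"
        using mult_left_mono[OF up, of C] C unfolding D_def by linarith
      have D: "D \<ge> 0" using C by (simp add: D_def)
      have N7: "0 \<le> 1 - 7 / real N" "7 / real N \<le> 7 / b ^ 2" "0 \<le> 7 / real N"
        using N b2 by (auto intro!: divide_left_mono mult_pos_pos)
      have "(1 - 7 / real N) * ((real Y powr c - 1) / c - C * real Y powr c) \<ge> (1 - 7 / real N) * (M - D)"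
        using X N7 by (intro mult_left_mono)
      moreover have "(1 - 7 / real N) * (M - D) = M - D - 7 / real N * M + 7 / real N * D"
        by (simp only: left_diff_distrib right_diff_distrib mult_1)
      moreover have "7 / real N * M \<le> 7 / b ^ 2 * M" using N7 M by (intro mult_right_mono)
      moreover have "7 / real N * D \<ge> 0" using N7 D by (intro mult_nonneg_nonneg)
      moreover have "C * (t + C) * (4 / 5) ^ K \<le> 2 * C"
      proof -
        have "real K * ln (4 / 5) \<le> real K * (- 1 / 5)"
          using ln_le_minus_one[of "4 / 5"] by (intro mult_left_mono) auto
        also have "\<dots> \<le> - a" using K by simp
        finally have "exp (real K * ln (4 / 5)) \<le> exp (- a)" by simp
        moreover have "exp (real K * ln (4 / 5)) = (4 / 5 :: real) ^ K" by (subst exp_of_nat_mult) simp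
        ultimately have "(4 / 5) ^ K \<le> exp (- a)" by simp
        also have "\<dots> = 1 / t" using t by (simp add: exp_minus inverse_eq_divide)
        finally have "C * (t + C) * (4 / 5) ^ K \<le> C * (2 * t) * (1 / t)"
          using C t elim(4) by (intro mult_mono mult_left_mono) auto
        then show ?thesis using t by simp
      qed
      moreover have "7 / b ^ 2 * M = 7 * ((exp A - 1) / A) * a / b ^ 2"
        by (simp only: M_def times_divide_eq_left times_divide_eq_right mult_ac)
      moreover have "a / b * ((exp A - 1) / A * b - x) = M - x * a / b" using b by (simp add: M_def field_simps)
      moreover have "x * a / b = 2 * V" by (simp add: V_def)
      moreover have "V \<ge> D + 7 * ((exp A - 1) / A) * a / b ^ 2 + C + 2 * C" using elim(9) by (simp add: V_def)
      ultimately show ?thesis by linarith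
    qed
    have cond5: "real N ^ card {p. prime p \<and> p \<le> Y} \<le> exp (36 * t * ln b / a)"
    proof -
      have lnY: "ln (real Y) \<ge> a / 2"
      proof -
        have "ln (t / 2) \<le> ln (real Y)" using Y(3) t(1) by (intro ln_mono) auto
        then show ?thesis using elim(7) by linarith
      qed
      have "real (card {p. prime p \<and> p \<le> Y}) \<le> 6 * real Y / ln (real Y)"
        using Y by (intro card_primes_le) simp
      also have "\<dots> \<le> 6 * t / (a / 2)"
        using lnY Y a t by (intro frac_le) auto
      finally have card: "real (card {p. prime p \<and> p \<le> Y}) \<le> 12 * t / a" by simp
      have "b ^ 2 + 1 \<le> 3 * b ^ 2" using b2 by simp
      also have "\<dots> \<le> b * b ^ 2" using b by (intro mult_right_mono) auto
      finally have "real N \<le> b ^ 3" using N by (simp add: power3_eq_cube power2_eq_square)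
      then have "ln (real N) \<le> ln (b ^ 3)" using N by (intro ln_mono) auto
      also have "\<dots> = 3 * ln b" using b by (simp add: ln_realpow)
      finally have lnN: "ln (real N) \<le> 3 * ln b" .
      have "real N ^ card {p. prime p \<and> p \<le> Y} = exp (real (card {p. prime p \<and> p \<le> Y}) * ln (real N))"
        using N by (simp add: exp_of_nat_mult)
      also have "real (card {p. prime p \<and> p \<le> Y}) * ln (real N) \<le> 12 * t / a * (3 * ln b)"
        using card lnN N t a by (intro mult_mono) auto
      finally show ?thesis by (simp add: mult_ac)
    qed
    have cond6: "(real k * (ln (real Z) ^ 2 * real Z powr (2 * c) / real Y) / V ^ 2) ^ k \<le> exp (- (t * b / (168 * a)))"
    proof -
      have "real Z powr (2 * c) \<le> (t powr 21) powr (2 * c)" using Zt c by (intro powr_mono2) auto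
      also have "\<dots> = exp (42 * A)" unfolding powr_powr unfolding tp c_def using a by simp
      finally have Zc: "real Z powr (2 * c) \<le> exp (42 * A)" .
      have "ln (real Z) ^ 2 * real Z powr (2 * c) / real Y \<le> (21 * a) ^ 2 * exp (42 * A) / (t / 2)"
        using lnZ lnZ0 Zc Y t by (intro frac_le mult_mono power_mono) auto
      then have "real k * (ln (real Z) ^ 2 * real Z powr (2 * c) / real Y) / V ^ 2 \<le>
          t / (42 * a) * ((21 * a) ^ 2 * exp (42 * A) / (t / 2)) / V ^ 2"
        using k(1) t a Y by (intro divide_right_mono mult_mono) auto
      also have "\<dots> = (84 * exp (42 * A) / x ^ 2) * (b ^ 2 / a)"
        using t a b x by (simp add: V_def field_simps power2_eq_square)
      \<comment> \<open>The base of the k-th power is O(b^2 / a), hence below a^(-1/2); the k-th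
        power then saves exp (b k / 2).\<close>
      also have "\<dots> \<le> exp (- b / 2)" using elim(10) .
      finally have "(real k * (ln (real Z) ^ 2 * real Z powr (2 * c) / real Y) / V ^ 2) ^ k \<le> exp (- b / 2) ^ k"
        by (intro power_mono) auto
      also have "\<dots> = exp (real k * (- b / 2))" by (simp only: exp_of_nat_mult)
      also have "real k * (- b / 2) \<le> t / (84 * a) * (- b / 2)"
        using k(2) b by (intro mult_right_mono_neg) auto
      also have "t / (84 * a) * (- b / 2) = - (t * b / (168 * a))" by simp
      finally show ?thesis by simp
    qed
    have "1 \<le> Y" using Y(4) by simp
    then show ?case
      unfolding a_def[symmetric] b_def[symmetric] c_def[symmetric]
      using YZ Y(1) cond1 cond2 cond3 N(3) V cond4 cond5 cond6 by blast
  qed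
qed

text \<open>The cost in the first exponent and the saving in the second are both of order t / ln t
  up to the factors ln ln ln t and ln ln t, so the saving wins. As the cost is o(t), the difference
  exceeds q^(1-d) for every fixed d > 0.\<close>

lemma forced_dominates_exceptional:
  fixes d :: real
  assumes d: "d > 0"
  shows "\<forall>\<^sub>F t in at_top. (exp t - 1) / exp (36 * t * ln (ln (ln t)) / ln t)
     - exp t * exp (- (t * ln (ln t) / (168 * ln t))) - 2 \<ge> exp ((1 - d) * t)"
proof -
  have "\<forall>\<^sub>F t in at_top. 36 * t * ln (ln (ln t)) / ln t + 3 \<le> t * ln (ln t) / (168 * ln (t::real))"
    by real_asymp
  moreover have "\<forall>\<^sub>F t in at_top. 36 * t * ln (ln (ln t)) / ln t + 15 \<le> (t::real)"
    by real_asymp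
  moreover have "\<forall>\<^sub>F t in at_top. 36 * t * ln (ln (ln t)) / ln t + 7 \<le> d * (t::real)"
    using d by real_asymp
  moreover have "\<forall>\<^sub>F t in at_top. (1::real) \<le> t" by (rule eventually_ge_at_top)
  ultimately show ?thesis
  proof eventually_elim
    case (elim t)
    define u v where "u = 36 * t * ln (ln (ln t)) / ln t" and "v = t * ln (ln t) / (168 * ln t)"
    note uv = elim[folded u_def v_def]
    have shrink: "(1 + r) * exp y \<le> exp z" if "y + r \<le> z" "r \<ge> 0" for r y z :: real
    proof -
      have "(1 + r) * exp y \<le> exp r * exp y"
        using exp_ge_add_one_self[of r] by (intro mult_right_mono) auto
      also have "\<dots> \<le> exp z" using that by (simp add: exp_add[symmetric] add.commute)
      finally show ?thesis .
    qed
    \<comment> \<open>Budget in units of exp (t - u): 1/2 is available, 1/4 goes to the exceptional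
      set and 1/8 to the constant 2; the remaining 1/8 covers the target.\<close>
    have "4 * exp (t - v) \<le> exp (t - u)" using shrink[of "t - v" 3 "t - u"] uv by simp
    moreover have "16 * exp 0 \<le> exp (t - u)" using shrink[of 0 15 "t - u"] uv by simp
    moreover have "8 * exp ((1 - d) * t) \<le> exp (t - u)"
      using shrink[of "(1 - d) * t" 7 "t - u"] uv by (simp add: algebra_simps)
    moreover have "(exp t - 1) / exp u \<ge> exp (t - u) / 2"
    proof -
      have "exp t \<ge> 2" using uv(4) exp_ge_add_one_self[of t] by linarith
      then have "(exp t / 2) / exp u \<le> (exp t - 1) / exp u" by (intro divide_right_mono) auto
      then show ?thesis by (simp add: exp_diff)
    qed
    moreover have "exp t * exp (- v) = exp (t - v)" by (simp add: exp_diff exp_minus divide_inverse)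
    ultimately show ?case unfolding u_def[symmetric] v_def[symmetric] exp_zero by linarith
  qed
qed

theorem theorem4:
  fixes A x :: real
  assumes "GRH" and "A > 0" and "x > 0"
  shows "\<exists>\<epsilon> :: nat \<Rightarrow> real. \<epsilon> \<longlonglongrightarrow> 0 \<and>
    (\<forall>\<^sub>F q in sequentially. prime q \<longrightarrow>
       real (card (large_log_deriv_characters A q x)) \<ge> real q powr (1 - exp (- x) + \<epsilon> q))"
proof -
  obtain C where C: "C > 0"
    "\<And>A q x s Y Z K k N V. \<lbrakk>GRH; prime q; s = sigma A q; 9 / 10 \<le> s; s < 1; 1 \<le> Y; Y \<le> Z; Y < q;
      real Y powr (11 / 5) \<le> 2 ^ K; 4 ^ K \<le> real Z powr (2 / 5); Z ^ k < q; N \<ge> 7; V > 0;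
      (1 - 7 / real N) * ((real Y powr (1 - s) - 1) / (1 - s) - C * real Y powr (1 - s)) - V - C
        - C * (ln (real q) + C) * (4 / 5) ^ K \<ge>
      ln (ln (real q)) / ln (ln (ln (real q))) * ((exp A - 1) / A * ln (ln (ln (real q))) - x)\<rbrakk> \<Longrightarrow>
     real (card (large_log_deriv_characters A q x)) \<ge>
       real (q - 1) / real N ^ card {p. prime p \<and> p \<le> Y} -
       real q * (real k * (ln (real Z) ^ 2 * real Z powr (2 * (1 - s)) / real Y) / V ^ 2) ^ k - 2"
    by (rule card_large_log_deriv_ge) (rule that)
  have lim: "filterlim (\<lambda>q. ln (real q)) at_top sequentially"
    by (rule filterlim_compose[OF ln_at_top filterlim_real_sequentially])
  have sigma_ev: "\<forall>\<^sub>F t in at_top. 9 / 10 \<le> 1 - A / ln t \<and> 0 < ln (t::real)"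
    using assms(2) by (intro eventually_conj; real_asymp)
  \<comment> \<open>The saving d is taken to be exp (- x), which is fixed and positive.\<close>
  have "\<forall>\<^sub>F q in sequentially. prime q \<longrightarrow>
       real (card (large_log_deriv_characters A q x)) \<ge> real q powr (1 - exp (- x) + 0)"
    using eventually_compose_filterlim[OF parameters_exist[OF assms(2,3) C(1)] lim]
      eventually_compose_filterlim[OF forced_dominates_exceptional[of "exp (- x)"] lim, OF exp_gt_zero]
      eventually_compose_filterlim[OF sigma_ev lim] eventually_gt_at_top[of 0]
  proof eventually_elim
    case (elim q)
    define t where "t = ln (real q)"
    note elim = elim[folded t_def]
    have qt: "real q = exp t" using elim(4) by (simp add: t_def)
    obtain Y Z K k N :: nat and V where par: "1 \<le> Y" "Y \<le> Z" "real Y \<le> t"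
      "real Y powr (11 / 5) \<le> 2 ^ K" "4 ^ K \<le> real Z powr (2 / 5)" "real (Z ^ k) < exp t" "N \<ge> 7" "V > 0"
      "(1 - 7 / real N) * ((real Y powr (A / ln t) - 1) / (A / ln t) - C * real Y powr (A / ln t)) - V - C
        - C * (t + C) * (4 / 5) ^ K \<ge> ln t / ln (ln t) * ((exp A - 1) / A * ln (ln t) - x)"
      "real N ^ card {p. prime p \<and> p \<le> Y} \<le> exp (36 * t * ln (ln (ln t)) / ln t)"
      "(real k * (ln (real Z) ^ 2 * real Z powr (2 * (A / ln t)) / real Y) / V ^ 2) ^ k \<le>
         exp (- (t * ln (ln t) / (168 * ln t)))"
      using elim(1) by blast
    show ?case
    proof
      assume q: "prime q"
      have s: "sigma A q = 1 - A / ln t" "1 - sigma A q = A / ln t" by (simp_all add: sigma_def t_def)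
      have s1: "9 / 10 \<le> sigma A q" "sigma A q < 1" using elim(3) assms(2) unfolding s(1) by auto
      have "real Y < real q" using par(3) exp_ge_add_one_self[of t] qt by linarith
      then have Yq: "Y < q" by simp
      have Zq: "Z ^ k < q" using par(6) unfolding qt[symmetric] by (simp only: of_nat_less_iff)
      have "real (card (large_log_deriv_characters A q x)) \<ge>
        real (q - 1) / real N ^ card {p. prime p \<and> p \<le> Y} -
        real q * (real k * (ln (real Z) ^ 2 * real Z powr (2 * (1 - sigma A q)) / real Y) / V ^ 2) ^ k - 2"
        by (rule C(2)[OF assms(1) q refl s1 par(1,2) Yq par(4,5) Zq par(7,8)])
           (use par(9) in \<open>simp add: s(2) t_def\<close>)
      moreover have "real (q - 1) / real N ^ card {p. prime p \<and> p \<le> Y} \<ge>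
          (exp t - 1) / exp (36 * t * ln (ln (ln t)) / ln t)"
        using par(7,10) prime_gt_1_nat[OF q] by (simp add: of_nat_diff qt[symmetric]) (intro divide_left_mono; simp)
      moreover have "real q * (real k * (ln (real Z) ^ 2 * real Z powr (2 * (1 - sigma A q)) / real Y) / V ^ 2) ^ k
          \<le> exp t * exp (- (t * ln (ln t) / (168 * ln t)))"
        unfolding s(2) qt using par(11) by (intro mult_left_mono) auto
      moreover have "real q powr (1 - exp (- x) + 0) = exp ((1 - exp (- x)) * t)"
        using elim(4) by (simp add: powr_def t_def)
      ultimately show "real (card (large_log_deriv_characters A q x)) \<ge> real q powr (1 - exp (- x) + 0)"
        using elim(2) by linarith
    qed
  qed
  then show ?thesis by (intro exI[of _ "\<lambda>_. 0"]) auto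
qed

end
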